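(* Let $g_0$ be the flat metric on the $2$-torus $\mathbb{T}^2=\mathbb{R}^2/\mathbb{Z}^2$. There exists a family of smooth functions $h_{\varepsilon}\colon\mathbb{T}^2\to\mathbb{R}$ (indexed by small $\varepsilon>0$) such that, at almost every point of $\mathbb{T}^2$, $\nabla h_{\varepsilon}$ tends to a unit vector of irrational slope as $\varepsilon\to 0$, such that $F_{\varepsilon,t}=\sqrt{g_0}+t\,dh_{\varepsilon}$ is a (Randers) Finsler metric for all $\varepsilon$ and all $0\le t<1$, and such that the following holds: for all $\varepsilon,t$, $(\mathbb{T}^2,F_{\varepsilon,t})$ has the same volume, the same geodesic flow up to a trivial time-change, and the same marked length spectrum as $(\mathbb{T}^2,g_0)$, but $$\lim_{(\varepsilon,t)\to(0,1)}\lambda_1(F_{\varepsilon,t})=+\infty.$$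
   Context: A Finsler metric on a manifold $M$ of dimension $n$ is a continuous function $F\colon TM\to[0,\infty)$ that is $C^2$ off the zero section, satisfies $F(x,\lambda v)=\lambda F(x,v)$ for $\lambda>0$, satisfies $F(x,v)=0$ only if $v=0$, and is such that the Hessian $\left(\partial^2F^2/\partial v_i\partial v_j\right)$ is positive definite. A Randers metric is a Finsler metric of the form $\sqrt g+\beta$ with $g$ Riemannian and $\beta$ a $1$-form. Let $HM=(TM\smallsetminus\{0\})/\mathbb{R}^+$ (positive rescaling), $\pi\colon HM\to M$ the projection, $H_xM=\pi^{-1}(x)$. The Hilbert form $A$ on $HM$ is $A_{(x,\xi)}(Z)=\lim_{s\to0}s^{-1}\left(F(x,v+s\, d\pi(Z))-F(x,v)\right)$, where $v\in T_xM$ is any vector in the direction $\xi$. It is a contact form, and the geodesic vector field $X$ of $F$ on $HM$ is its Reeb field ($A(X)=1$, $i_XdA=0$); the geodesic flow is the flow of $X$ on $HM$. There is a unique volume form $\Omega^F$ on $M$ and an $(n-1)$-form $\alpha^F$ on $HM$ (unique as an angle measure on the fibers) with $\alpha^F\wedge\pi^*\Omega^F=A\wedge dA^{n-1}$ and $\int_{H_xM}\alpha^F=\mathrm{vol}_{\mathrm{Eucl}}(\mathbb{S}^{n-1})$ for all $x$. The volume of $(M,F)$ is $\int_M\Omega^F$ (the Holmes–Thompson volume up to a constant factor). The BF-Laplacian is $\Delta^Ff(x)=\frac{n}{\mathrm{vol}_{\mathrm{Eucl}}(\mathbb{S}^{n-1})}\int_{H_xM}L_X^2(\pi^*f)\,\alpha^F$.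 Its Rayleigh quotient is $R^F(f)=E^F(f)/\int_Mf^2\,\Omega^F$, with $E^F(f)=\frac{n}{\mathrm{vol}_{\mathrm{Eucl}}(\mathbb{S}^{n-1})}\int_{HM}|L_X(\pi^*f)|^2\,A\wedge dA^{n-1}$. For $M$ closed the spectrum is discrete, $0=\lambda_0<\lambda_1\leq\lambda_2\leq\dots$, and given by $\lambda_k(F)=\inf_{V_k}\sup\{R^F(f)\mid f\in V_k\smallsetminus\{0\}\}$, where $V_k$ runs over the $(k+1)$-dimensional subspaces of $H^1(M)$. Two Finsler manifolds have the same marked length spectrum if there is an isomorphism of their fundamental groups such that corresponding free homotopy classes contain closed geodesics of the same lengths. A trivial time-change of a flow is a time change such that the original flow and the time-changed flow are smoothly conjugate. The gradient $\nabla$ and unit vectors are with respect to $g_0$. *)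

theory Defs
  imports "HOL-Analysis.Analysis"
begin

text \<open>
  Objects on the torus \<open>R^2 / Z^2\<close> are represented by their lifts to the universal cover: functions
  on the torus are \<open>Z^2\<close>-periodic functions on \<^typ>\<open>real^2\<close>, integrals over the torus are
  integrals over a unit cell, and the fundamental group is the group \<open>Z^2\<close> of deck transformations
  (it is abelian, so its elements are also the free homotopy classes of loops).
\<close>

definition lattice :: "(real^2) set" where
  "lattice = {k. \<forall>i. k $ i \<in> \<int>}"

definition torus_periodic :: "(real^2 \<Rightarrow> 'b) \<Rightarrow> bool" where
  "torus_periodic f \<longleftrightarrow> (\<forall>x. \<forall>k\<in>lattice. f (x + k) = f x)"

definition cell :: "(real^2) set" where
  "cell = {x. \<forall>i. 0 \<le> x $ i \<and> x $ i \<le> 1}"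

text \<open>\<open>Ck_on k f S\<close> is meant for open \<open>S\<close> and finite-dimensional domains.\<close>

primrec Ck_on :: "nat \<Rightarrow> ('a::real_normed_vector \<Rightarrow> 'b::real_normed_vector) \<Rightarrow> 'a set \<Rightarrow> bool" where
  "Ck_on 0 f S \<longleftrightarrow> continuous_on S f"
| "Ck_on (Suc n) f S \<longleftrightarrow> (\<forall>x\<in>S. f differentiable (at x)) \<and>
     (\<forall>v. Ck_on n (\<lambda>x. frechet_derivative f (at x) v) S)"

definition smooth :: "('a::real_normed_vector \<Rightarrow> 'b::real_normed_vector) \<Rightarrow> bool" where
  "smooth f \<longleftrightarrow> (\<forall>k. Ck_on k f UNIV)"

definition grad :: "(real^2 \<Rightarrow> real) \<Rightarrow> real^2 \<Rightarrow> real^2" where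
  "grad f x = (\<chi> i. frechet_derivative f (at x) (axis i 1))"


section \<open>Finsler and Randers metrics on the torus\<close>

type_synonym finsler = "real^2 \<Rightarrow> real^2 \<Rightarrow> real"

definition hessian :: "(real^2 \<Rightarrow> real) \<Rightarrow> real^2 \<Rightarrow> real^2^2" where
  "hessian G v = (\<chi> i j. frechet_derivative
     (\<lambda>u. frechet_derivative G (at u) (axis j 1)) (at v) (axis i 1))"

definition finsler_metric :: "finsler \<Rightarrow> bool" where
  "finsler_metric F \<longleftrightarrow>
     torus_periodic F \<and>
     (\<forall>x v. 0 \<le> F x v) \<and>
     continuous_on UNIV (\<lambda>(x, v). F x v) \<and>
     Ck_on 2 (\<lambda>(x, v). F x v) {(x, v). v \<noteq> 0} \<and>
     (\<forall>x v l. 0 < l \<longrightarrow> F x (l *\<^sub>R v) = l * F x v) \<and>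
     (\<forall>x v. F x v = 0 \<longrightarrow> v = 0) \<and>
     (\<forall>x v w. v \<noteq> 0 \<longrightarrow> w \<noteq> 0 \<longrightarrow> 0 < w \<bullet> (hessian (\<lambda>u. (F x u)\<^sup>2) v *v w))"

definition riemannian_metric :: "(real^2 \<Rightarrow> real^2 \<Rightarrow> real^2 \<Rightarrow> real) \<Rightarrow> bool" where
  "riemannian_metric g \<longleftrightarrow>
     torus_periodic g \<and>
     (\<forall>v w. smooth (\<lambda>x. g x v w)) \<and>
     (\<forall>x. bilinear (g x)) \<and>
     (\<forall>x v w. g x v w = g x w v) \<and>
     (\<forall>x v. v \<noteq> 0 \<longrightarrow> 0 < g x v v)"

definition one_form :: "(real^2 \<Rightarrow> real^2 \<Rightarrow> real) \<Rightarrow> bool" where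
  "one_form \<beta> \<longleftrightarrow>
     torus_periodic \<beta> \<and> (\<forall>v. smooth (\<lambda>x. \<beta> x v)) \<and> (\<forall>x. linear (\<beta> x))"

definition randers :: "(real^2 \<Rightarrow> real^2 \<Rightarrow> real^2 \<Rightarrow> real) \<Rightarrow> (real^2 \<Rightarrow> real^2 \<Rightarrow> real) \<Rightarrow> finsler" where
  "randers g \<beta> = (\<lambda>x v. sqrt (g x v v) + \<beta> x v)"

definition randers_metric :: "finsler \<Rightarrow> bool" where
  "randers_metric F \<longleftrightarrow> finsler_metric F \<and>
     (\<exists>g \<beta>. riemannian_metric g \<and> one_form \<beta> \<and> F = randers g \<beta>)"

definition flat_metric :: "real^2 \<Rightarrow> real^2 \<Rightarrow> real^2 \<Rightarrow> real" where
  "flat_metric x v w = v \<bullet> w"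

definition flat_finsler :: finsler where
  "flat_finsler = (\<lambda>x v. sqrt (flat_metric x v v))"


section \<open>The homogenized tangent bundle and the Hilbert form\<close>

text \<open>
  The homogenized bundle \<open>HM = (TM - 0) / R^+\<close> is parametrized by its universal cover: the pair
  \<open>(x, \<theta>)\<close> stands for the class of the vector \<open>dir \<theta>\<close> at \<open>x\<close>, and \<open>hm_eq\<close> says that two
  pairs give the same point. The projection to \<open>M\<close> is \<^const>\<open>fst\<close>.
\<close>

type_synonym hm = "(real^2) \<times> real"

definition dir :: "real \<Rightarrow> real^2" where
  "dir \<theta> = vector [cos \<theta>, sin \<theta>]"

definition hm_eq :: "hm \<Rightarrow> hm \<Rightarrow> bool" where
  "hm_eq p q \<longleftrightarrow> fst q - fst p \<in> lattice \<and> (\<exists>m\<in>\<int>. snd q - snd p = 2 * pi * m)"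

definition hilbert_form :: "finsler \<Rightarrow> hm \<Rightarrow> hm \<Rightarrow> real" where
  "hilbert_form F p Z = Lim (at 0)
     (\<lambda>s::real. (F (fst p) (dir (snd p) + s *\<^sub>R fst Z) - F (fst p) (dir (snd p))) / s)"

definition ext_deriv :: "('a::real_normed_vector \<Rightarrow> 'a \<Rightarrow> real) \<Rightarrow> 'a \<Rightarrow> 'a \<Rightarrow> 'a \<Rightarrow> real" where
  "ext_deriv a p Y Z =
     frechet_derivative (\<lambda>q. a q Z) (at p) Y - frechet_derivative (\<lambda>q. a q Y) (at p) Z"

text \<open>The wedge product of a covector with an alternating bilinear form.\<close>

definition wedge12 :: "('a \<Rightarrow> real) \<Rightarrow> ('a \<Rightarrow> 'a \<Rightarrow> real) \<Rightarrow> 'a \<Rightarrow> 'a \<Rightarrow> 'a \<Rightarrow> real" where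
  "wedge12 a b X Y Z = a X * b Y Z - a Y * b X Z + a Z * b X Y"

text \<open>\<open>A \<and> dA^(n-1)\<close> for \<open>n = 2\<close>.\<close>

definition contact_volume :: "finsler \<Rightarrow> hm \<Rightarrow> hm \<Rightarrow> hm \<Rightarrow> hm \<Rightarrow> real" where
  "contact_volume F p = wedge12 (hilbert_form F p) (ext_deriv (hilbert_form F) p)"

definition geodesic_field :: "finsler \<Rightarrow> hm \<Rightarrow> hm" where
  "geodesic_field F p = (THE X. hilbert_form F p X = 1 \<and>
     (\<forall>Y. ext_deriv (hilbert_form F) p X Y = 0))"


section \<open>Volume\<close>

text \<open>
  \<open>ht_forms F \<Omega> \<alpha>\<close>: the 2-form \<open>\<Omega>\<close> on the torus and the 1-form \<open>\<alpha>\<close> on \<open>HM\<close> satisfy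
  \<open>\<alpha> \<and> \<pi>^* \<Omega> = A \<and> dA\<close>, and \<open>\<alpha>\<close> has integral \<open>vol(S^1) = 2 \<pi>\<close> on every fibre. Only the
  restriction of \<open>\<alpha>\<close> to the fibres is determined by this, whereas \<open>\<Omega>\<close> is unique.
  Fibres are oriented by increasing \<open>\<theta>\<close>; then \<open>\<Omega>\<close> is a negative multiple of \<open>dx \<and> dy\<close>. As
  usual for volume forms, \<open>\<Omega>\<close> and \<open>A \<and> dA\<close> are integrated with respect to the orientation they
  define, that is, as the densities given by their absolute values on the standard frame.
\<close>

definition ht_forms :: "finsler \<Rightarrow> (real^2 \<Rightarrow> real^2 \<Rightarrow> real^2 \<Rightarrow> real) \<Rightarrow> (hm \<Rightarrow> hm \<Rightarrow> real) \<Rightarrow> bool" where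
  "ht_forms F \<Omega> \<alpha> \<longleftrightarrow>
     torus_periodic \<Omega> \<and>
     (\<forall>x. bilinear (\<Omega> x) \<and> (\<forall>v. \<Omega> x v v = 0) \<and> \<Omega> x \<noteq> (\<lambda>v w. 0)) \<and>
     (\<forall>v w. continuous_on UNIV (\<lambda>x. \<Omega> x v w)) \<and>
     (\<forall>p q. hm_eq p q \<longrightarrow> \<alpha> p = \<alpha> q) \<and>
     (\<forall>p. linear (\<alpha> p)) \<and>
     (\<forall>Z. continuous_on UNIV (\<lambda>p. \<alpha> p Z)) \<and>
     (\<forall>p. wedge12 (\<alpha> p) (\<lambda>Y Z. \<Omega> (fst p) (fst Y) (fst Z)) = contact_volume F p) \<and>
     (\<forall>x. ((\<lambda>\<theta>. \<alpha> (x, \<theta>) (0, 1)) has_integral 2 * pi) {0..2 * pi})"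

definition ht_volume_form :: "finsler \<Rightarrow> real^2 \<Rightarrow> real^2 \<Rightarrow> real^2 \<Rightarrow> real" where
  "ht_volume_form F = (THE \<Omega>. \<exists>\<alpha>. ht_forms F \<Omega> \<alpha>)"

definition ht_density :: "finsler \<Rightarrow> real^2 \<Rightarrow> real" where
  "ht_density F x = \<bar>ht_volume_form F x (axis 1 1) (axis 2 1)\<bar>"

definition contact_density :: "finsler \<Rightarrow> hm \<Rightarrow> real" where
  "contact_density F p = \<bar>contact_volume F p (axis 1 1, 0) (axis 2 1, 0) (0, 1)\<bar>"

definition ht_volume :: "finsler \<Rightarrow> real" where
  "ht_volume F = (LINT x:cell|lborel. ht_density F x)"


section \<open>Geodesic flow and trivial time-changes\<close>

definition is_flow_of :: "(real \<Rightarrow> hm \<Rightarrow> hm) \<Rightarrow> (hm \<Rightarrow> hm) \<Rightarrow> bool" where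
  "is_flow_of \<phi> X \<longleftrightarrow> (\<forall>p. \<phi> 0 p = p \<and>
     (\<forall>s. ((\<lambda>r. \<phi> r p) has_vector_derivative X (\<phi> s p)) (at s)))"

definition geodesic_flow :: "finsler \<Rightarrow> (real \<Rightarrow> hm \<Rightarrow> hm) \<Rightarrow> bool" where
  "geodesic_flow F \<phi> \<longleftrightarrow> is_flow_of \<phi> (geodesic_field F)"

definition time_change :: "(real \<Rightarrow> hm \<Rightarrow> hm) \<Rightarrow> (real \<Rightarrow> hm \<Rightarrow> hm) \<Rightarrow> bool" where
  "time_change \<phi> \<psi> \<longleftrightarrow> (\<exists>\<tau> :: real \<Rightarrow> hm \<Rightarrow> real.
     smooth (\<lambda>(s, p). \<tau> s p) \<and>
     (\<forall>s p q. hm_eq p q \<longrightarrow> \<tau> s p = \<tau> s q) \<and>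
     (\<forall>p. \<tau> 0 p = 0) \<and>
     (\<forall>s p. 0 < deriv (\<lambda>r. \<tau> r p) s) \<and>
     (\<forall>s p. hm_eq (\<psi> s p) (\<phi> (\<tau> s p) p)))"

text \<open>\<open>\<Phi>\<close> is the lift of a diffeomorphism of \<open>HM\<close> to the universal cover.\<close>

definition smoothly_conjugate :: "(real \<Rightarrow> hm \<Rightarrow> hm) \<Rightarrow> (real \<Rightarrow> hm \<Rightarrow> hm) \<Rightarrow> bool" where
  "smoothly_conjugate \<phi> \<psi> \<longleftrightarrow> (\<exists>\<Phi> :: hm \<Rightarrow> hm.
     bij \<Phi> \<and> smooth \<Phi> \<and> smooth (inv \<Phi>) \<and>
     (\<forall>p q. hm_eq p q \<longleftrightarrow> hm_eq (\<Phi> p) (\<Phi> q)) \<and>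
     (\<forall>s p. hm_eq (\<Phi> (\<phi> s p)) (\<psi> s (\<Phi> p))))"

definition trivial_time_change :: "(real \<Rightarrow> hm \<Rightarrow> hm) \<Rightarrow> (real \<Rightarrow> hm \<Rightarrow> hm) \<Rightarrow> bool" where
  "trivial_time_change \<phi> \<psi> \<longleftrightarrow> time_change \<phi> \<psi> \<and> smoothly_conjugate \<phi> \<psi>"

definition same_geodesic_flow_up_to_trivial_time_change :: "finsler \<Rightarrow> finsler \<Rightarrow> bool" where
  "same_geodesic_flow_up_to_trivial_time_change F F' \<longleftrightarrow>
     (\<exists>\<phi> \<psi>. geodesic_flow F \<phi> \<and> geodesic_flow F' \<psi> \<and> trivial_time_change \<phi> \<psi>)"


section \<open>Marked length spectrum\<close>

text \<open>
  A closed geodesic is the projection \<open>c\<close> of a periodic orbit \<open>\<gamma>\<close> of the geodesic flow, with a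
  (not necessarily minimal) period \<open>T\<close>; the lift \<open>c\<close> determines the class \<open>k\<close> by
  \<open>c T = c 0 + k\<close>.
\<close>

definition closed_geodesic :: "finsler \<Rightarrow> real^2 \<Rightarrow> real \<Rightarrow> (real \<Rightarrow> real^2) \<Rightarrow> bool" where
  "closed_geodesic F k T c \<longleftrightarrow> 0 < T \<and> c T - c 0 = k \<and>
     (\<exists>\<gamma>. (\<forall>s. (\<gamma> has_vector_derivative geodesic_field F (\<gamma> s)) (at s)) \<and>
          (\<forall>s. hm_eq (\<gamma> (s + T)) (\<gamma> s)) \<and> c = (\<lambda>s. fst (\<gamma> s)))"

definition curve_length :: "finsler \<Rightarrow> real \<Rightarrow> (real \<Rightarrow> real^2) \<Rightarrow> real" where
  "curve_length F T c = integral {0..T} (\<lambda>s. F (c s) (vector_derivative c (at s)))"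

definition geodesic_lengths :: "finsler \<Rightarrow> real^2 \<Rightarrow> real set" where
  "geodesic_lengths F k = {l. \<exists>T c. closed_geodesic F k T c \<and> l = curve_length F T c}"

definition same_marked_length_spectrum :: "finsler \<Rightarrow> finsler \<Rightarrow> bool" where
  "same_marked_length_spectrum F F' \<longleftrightarrow>
     (\<exists>\<iota>. bij_betw \<iota> lattice lattice \<and>
       (\<forall>k\<in>lattice. \<forall>l\<in>lattice. \<iota> (k + l) = \<iota> k + \<iota> l) \<and>
       (\<forall>k\<in>lattice. geodesic_lengths F k = geodesic_lengths F' (\<iota> k)))"


section \<open>Sobolev space, Rayleigh quotient and eigenvalues\<close>

definition is_weak_grad :: "(real^2 \<Rightarrow> real) \<Rightarrow> (real^2 \<Rightarrow> real^2) \<Rightarrow> bool" where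
  "is_weak_grad f G \<longleftrightarrow>
     G \<in> borel_measurable borel \<and> torus_periodic G \<and>
     set_integrable lborel cell (\<lambda>x. (norm (G x))\<^sup>2) \<and>
     (\<forall>\<phi> i. smooth \<phi> \<longrightarrow> torus_periodic \<phi> \<longrightarrow>
        (LINT x:cell|lborel. f x * grad \<phi> x $ i) = - (LINT x:cell|lborel. G x $ i * \<phi> x))"

text \<open>
  Elements of \<open>H^1\<close> are represented by Borel functions; two of them represent the same element
  if they agree almost everywhere.
\<close>

definition H1 :: "(real^2 \<Rightarrow> real) set" where
  "H1 = {f. f \<in> borel_measurable borel \<and> torus_periodic f \<and>
     set_integrable lborel cell (\<lambda>x. (f x)\<^sup>2) \<and> (\<exists>G. is_weak_grad f G)}"

definition weak_grad :: "(real^2 \<Rightarrow> real) \<Rightarrow> real^2 \<Rightarrow> real^2" where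
  "weak_grad f = (SOME G. is_weak_grad f G)"

definition H1_subspace :: "nat \<Rightarrow> (real^2 \<Rightarrow> real) set \<Rightarrow> bool" where
  "H1_subspace d V \<longleftrightarrow> (\<exists>b :: nat \<Rightarrow> real^2 \<Rightarrow> real.
     (\<forall>i<d. b i \<in> H1) \<and>
     (\<forall>c. (AE x in lborel. (\<Sum>i<d. c i * b i x) = 0) \<longrightarrow> (\<forall>i<d. c i = 0)) \<and>
     V = {f \<in> H1. \<exists>c. AE x in lborel. f x = (\<Sum>i<d. c i * b i x)})"

text \<open>\<open>L_X (\<pi>^* f) = df (d\<pi> X)\<close>.\<close>

definition lie_deriv :: "finsler \<Rightarrow> (real^2 \<Rightarrow> real) \<Rightarrow> hm \<Rightarrow> real" where
  "lie_deriv F f p = weak_grad f (fst p) \<bullet> fst (geodesic_field F p)"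

text \<open>The constant is \<open>n / vol(S^(n-1))\<close> for \<open>n = 2\<close>.\<close>

definition energy :: "finsler \<Rightarrow> (real^2 \<Rightarrow> real) \<Rightarrow> real" where
  "energy F f = 2 / (2 * pi) *
     (LINT p:(cell \<times> {0..2 * pi})|lborel. \<bar>lie_deriv F f p\<bar>\<^sup>2 * contact_density F p)"

definition rayleigh :: "finsler \<Rightarrow> (real^2 \<Rightarrow> real) \<Rightarrow> real" where
  "rayleigh F f = energy F f / (LINT x:cell|lborel. (f x)\<^sup>2 * ht_density F x)"

text \<open>
  The \<open>k\<close>-th eigenvalue of the BF-Laplacian, given by the min-max principle: \<open>V\<close> ranges over the
  \<open>(k + 1)\<close>-dimensional subspaces of \<open>H^1\<close>.
\<close>

definition eigenvalue :: "nat \<Rightarrow> finsler \<Rightarrow> ereal" where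
  "eigenvalue k F = (INF V\<in>{V. H1_subspace (k + 1) V}.
     SUP f\<in>{f \<in> V. \<not> (AE x in lborel. f x = 0)}. ereal (rayleigh F f))"

end

theory Submission
  imports Defs "HOL-Real_Asymp.Real_Asymp"
begin

text \<open>
  Let \<open>h\<^sub>\<epsilon>\<close> be a smoothing of the distance to the point \<open>o = (1/2, 1/2)\<close> of the torus. Adding the exact form
  \<open>t dh\<^sub>\<epsilon>\<close> to \<open>\<surd>g\<^sub>0\<close> leaves \<open>dA\<close> unchanged, so geodesics stay straight lines and only their
  parametrization changes, by the coboundary \<open>t h\<^sub>\<epsilon>\<close>; hence the length of a closed geodesic and the volume are
  unchanged, and the flows are conjugate by moving each point by the time \<open>t h\<^sub>\<epsilon>\<close> along its geodesic.

  The energy density is the quadratic form \<open>p \<mapsto> 1/\<pi> \<integral> (p \<bullet> u)\<^sup>2 / (1 + t \<nabla>h\<^sub>\<epsilon> \<bullet> u) du\<close>. It always dominates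
  \<open>1/2 |p|\<^sup>2\<close>, and as \<open>t \<nabla>h\<^sub>\<epsilon>\<close> tends to the unit radial field it becomes infinitely stiff in the radial direction.
  A function of bounded energy is therefore almost constant along the rays from \<open>o\<close>. Since \<open>\<integral> dr / r\<close> diverges at
  \<open>o\<close>, such a function has little angular energy on some small square around \<open>o\<close>; so it is almost constant
  there, and along the rays everywhere. This forces the first eigenvalue to infinity.
\<close>

section \<open>Calculus of \<open>C\<^sup>k\<close> functions\<close>

text \<open>The smoothing shapes the argument. The gradient of \<open>potential e\<close> is
  controlled only at distance at least \<rho> from \<open>center\<close>, where the distance has its
  tip, and from the boundary of the cell, which contains its cut locus. Radial stiffness is used
  only on that core. Outside it the area element r dr helps: crossing the excluded parts costs
  O(\<rho>), although the integral of dr / r diverges. The constants must be fixed in the order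
  \<rho>, then \<eta> (small against 1 / ln (1 / \<rho>)), then the angular window \<gamma>, then
  the tolerance \<mu>, and last the neighbourhood of (0, 1). The limit is joint since
  \<open>e\<close> and \<open>1 - t\<close> enter only through \<mu>. The cell being a square,
  concentric squares replace circles. Irrational slopes arise by themselves: the limit at x is the
  direction from a lattice translate of \<open>center\<close> to x, and rational directions fill
  only countably many lines. The min-max formula involves weak gradients, so the inequality is shown
  for smooth functions and transferred by convolution; for fixed t < 1 the energy is continuous in
  the H^1 norm.\<close>

lemma Ck_on_cong:
  assumes "open S" "\<And>x. x \<in> S \<Longrightarrow> f x = g x" "Ck_on k f S"
  shows "Ck_on k g S"
  using assms(2,3)
proof (induction k arbitrary: f g)
  case 0
  then show ?case
    using continuous_on_cong by (metis Ck_on.simps(1))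
next
  case (Suc k)
  have d: "f differentiable at x" if "x \<in> S" for x
    using Suc.prems that by auto
  have eq: "frechet_derivative f (at x) = frechet_derivative g (at x)" if "x \<in> S" for x
    using frechet_derivative_transform_within_open[OF d[OF that] assms(1) that] Suc.prems(1) by blast
  have "g differentiable at x" if "x \<in> S" for x
    using d[OF that] Suc.prems(1) that assms(1)
    by (metis differentiable_def has_derivative_transform_within_open)
  moreover have "Ck_on k (\<lambda>x. frechet_derivative g (at x) v) S" for v
    by (rule Suc.IH[of "\<lambda>x. frechet_derivative f (at x) v"]) (use eq Suc.prems in auto)
  ultimately show ?case by simp
qed

text \<open>Any formula \<open>f'\<close> for the derivative may replace
  \<open>frechet_derivative\<close>, because the two agree on the open set \<open>S\<close>. The
  closure properties below go through this rule.\<close>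

lemma Ck_on_SucI:
  assumes "open S" "\<And>x. x \<in> S \<Longrightarrow> (f has_derivative f' x) (at x)"
    and "\<And>v. Ck_on k (\<lambda>x. f' x v) S"
  shows "Ck_on (Suc k) f S"
proof -
  have "frechet_derivative f (at x) = f' x" if "x \<in> S" for x
    using frechet_derivative_at[OF assms(2)[OF that]] by simp
  then have "Ck_on k (\<lambda>x. frechet_derivative f (at x) v) S" for v
    by (intro Ck_on_cong[OF assms(1) _ assms(3)]) auto
  then show ?thesis
    using assms(2) by (auto simp: differentiable_def)
qed

lemma Ck_on_SucD:
  assumes "Ck_on (Suc k) f S" "x \<in> S"
  shows "(f has_derivative frechet_derivative f (at x)) (at x)"
  using assms frechet_derivative_works by auto

lemma Ck_on_SucD2: "Ck_on (Suc k) f S \<Longrightarrow> Ck_on k (\<lambda>x. frechet_derivative f (at x) v) S"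
  by simp

text \<open>Differentiating a product or a composition leaves the other factor undifferentiated; in
  the inductions that factor has to be lowered from order k + 1 to order k.\<close>

lemma Ck_on_Suc_imp: "Ck_on (Suc k) f S \<Longrightarrow> Ck_on k f S"
proof (induction k arbitrary: f)
  case 0
  then have "f differentiable at x" if "x \<in> S" for x
    using that by simp
  then show ?case
    by (simp add: continuous_at_imp_continuous_on differentiable_imp_continuous_within)
next
  case (Suc k)
  have "Ck_on k (\<lambda>x. frechet_derivative f (at x) v) S" for v
    using Suc by simp
  then show ?case using Suc.prems by simp
qed

lemma Ck_on_subset: "Ck_on k f S \<Longrightarrow> T \<subseteq> S \<Longrightarrow> Ck_on k f T"
  by (induction k arbitrary: f) (auto intro: continuous_on_subset)

lemma Ck_on_const: "Ck_on k (\<lambda>x. c) S"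
  by (induction k arbitrary: c) auto

lemma Ck_on_bounded_linear_comp:
  assumes "bounded_linear L" "open S" "Ck_on k g S"
  shows "Ck_on k (\<lambda>x. L (g x)) S"
  using assms(3)
proof (induction k arbitrary: g)
  case 0
  then show ?case
    using assms(1) by (simp add: linear_continuous_on bounded_linear.continuous_on)
next
  case (Suc k)
  show ?case
  proof (rule Ck_on_SucI[OF assms(2)])
    fix x assume "x \<in> S"
    show "((\<lambda>x. L (g x)) has_derivative (\<lambda>v. L (frechet_derivative g (at x) v))) (at x)"
      by (rule bounded_linear.has_derivative[OF assms(1) Ck_on_SucD[OF Suc.prems \<open>x \<in> S\<close>]])
  next
    fix v
    show "Ck_on k (\<lambda>x. L (frechet_derivative g (at x) v)) S"
      by (rule Suc.IH[OF Ck_on_SucD2[OF Suc.prems]])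
  qed
qed

lemma Ck_on_ident: "Ck_on k (\<lambda>x. x) S"
  by (cases k) (auto simp: Ck_on_const frechet_derivative_ident)

lemma Ck_on_bounded_linear: "bounded_linear L \<Longrightarrow> Ck_on k L S"
  using Ck_on_subset[OF Ck_on_bounded_linear_comp[OF _ open_UNIV Ck_on_ident]] by blast

lemma Ck_on_add:
  assumes "open S" "Ck_on k f S" "Ck_on k g S"
  shows "Ck_on k (\<lambda>x. f x + g x) S"
  using assms(2,3)
proof (induction k arbitrary: f g)
  case 0
  then show ?case by (auto intro: continuous_intros)
next
  case (Suc k)
  show ?case
    by (rule Ck_on_SucI[OF assms(1) has_derivative_add[OF Ck_on_SucD[OF Suc.prems(1)]
            Ck_on_SucD[OF Suc.prems(2)]]])
      (assumption | intro Suc.IH Ck_on_SucD2 Suc.prems)+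
qed

lemma Ck_on_scaleR:
  fixes f :: "'a::real_normed_vector \<Rightarrow> real"
  assumes "open S" "Ck_on k f S" "Ck_on k g S"
  shows "Ck_on k (\<lambda>x. f x *\<^sub>R g x) S"
  using assms(2,3)
proof (induction k arbitrary: f g)
  case 0
  then show ?case by (auto intro: continuous_intros)
next
  case (Suc k)
  show ?case
  proof (rule Ck_on_SucI[OF assms(1) has_derivative_scaleR[OF Ck_on_SucD[OF Suc.prems(1)]
            Ck_on_SucD[OF Suc.prems(2)]]])
    fix v
    show "Ck_on k (\<lambda>x. f x *\<^sub>R frechet_derivative g (at x) v + frechet_derivative f (at x) v *\<^sub>R g x) S"
      by (intro Ck_on_add[OF assms(1)] Suc.IH Ck_on_SucD2 Suc.prems Ck_on_Suc_imp[OF Suc.prems(1)]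
          Ck_on_Suc_imp[OF Suc.prems(2)])
  qed
qed

lemma Ck_on_mult:
  fixes f g :: "'a::real_normed_vector \<Rightarrow> real"
  assumes "open S" "Ck_on k f S" "Ck_on k g S"
  shows "Ck_on k (\<lambda>x. f x * g x) S"
  using Ck_on_scaleR[OF assms] by simp

lemma Ck_on_diff:
  assumes "open S" "Ck_on k f S" "Ck_on k g S"
  shows "Ck_on k (\<lambda>x. f x - g x) S"
  using Ck_on_add[OF assms(1,2) Ck_on_scaleR[OF assms(1) Ck_on_const[of k "-1"] assms(3)]] by simp

lemma Ck_on_sum:
  assumes "open S" "\<And>i. i \<in> I \<Longrightarrow> Ck_on k (f i) S"
  shows "Ck_on k (\<lambda>x. \<Sum>i\<in>I. f i x) S"
  using assms(2) by (induction I rule: infinite_finite_induct) (auto intro: Ck_on_const Ck_on_add[OF assms(1)])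

lemma Ck_on_power:
  fixes f :: "'a::real_normed_vector \<Rightarrow> real"
  assumes "open S" "Ck_on k f S"
  shows "Ck_on k (\<lambda>x. f x ^ n) S"
  by (induction n) (auto intro: Ck_on_const Ck_on_mult assms)

text \<open>The chain rule gives \<open>?D x (?d x v)\<close>, whose direction varies with
  \<open>x\<close>, whereas \<open>Ck_on\<close> speaks of fixed directions. Expanding the inner
  derivative in a basis turns it into a finite sum of products of functions that the induction
  covers.\<close>

lemma Ck_on_compose:
  fixes f :: "'b::euclidean_space \<Rightarrow> 'c::real_normed_vector" and g :: "'a::real_normed_vector \<Rightarrow> 'b"
  assumes "open S" "open T" "g ` S \<subseteq> T" "Ck_on k f T" "Ck_on k g S"
  shows "Ck_on k (\<lambda>x. f (g x)) S"
  using assms(4,5)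
proof (induction k arbitrary: f)
  case 0
  then show ?case
    using assms(3) continuous_on_compose2 by (metis Ck_on.simps(1))
next
  case (Suc k)
  let ?D = "\<lambda>x. frechet_derivative f (at (g x))" and ?d = "\<lambda>x. frechet_derivative g (at x)"
  have comp: "(\<Sum>b\<in>Basis. (?d x v \<bullet> b) *\<^sub>R ?D x b) = ?D x (?d x v)" if "x \<in> S" for x v
  proof -
    have "linear (?D x)"
      using Ck_on_SucD[OF Suc.prems(1)] that assms(3) has_derivative_linear by blast
    then show ?thesis
      by (subst (2) euclidean_representation[symmetric, of "?d x v"])
        (simp add: linear_sum linear_cmul)
  qed
  show ?case
  proof (rule Ck_on_SucI[OF assms(1)])
    fix x assume "x \<in> S"
    have "(f has_derivative ?D x) (at (g x))"
      using Ck_on_SucD[OF Suc.prems(1)] \<open>x \<in> S\<close> assms(3) by blast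
    from diff_chain_at[OF Ck_on_SucD[OF Suc.prems(2) \<open>x \<in> S\<close>] this]
    show "((\<lambda>x. f (g x)) has_derivative (\<lambda>v. ?D x (?d x v))) (at x)"
      by (simp add: o_def)
  next
    fix v
    have "Ck_on k (\<lambda>x. \<Sum>b\<in>Basis. (?d x v \<bullet> b) *\<^sub>R ?D x b) S"
    proof (intro Ck_on_sum[OF assms(1)] Ck_on_scaleR[OF assms(1)])
      fix b :: 'b
      show "Ck_on k (\<lambda>x. ?d x v \<bullet> b) S"
        by (rule Ck_on_bounded_linear_comp[OF bounded_linear_inner_left assms(1) Ck_on_SucD2[OF Suc.prems(2)]])
      show "Ck_on k (\<lambda>x. ?D x b) S"
        by (rule Suc.IH[OF Ck_on_SucD2[OF Suc.prems(1)] Ck_on_Suc_imp[OF Suc.prems(2)]])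
    qed
    then show "Ck_on k (\<lambda>x. ?D x (?d x v)) S"
      by (rule Ck_on_cong[OF assms(1), rotated]) (use comp in auto)
  qed
qed

lemma Ck_on_compose_deriv:
  fixes f :: "real \<Rightarrow> real"
  assumes "open T" "\<And>x. x \<in> T \<Longrightarrow> (f has_real_derivative f' x) (at x)" "Ck_on k f' T"
  shows "Ck_on (Suc k) f T"
proof (rule Ck_on_SucI[OF assms(1)])
  show "(f has_derivative (\<lambda>v. f' x * v)) (at x)" if "x \<in> T" for x
    using assms(2)[OF that] by (simp add: has_field_derivative_def)
  show "Ck_on k (\<lambda>x. f' x * v) T" for v
    by (intro Ck_on_mult assms Ck_on_const)
qed

lemma Ck_on_Pair:
  assumes "open S" "Ck_on k f S" "Ck_on k g S"
  shows "Ck_on k (\<lambda>x. (f x, g x)) S"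
proof -
  have 1: "bounded_linear (\<lambda>a. (a::'b, 0::'c))" and 2: "bounded_linear (\<lambda>a. (0::'b, a::'c))"
    by (auto intro!: bounded_linear_Pair bounded_linear_ident bounded_linear_zero)
  show ?thesis
    using Ck_on_add[OF assms(1) Ck_on_bounded_linear_comp[OF 1 assms(1,2)]
        Ck_on_bounded_linear_comp[OF 2 assms(1,3)]] by simp
qed

section \<open>Elementary functions of one real variable\<close>

lemma Ck_on_sin_cos: "Ck_on k (sin :: real \<Rightarrow> real) UNIV \<and> Ck_on k (cos :: real \<Rightarrow> real) UNIV"
proof (induction k)
  case 0
  then show ?case by (auto intro: continuous_intros)
next
  case (Suc k)
  have "Ck_on k (\<lambda>x::real. - sin x) UNIV"
    using Ck_on_diff[OF open_UNIV Ck_on_const[of k 0] conjunct1[OF Suc]] by simp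
  then have "Ck_on (Suc k) (cos :: real \<Rightarrow> real) UNIV"
    by (rule Ck_on_compose_deriv[rotated 2]) (auto intro!: derivative_eq_intros)
  moreover have "Ck_on (Suc k) (sin :: real \<Rightarrow> real) UNIV"
    by (rule Ck_on_compose_deriv[OF _ _ conjunct2[OF Suc]]) (auto intro!: derivative_eq_intros)
  ultimately show ?case by blast
qed

text \<open>The derivative is a polynomial in the function itself, so the induction hypothesis
  applies to it. \<open>Ck_on_sqrt\<close> follows the same pattern, its derivative being half the
  reciprocal of the root.\<close>

lemma Ck_on_inverse: "Ck_on k (inverse :: real \<Rightarrow> real) (- {0})"
proof (induction k)
  case 0
  then show ?case by (auto intro!: continuous_intros)
next
  case (Suc k)
  have "Ck_on k (\<lambda>x::real. 0 - inverse x * inverse x) (- {0})"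
    by (intro Ck_on_diff Ck_on_mult Suc Ck_on_const) auto
  then show ?case
    by (rule Ck_on_compose_deriv[rotated 2]) (auto intro!: derivative_eq_intros simp: power2_eq_square)
qed

lemma Ck_on_sqrt: "Ck_on k sqrt {0<..}"
proof (induction k)
  case 0
  then show ?case by (auto intro!: continuous_intros)
next
  case (Suc k)
  have "Ck_on k (\<lambda>x. inverse (sqrt x) * (1/2)) {0<..}"
    by (intro Ck_on_mult Ck_on_const Ck_on_compose[OF _ _ _ Ck_on_inverse Suc]) auto
  then show ?case
    by (rule Ck_on_compose_deriv[rotated 2])
      (auto intro!: derivative_eq_intros simp: field_simps)
qed

lemma Ck_on_arcsin: "Ck_on k arcsin {-1<..<1}"
proof (cases k)
  case 0
  have "continuous_on {-1<..<1} arcsin"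
    by (rule continuous_on_subset[OF continuous_on_arcsin']) auto
  then show ?thesis using 0 by simp
next
  case (Suc j)
  have less1: "x * x < 1" if "-1 < x" "x < 1" for x :: real
    using that abs_square_less_1[of x] by (simp add: power2_eq_square)
  have "Ck_on j (\<lambda>x. sqrt (1 - x * x)) {-1<..<1}"
    by (rule Ck_on_compose[OF _ _ _ Ck_on_sqrt])
      (auto intro!: Ck_on_diff Ck_on_mult Ck_on_const Ck_on_ident less1)
  then have "Ck_on j (\<lambda>x. inverse (sqrt (1 - x * x))) {-1<..<1}"
    using Ck_on_compose[OF _ _ _ Ck_on_inverse[of j], of "{-1<..<1}" "\<lambda>x. sqrt (1 - x * x)"] less1
    by force
  then show ?thesis
    unfolding Suc by (rule Ck_on_compose_deriv[rotated 2])
      (use DERIV_arcsin in \<open>auto simp: power2_eq_square\<close>)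
qed

section \<open>Closure properties of smooth maps\<close>

lemma smoothI: "(\<And>k. Ck_on k f UNIV) \<Longrightarrow> smooth f"
  by (simp add: smooth_def)

lemma smoothD: "smooth f \<Longrightarrow> Ck_on k f UNIV"
  by (simp add: smooth_def)

lemma smooth_has_derivative: "smooth f \<Longrightarrow> (f has_derivative frechet_derivative f (at x)) (at x)"
  using Ck_on_SucD[OF smoothD] by simp

lemma smooth_continuous_on: "smooth f \<Longrightarrow> continuous_on S f"
  using smoothD[of f 0] continuous_on_subset by auto

lemma smooth_frechet_derivative: "smooth f \<Longrightarrow> smooth (\<lambda>x. frechet_derivative f (at x) v)"
  by (rule smoothI, rule Ck_on_SucD2, rule smoothD)

named_theorems smooth_intros

lemma smooth_const [smooth_intros]: "smooth (\<lambda>x. c)"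
  by (simp add: smooth_def Ck_on_const)

lemma smooth_ident [smooth_intros]: "smooth (\<lambda>x. x)"
  by (simp add: smooth_def Ck_on_ident)

lemma smooth_add [smooth_intros]: "smooth f \<Longrightarrow> smooth g \<Longrightarrow> smooth (\<lambda>x. f x + g x)"
  by (simp add: smooth_def Ck_on_add)

lemma smooth_diff [smooth_intros]: "smooth f \<Longrightarrow> smooth g \<Longrightarrow> smooth (\<lambda>x. f x - g x)"
  by (simp add: smooth_def Ck_on_diff)

lemma smooth_scaleR [smooth_intros]:
  fixes f :: "'a::real_normed_vector \<Rightarrow> real"
  shows "smooth f \<Longrightarrow> smooth g \<Longrightarrow> smooth (\<lambda>x. f x *\<^sub>R g x)"
  by (simp add: smooth_def Ck_on_scaleR)

lemma smooth_mult [smooth_intros]: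
  fixes f g :: "'a::real_normed_vector \<Rightarrow> real"
  shows "smooth f \<Longrightarrow> smooth g \<Longrightarrow> smooth (\<lambda>x. f x * g x)"
  by (simp add: smooth_def Ck_on_mult)

lemma smooth_power [smooth_intros]:
  fixes f :: "'a::real_normed_vector \<Rightarrow> real"
  shows "smooth f \<Longrightarrow> smooth (\<lambda>x. f x ^ n)"
  by (simp add: smooth_def Ck_on_power)

lemma smooth_sum [smooth_intros]: "(\<And>i. i \<in> I \<Longrightarrow> smooth (f i)) \<Longrightarrow> smooth (\<lambda>x. \<Sum>i\<in>I. f i x)"
  by (simp add: smooth_def Ck_on_sum)

lemma smooth_Pair [smooth_intros]: "smooth f \<Longrightarrow> smooth g \<Longrightarrow> smooth (\<lambda>x. (f x, g x))"
  by (simp add: smooth_def Ck_on_Pair)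

lemma smooth_compose:
  fixes f :: "'b::euclidean_space \<Rightarrow> 'c::real_normed_vector"
  shows "smooth f \<Longrightarrow> smooth g \<Longrightarrow> smooth (\<lambda>x. f (g x))"
  unfolding smooth_def using Ck_on_compose[OF open_UNIV open_UNIV subset_UNIV] by blast

lemma smooth_bounded_linear_comp:
  "bounded_linear L \<Longrightarrow> smooth g \<Longrightarrow> smooth (\<lambda>x. L (g x))"
  by (simp add: smooth_def Ck_on_bounded_linear_comp)

lemma smooth_sin [smooth_intros]: "smooth f \<Longrightarrow> smooth (\<lambda>x. sin (f x :: real))"
  and smooth_cos [smooth_intros]: "smooth f \<Longrightarrow> smooth (\<lambda>x. cos (f x :: real))"
  using smooth_compose[of sin f] smooth_compose[of cos f] Ck_on_sin_cos by (auto intro: smoothI)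

lemma smooth_sqrt:
  assumes "smooth f" "\<And>x. 0 < f x"
  shows "smooth (\<lambda>x. sqrt (f x))"
  using assms by (intro smoothI Ck_on_compose[OF _ _ _ Ck_on_sqrt]) (auto simp: smoothD)

lemma smooth_inverse:
  assumes "smooth f" "\<And>x. f x \<noteq> (0::real)"
  shows "smooth (\<lambda>x. inverse (f x))"
  using assms by (intro smoothI Ck_on_compose[OF _ _ _ Ck_on_inverse]) (auto simp: smoothD)

lemma smooth_arcsin:
  assumes "smooth f" "\<And>x. \<bar>f x\<bar> < 1"
  shows "smooth (\<lambda>x. arcsin (f x))"
  using assms by (intro smoothI Ck_on_compose[OF _ _ _ Ck_on_arcsin]) (auto simp: smoothD abs_less_iff)

lemma smooth_vec_nth [smooth_intros]: "smooth f \<Longrightarrow> smooth (\<lambda>x. f x $ i :: real)"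
  using smooth_bounded_linear_comp[OF bounded_linear_vec_nth, of f i] by simp

lemma smooth_fst [smooth_intros]: "smooth f \<Longrightarrow> smooth (\<lambda>x. fst (f x))"
  and smooth_snd [smooth_intros]: "smooth f \<Longrightarrow> smooth (\<lambda>x. snd (f x))"
  using smooth_bounded_linear_comp[OF bounded_linear_fst, of f]
    smooth_bounded_linear_comp[OF bounded_linear_snd, of f] by simp_all

lemma vector_2_eq: "vector [a, b] = a *\<^sub>R axis 1 1 + b *\<^sub>R (axis 2 1 :: real^2)"
  by (simp add: vec_eq_iff forall_2 axis_def)

lemma smooth_vector_2 [smooth_intros]:
  "smooth f \<Longrightarrow> smooth g \<Longrightarrow> smooth (\<lambda>x. vector [f x, g x] :: real^2)"
  unfolding vector_2_eq by (intro smooth_intros)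

section \<open>Geometry of \<open>\<surd>g\<^sub>0 + t dh\<close>\<close>

lemma inner_2: "v \<bullet> w = v $ 1 * w $ 1 + v $ 2 * (w $ 2 :: real)" for v w :: "real^2"
  by (simp add: inner_vec_def sum_2)

lemma dir_nth [simp]: "dir \<theta> $ 1 = cos \<theta>" "dir \<theta> $ 2 = sin \<theta>"
  by (simp_all add: dir_def)

lemma dir_inner_dir [simp]: "dir \<theta> \<bullet> dir \<theta> = 1"
  by (simp add: inner_2 flip: power2_eq_square)

lemma norm_dir [simp]: "norm (dir \<theta>) = 1"
  by (simp add: norm_eq_sqrt_inner)

lemma dir_neq_0 [simp]: "dir \<theta> \<noteq> 0"
  using norm_dir[of \<theta>] by force

lemma sin_cos_periodic_Ints:
  assumes "m \<in> \<int>"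
  shows "sin (x + 2 * pi * m) = sin x" "cos (x + 2 * pi * m) = cos x"
proof -
  obtain n where "m = of_int n" using assms by (auto elim: Ints_cases)
  then show "sin (x + 2 * pi * m) = sin x" "cos (x + 2 * pi * m) = cos x"
    by (simp_all add: sin_add cos_add sin_int_2pin cos_int_2pin)
qed

lemma dir_periodic: "m \<in> \<int> \<Longrightarrow> dir (\<theta> + 2 * pi * m) = dir \<theta>"
  by (simp add: dir_def sin_cos_periodic_Ints)

lemma dir_exists:
  fixes v :: "real^2"
  assumes "norm v = 1"
  obtains \<theta> where "v = dir \<theta>"
proof -
  have "(v $ 1)\<^sup>2 + (v $ 2)\<^sup>2 = 1"
    using assms by (simp add: norm_eq_sqrt_inner inner_2 power2_eq_square)
  then obtain \<theta> where "v $ 1 = cos \<theta>" "v $ 2 = sin \<theta>"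
    using sincos_total_2pi by metis
  then have "v = dir \<theta>" by (simp add: vec_eq_iff forall_2)
  then show thesis by (rule that)
qed

text \<open>Both the derivative of \<open>dir\<close> and its unit normal. The first reading
  produces it in \<open>ext_deriv_eq\<close>, the second determines the geodesic field.\<close>

definition ndir :: "real \<Rightarrow> real^2" where
  "ndir \<theta> = vector [- sin \<theta>, cos \<theta>]"

lemma ndir_nth [simp]: "ndir \<theta> $ 1 = - sin \<theta>" "ndir \<theta> $ 2 = cos \<theta>"
  by (simp_all add: ndir_def)

lemma ndir_inner [simp]: "ndir \<theta> \<bullet> ndir \<theta> = 1" "ndir \<theta> \<bullet> dir \<theta> = 0" "dir \<theta> \<bullet> ndir \<theta> = 0"
  by (simp_all add: inner_2 flip: power2_eq_square)

lemma dir_ndir_decomp: "v = (v \<bullet> dir \<theta>) *\<^sub>R dir \<theta> + (v \<bullet> ndir \<theta>) *\<^sub>R ndir \<theta>"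
proof -
  have *: "x = x * (cos \<theta>)\<^sup>2 + x * (sin \<theta>)\<^sup>2" for x
    using sin_cos_squared_add2[of \<theta>] by (metis distrib_left mult.right_neutral)
  show ?thesis
    using *[of "v $ 1"] *[of "v $ 2"]
    by (simp add: vec_eq_iff forall_2 inner_2 algebra_simps power2_eq_square)
qed

lemma dir_has_derivative: "(dir has_derivative (\<lambda>s. s *\<^sub>R ndir \<theta>)) (at \<theta>)"
proof -
  have "((\<lambda>\<theta>. cos \<theta> *\<^sub>R axis 1 1 + sin \<theta> *\<^sub>R axis 2 1) has_derivative
      (\<lambda>s. (s * - sin \<theta>) *\<^sub>R axis 1 1 + (s * cos \<theta>) *\<^sub>R (axis 2 1 :: real^2))) (at \<theta>)"
    by (auto intro!: derivative_eq_intros)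
  moreover have "dir = (\<lambda>\<theta>. cos \<theta> *\<^sub>R axis 1 1 + sin \<theta> *\<^sub>R axis 2 1)"
    by (simp add: fun_eq_iff dir_def vector_2_eq)
  ultimately show ?thesis
    by (simp add: ndir_def vector_2_eq scaleR_diff_right)
qed

lemma smooth_dir [smooth_intros]: "smooth f \<Longrightarrow> smooth (\<lambda>x. dir (f x))"
  unfolding dir_def by (intro smooth_intros)

lemma frechet_derivative_eq_grad:
  assumes "f differentiable (at x)"
  shows "frechet_derivative f (at x) v = grad f x \<bullet> v"
proof -
  have lin: "linear (frechet_derivative f (at x))"
    using assms frechet_derivative_works has_derivative_linear by blast
  have "v = v $ 1 *\<^sub>R axis 1 1 + v $ 2 *\<^sub>R axis 2 1"
    by (simp add: vec_eq_iff forall_2 axis_def)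
  then have "frechet_derivative f (at x) v =
      frechet_derivative f (at x) (v $ 1 *\<^sub>R axis 1 1 + v $ 2 *\<^sub>R axis 2 1)"
    by (rule arg_cong)
  also have "\<dots> = v $ 1 * frechet_derivative f (at x) (axis 1 1) + v $ 2 * frechet_derivative f (at x) (axis 2 1)"
    by (simp add: linear_add[OF lin] linear_cmul[OF lin])
  finally have "frechet_derivative f (at x) v =
      v $ 1 * frechet_derivative f (at x) (axis 1 1) + v $ 2 * frechet_derivative f (at x) (axis 2 1)" .
  then show ?thesis by (simp add: grad_def inner_2)
qed

lemma smooth_differentiable: "smooth f \<Longrightarrow> f differentiable (at x)"
  using smooth_has_derivative differentiableI by blast

lemma grad_components: "grad f x = frechet_derivative f (at x) (axis 1 1) *\<^sub>R axis 1 1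
    + frechet_derivative f (at x) (axis 2 1) *\<^sub>R axis 2 1"
  by (simp add: grad_def vec_eq_iff forall_2 axis_def)

lemma smooth_grad [smooth_intros]: "smooth f \<Longrightarrow> smooth (grad f)"
  unfolding grad_components[abs_def] by (intro smooth_intros smooth_frechet_derivative)

lemma lattice_uminus: "k \<in> lattice \<Longrightarrow> - k \<in> lattice"
  by (simp add: lattice_def)

lemma grad_periodic:
  assumes "smooth f" "torus_periodic f" "k \<in> lattice"
  shows "grad f (x + k) = grad f x"
proof -
  have "((\<lambda>y. f (y + k)) has_derivative frechet_derivative f (at (x + k))) (at x)"
    by (rule has_derivative_compose[where f = "\<lambda>y. y + k" and g = f and f' = "\<lambda>v. v"])
      (auto intro!: derivative_eq_intros smooth_has_derivative assms(1))
  moreover have "(\<lambda>y. f (y + k)) = f"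
    using assms(2,3) by (auto simp: torus_periodic_def)
  ultimately have "frechet_derivative f (at (x + k)) = frechet_derivative f (at x)"
    using frechet_derivative_at by metis
  then show ?thesis by (simp add: grad_def)
qed

text \<open>What the geometry uses of a potential. The gradient bound together with t < 1 keeps the
  metric positive; symmetry of the second derivative says that t dh is closed, and is an assumption
  because \<open>second_derivative_potential_sym\<close> reads it off an explicit formula.\<close>

locale randers_potential =
  fixes h :: "real^2 \<Rightarrow> real" and t :: real
  assumes smooth_h: "smooth h" and periodic_h: "torus_periodic h"
    and t_nonneg: "0 \<le> t" and t_less: "t < 1"
    and grad_le: "norm (grad h x) \<le> 1"
    and second_derivative_sym: "frechet_derivative (grad h) (at x) v \<bullet> w = frechet_derivative (grad h) (at x) w \<bullet> v"
begin

abbreviation F :: finsler where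
  "F \<equiv> randers flat_metric (\<lambda>x v. t * frechet_derivative h (at x) v)"

definition w :: "real^2 \<Rightarrow> real^2" where
  "w x = t *\<^sub>R grad h x"

text \<open>The value of \<open>F\<close> on the Euclidean unit vector \<open>dir (snd p)\<close>:
  the factor between Euclidean and Finsler arc length, and also the density of A \<and> dA with
  respect to dx d\<theta>.\<close>

definition speed :: "hm \<Rightarrow> real" where
  "speed p = 1 + w (fst p) \<bullet> dir (snd p)"

lemma smooth_w: "smooth w"
  unfolding w_def by (intro smooth_intros smooth_h)

lemma F_eq: "F x v = norm v + w x \<bullet> v"
  by (simp add: randers_def flat_metric_def norm_eq_sqrt_inner w_def
      frechet_derivative_eq_grad[OF smooth_differentiable[OF smooth_h]])

lemma norm_w: "norm (w x) \<le> t"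
  using mult_left_mono[OF grad_le t_nonneg, of x] t_nonneg by (simp add: w_def)

lemma w_inner_ge: "- t * norm v \<le> w x \<bullet> v"
proof -
  have "\<bar>w x \<bullet> v\<bar> \<le> norm (w x) * norm v" by (rule Cauchy_Schwarz_ineq2)
  also have "\<dots> \<le> t * norm v" using norm_w by (simp add: mult_right_mono)
  finally show ?thesis by linarith
qed

lemma speed_ge: "1 - t \<le> speed p"
  using w_inner_ge[of "dir (snd p)" "fst p"] by (simp add: speed_def)

lemma speed_pos: "0 < speed p"
  using speed_ge t_less by (meson diff_gt_0_iff_gt less_le_trans)

lemma w_periodic: "k \<in> lattice \<Longrightarrow> w (x + k) = w x"
  by (simp add: w_def grad_periodic[OF smooth_h periodic_h])

lemma hm_eq_invariants:
  assumes "hm_eq p q"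
  shows "w (fst p) = w (fst q)" "dir (snd p) = dir (snd q)" "h (fst p) = h (fst q)"
proof -
  obtain m where m: "m \<in> \<int>" "snd q = snd p + 2 * pi * m" and k: "fst q - fst p \<in> lattice"
    using assms unfolding hm_eq_def by (metis add_diff_cancel_left' diff_add_cancel add.commute)
  show "dir (snd p) = dir (snd q)"
    using m by (simp add: dir_periodic)
  show "w (fst p) = w (fst q)"
    using w_periodic[OF k, of "fst p"] by simp
  show "h (fst p) = h (fst q)"
    using periodic_h k unfolding torus_periodic_def by (metis add_diff_cancel_left' diff_add_cancel add.commute)
qed

lemma speed_hm_eq: "hm_eq p q \<Longrightarrow> speed p = speed q"
  by (simp add: speed_def hm_eq_invariants)

lemma smooth_speed: "smooth speed"
proof -
  have "smooth (\<lambda>p. w (fst p))"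
    by (intro smooth_compose[OF smooth_w] smooth_intros)
  then show ?thesis
    unfolding speed_def inner_2 by (intro smooth_intros)
qed

lemma F_pos: "v \<noteq> 0 \<Longrightarrow> 0 < F x v"
proof -
  assume "v \<noteq> 0"
  then have "t * norm v < norm v" using t_less by simp
  then show "0 < F x v" using w_inner_ge[of v x] by (simp add: F_eq)
qed

section \<open>Hilbert form, its differential and the contact volume\<close>

lemma F_has_derivative:
  assumes "v \<noteq> 0"
  shows "(F x has_derivative (\<lambda>u. (sgn v + w x) \<bullet> u)) (at v)"
proof -
  have "((\<lambda>v. norm v + w x \<bullet> v) has_derivative (\<lambda>u. u \<bullet> sgn v + w x \<bullet> u)) (at v)"
    by (intro has_derivative_add has_derivative_norm[OF assms] bounded_linear.has_derivative[OF bounded_linear_inner_right] has_derivative_ident)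
  then show ?thesis
    by (simp add: F_eq[abs_def] inner_add_left inner_add_right inner_commute)
qed

lemma hilbert_form_eq: "hilbert_form F p Z = (dir (snd p) + w (fst p)) \<bullet> fst Z"
proof -
  let ?f = "\<lambda>s::real. F (fst p) (dir (snd p) + s *\<^sub>R fst Z)"
  have "((\<lambda>s. dir (snd p) + s *\<^sub>R fst Z) has_derivative (\<lambda>s. s *\<^sub>R fst Z)) (at 0)"
    by (auto intro!: derivative_eq_intros)
  moreover have "(F (fst p) has_derivative (\<lambda>u. (sgn (dir (snd p)) + w (fst p)) \<bullet> u))
      (at (dir (snd p) + 0 *\<^sub>R fst Z))"
    using F_has_derivative[OF dir_neq_0, of "fst p" "snd p"] by simp
  ultimately have "(?f has_derivative (\<lambda>s. (sgn (dir (snd p)) + w (fst p)) \<bullet> (s *\<^sub>R fst Z))) (at 0)"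
    by (rule has_derivative_compose)
  moreover have "(\<lambda>s. (sgn (dir (snd p)) + w (fst p)) \<bullet> (s *\<^sub>R fst Z)) = (*) ((dir (snd p) + w (fst p)) \<bullet> fst Z)"
    by (simp add: fun_eq_iff sgn_div_norm)
  ultimately have "(?f has_real_derivative (dir (snd p) + w (fst p)) \<bullet> fst Z) (at 0)"
    by (simp only: has_field_derivative_def)
  then have "((\<lambda>s. (?f s - ?f 0) / s) \<longlongrightarrow> (dir (snd p) + w (fst p)) \<bullet> fst Z) (at 0)"
    by (simp add: DERIV_def)
  then show ?thesis
    unfolding hilbert_form_def by (intro tendsto_Lim) auto
qed

text \<open>The derivative of \<open>w\<close> enters as a symmetric bilinear form in the horizontal
  parts and cancels under antisymmetrization. Hence dA is that of the flat metric, whatever t and h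
  are.\<close>

lemma ext_deriv_eq:
  "ext_deriv (hilbert_form F) p Y Z = snd Y * (ndir (snd p) \<bullet> fst Z) - snd Z * (ndir (snd p) \<bullet> fst Y)"
proof -
  let ?D = "frechet_derivative w (at (fst p))"
  have *: "frechet_derivative (\<lambda>q. hilbert_form F q Z) (at p) Y = (snd Y *\<^sub>R ndir (snd p) + ?D (fst Y)) \<bullet> fst Z" for Y Z
  proof -
    have "((\<lambda>q. dir (snd q)) has_derivative (\<lambda>v. snd v *\<^sub>R ndir (snd p))) (at p)"
      by (rule has_derivative_compose[OF _ dir_has_derivative]) (auto intro!: derivative_eq_intros)
    moreover have "((\<lambda>q. w (fst q)) has_derivative (\<lambda>v. ?D (fst v))) (at p)"
      by (rule has_derivative_compose[OF _ smooth_has_derivative[OF smooth_w]]) (auto intro!: derivative_eq_intros)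
    ultimately have "((\<lambda>q. (dir (snd q) + w (fst q)) \<bullet> fst Z) has_derivative
        (\<lambda>v. (snd v *\<^sub>R ndir (snd p) + ?D (fst v)) \<bullet> fst Z)) (at p)"
      by (intro has_derivative_inner_left has_derivative_add)
    from frechet_derivative_at[OF this, symmetric] show ?thesis
      unfolding hilbert_form_eq by (simp only:)
  qed
  have "?D = (\<lambda>v. t *\<^sub>R frechet_derivative (grad h) (at (fst p)) v)"
    unfolding w_def
    by (rule frechet_derivative_at[symmetric] has_derivative_scaleR_right
        smooth_has_derivative[OF smooth_grad[OF smooth_h]])+
  then have "?D (fst Y) \<bullet> fst Z = ?D (fst Z) \<bullet> fst Y"
    by (simp add: second_derivative_sym)
  then show ?thesis
    unfolding ext_deriv_def * by (simp add: inner_add_left)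
qed

text \<open>Written as the wedge of a multiple of d\<theta> with - dx \<and> dy, so that the forms
  \<alpha> and \<Omega> of \<open>ht_forms\<close> can be read off.\<close>

lemma contact_volume_eq:
  "contact_volume F p X Y Z = wedge12 (\<lambda>Z. speed p * snd Z)
     (\<lambda>Y Z. - (fst Y $ 1 * fst Z $ 2 - fst Y $ 2 * fst Z $ 1)) X Y Z"
proof -
  have c: "(cos (snd p))\<^sup>2 = 1 - (sin (snd p))\<^sup>2" by (simp add: cos_squared_eq)
  define C S where "C = cos (snd p)" and "S = sin (snd p)"
  have CS: "C * C = 1 - S * S" using c by (simp add: C_def S_def power2_eq_square)
  \<comment> \<open>Removes squares of \<open>C\<close> also inside longer products, so that both
    sides reach a common normal form.\<close>
  have CC: "C * (C * x) = x - S * (S * x)" for x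
    using CS by (metis (no_types, lifting) left_diff_distrib mult.assoc mult_1)
  show ?thesis
    unfolding contact_volume_def wedge12_def ext_deriv_eq hilbert_form_eq speed_def inner_2
      dir_nth ndir_nth vector_add_component C_def[symmetric] S_def[symmetric]
    by (simp add: algebra_simps CS CC)
qed

lemma contact_density_eq: "contact_density F p = speed p"
  using speed_pos[of p] by (simp add: contact_density_def contact_volume_eq wedge12_def axis_def)

text \<open>The linear term \<open>w x \<bullet> dir \<theta>\<close> has mean zero on the circle.
  This is the reason why the volume does not change.\<close>

lemma speed_has_integral: "((\<lambda>\<theta>. speed (x, \<theta>)) has_integral 2 * pi) {0..2 * pi}"
proof -
  let ?g = "\<lambda>\<theta>. \<theta> + w x $ 1 * sin \<theta> - w x $ 2 * cos \<theta>"
  have "((\<lambda>\<theta>. speed (x, \<theta>)) has_integral (?g (2 * pi) - ?g 0)) {0..2 * pi}"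
  proof (rule fundamental_theorem_of_calculus)
    show "(?g has_vector_derivative speed (x, \<theta>)) (at \<theta> within {0..2 * pi})" for \<theta>
      unfolding speed_def inner_2 has_real_derivative_iff_has_vector_derivative[symmetric]
      by (auto intro!: derivative_eq_intros)
  qed simp
  then show ?thesis by simp
qed

section \<open>The volume form\<close>

definition vol :: "real^2 \<Rightarrow> real^2 \<Rightarrow> real^2 \<Rightarrow> real" where
  "vol x a b = - (a $ 1 * b $ 2 - a $ 2 * b $ 1)"

lemma ht_forms_vol: "ht_forms F vol (\<lambda>p Z. speed p * snd Z)"
  unfolding ht_forms_def
proof (intro conjI allI impI)
  show "torus_periodic vol" by (simp add: torus_periodic_def vol_def fun_eq_iff)
  show "bilinear (vol x)" for x
    by (auto simp: bilinear_def linear_iff vol_def algebra_simps)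
  show "vol x v v = 0" for x v by (simp add: vol_def)
  show "vol x \<noteq> (\<lambda>v w. 0)" for x
  proof
    assume "vol x = (\<lambda>v w. 0)"
    from fun_cong[OF fun_cong[OF this, of "axis 1 1"], of "axis 2 1"]
    show False by (simp add: vol_def axis_def)
  qed
  show "continuous_on UNIV (\<lambda>x. vol x v w)" for v w by (simp add: vol_def)
  show "(\<lambda>Z. speed p * snd Z) = (\<lambda>Z. speed q * snd Z)" if "hm_eq p q" for p q :: hm
    using speed_hm_eq[OF that] by simp
  show "linear (\<lambda>Z. speed p * snd Z)" for p :: hm
    by (auto simp: linear_iff algebra_simps)
  show "continuous_on UNIV (\<lambda>p. speed p * snd Z)" for Z :: hm
    by (intro continuous_intros smooth_continuous_on[OF smooth_speed])
  show "wedge12 (\<lambda>Z. speed p * snd Z) (\<lambda>Y Z. vol (fst p) (fst Y) (fst Z)) = contact_volume F p" for p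
    by (simp add: fun_eq_iff contact_volume_eq vol_def)
  show "((\<lambda>\<theta>. speed (x, \<theta>) * snd (0::real^2, 1::real)) has_integral 2 * pi) {0..2 * pi}" for x
    using speed_has_integral by simp
qed

text \<open>On the frame of two horizontal axes and the fibre direction, the wedge equation says
  that the fibre part of \<alpha> times \<open>?o\<close> equals minus the speed. Both have known
  integrals over the fibre, 2 pi each up to sign, which forces \<open>?o = -1\<close>; bilinearity
  and alternation give the rest of \<Omega>.\<close>

lemma ht_forms_unique:
  assumes "ht_forms F \<Omega> \<alpha>"
  shows "\<Omega> = vol"
proof (intro ext)
  fix x a b
  have bil: "bilinear (\<Omega> x)" and alt: "\<Omega> x v v = 0" for v
    using assms by (auto simp: ht_forms_def)
  have wedge: "wedge12 (\<alpha> p) (\<lambda>Y Z. \<Omega> (fst p) (fst Y) (fst Z)) = contact_volume F p" for p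
    using assms unfolding ht_forms_def by blast
  have int: "((\<lambda>\<theta>. \<alpha> (x, \<theta>) (0, 1)) has_integral 2 * pi) {0..2 * pi}"
    using assms by (auto simp: ht_forms_def)
  let ?o = "\<Omega> x (axis 1 1) (axis 2 1)"
  have lin: "\<Omega> x (u + v) y = \<Omega> x u y + \<Omega> x v y" "\<Omega> x y (u + v) = \<Omega> x y u + \<Omega> x y v"
    "\<Omega> x (r *\<^sub>R u) y = r * \<Omega> x u y" "\<Omega> x y (r *\<^sub>R u) = r * \<Omega> x y u" for u v y r
    using bil by (auto simp: bilinear_def linear_iff)
  have "\<alpha> (x, \<theta>) (0, 1) * ?o = - speed (x, \<theta>)" for \<theta>
  proof -
    have "\<Omega> x y 0 = 0" for y using lin(4)[of y 0 0] by simp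
    then show ?thesis
      using fun_cong[OF fun_cong[OF fun_cong[OF wedge[of "(x, \<theta>)"], of "(axis 1 1, 0)"], of "(axis 2 1, 0)"], of "(0, 1)"]
      by (simp add: contact_volume_eq wedge12_def axis_def)
  qed
  then have "((\<lambda>\<theta>. - speed (x, \<theta>)) has_integral (2 * pi * ?o)) {0..2 * pi}"
    using has_integral_mult_left[OF int, of ?o] by simp
  moreover have "((\<lambda>\<theta>. - speed (x, \<theta>)) has_integral (- (2 * pi))) {0..2 * pi}"
    by (rule has_integral_neg[OF speed_has_integral])
  ultimately have "2 * pi * ?o = - (2 * pi)"
    by (rule has_integral_unique)
  then have "pi * ?o = pi * (-1)" by simp
  then have o: "?o = -1" by (subst (asm) mult_left_cancel) simp_all
  moreover have "\<Omega> x (axis 2 1) (axis 1 1) = - ?o"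
    using alt[of "axis 1 1 + axis 2 1"] alt[of "axis 1 1"] alt[of "axis 2 1"] by (simp add: lin)
  moreover have dec: "v = v $ 1 *\<^sub>R axis 1 1 + v $ 2 *\<^sub>R axis 2 1" for v :: "real^2"
    by (simp add: vec_eq_iff forall_2 axis_def)
  have "\<Omega> x a b = \<Omega> x (a $ 1 *\<^sub>R axis 1 1 + a $ 2 *\<^sub>R axis 2 1) (b $ 1 *\<^sub>R axis 1 1 + b $ 2 *\<^sub>R axis 2 1)"
    using dec by metis
  ultimately show "\<Omega> x a b = vol x a b"
    by (simp add: lin alt vol_def)
qed

lemma ht_density_eq: "ht_density F x = 1"
proof -
  have "ht_volume_form F = vol"
    unfolding ht_volume_form_def using ht_forms_vol ht_forms_unique by blast
  then show ?thesis by (simp add: ht_density_def vol_def axis_def)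
qed

lemma geodesic_field_eq: "geodesic_field F p = ((1 / speed p) *\<^sub>R dir (snd p), 0)"
  unfolding geodesic_field_def
proof (rule the_equality)
  show "hilbert_form F p ((1 / speed p) *\<^sub>R dir (snd p), 0) = 1 \<and>
    (\<forall>Y. ext_deriv (hilbert_form F) p ((1 / speed p) *\<^sub>R dir (snd p), 0) Y = 0)"
    using speed_pos[of p] by (simp add: hilbert_form_eq ext_deriv_eq inner_add_left speed_def)
next
  fix X :: hm
  assume X: "hilbert_form F p X = 1 \<and> (\<forall>Y. ext_deriv (hilbert_form F) p X Y = 0)"
  \<comment> \<open>Testing i_X dA = 0 against the horizontal normal removes the angular part of X,
    and against the fibre direction the normal part. What is left is a multiple of
    \<open>dir\<close>, fixed by A(X) = 1.\<close>
  have sX: "snd X = 0"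
    using X[THEN conjunct2, rule_format, of "(ndir (snd p), 0)"] by (simp add: ext_deriv_eq)
  have "ndir (snd p) \<bullet> fst X = 0"
    using X[THEN conjunct2, rule_format, of "(0, 1)"] by (simp add: ext_deriv_eq)
  then have fX: "fst X = (fst X \<bullet> dir (snd p)) *\<^sub>R dir (snd p)"
    using dir_ndir_decomp[of "fst X" "snd p"] by (simp add: inner_commute)
  have "1 = (dir (snd p) + w (fst p)) \<bullet> ((fst X \<bullet> dir (snd p)) *\<^sub>R dir (snd p))"
    using X[THEN conjunct1] fX by (simp add: hilbert_form_eq)
  also have "\<dots> = (fst X \<bullet> dir (snd p)) * speed p"
    by (simp add: speed_def inner_add_left)
  finally have "fst X \<bullet> dir (snd p) = 1 / speed p"
    using speed_pos[of p] by (simp add: field_simps)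
  then show "X = ((1 / speed p) *\<^sub>R dir (snd p), 0)"
    using fX sX by (metis prod.collapse)
qed

text \<open>Up to the factor 2, the quadratic form is the square of dF(z) plus F times the Hessian
  of the Euclidean norm. The second term is a positive multiple of the squared determinant
  \<open>\<delta>\<close> of z and v; when it vanishes, z is a nonzero multiple of v and the first
  term is a nonzero multiple of the square of F(v), by homogeneity.\<close>

lemma hessian_F_sq:
  assumes "v \<noteq> 0" "z \<noteq> 0"
  shows "0 < z \<bullet> (hessian (\<lambda>u. (F x u)\<^sup>2) v *v z)"
proof -
  let ?N = "norm v" and ?a = "sgn v + w x"
  have D1: "frechet_derivative (\<lambda>u. (F x u)\<^sup>2) (at u) e = 2 * F x u * ((sgn u + w x) \<bullet> e)" if "u \<noteq> 0" for u e
  proof -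
    have "((\<lambda>u. (F x u)\<^sup>2) has_derivative (\<lambda>e. 2 * F x u * ((sgn u + w x) \<bullet> e))) (at u)"
      using has_derivative_power[OF F_has_derivative[OF that, of x], of 2] by (simp add: mult_ac)
    from frechet_derivative_at[OF this] show ?thesis by metis
  qed
  have D2: "frechet_derivative (\<lambda>u. frechet_derivative (\<lambda>u. (F x u)\<^sup>2) (at u) e) (at v) d
    = 2 * (?a \<bullet> d) * (?a \<bullet> e) + 2 * F x v * ((d \<bullet> e) / ?N - (v \<bullet> d) * (v \<bullet> e) / ?N ^ 3)" for d e
  proof -
    have inv: "((\<lambda>u. inverse (norm u)) has_derivative (\<lambda>d. - (inverse ?N * (d \<bullet> sgn v) * inverse ?N))) (at v)"
      by (rule Deriv.has_derivative_inverse) (use assms has_derivative_norm in auto)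
    have "((\<lambda>u. 2 * F x u * ((inverse (norm u) *\<^sub>R u + w x) \<bullet> e)) has_derivative
       (\<lambda>d. 2 * F x v * ((inverse ?N *\<^sub>R d + (- (inverse ?N * (d \<bullet> sgn v) * inverse ?N)) *\<^sub>R v) \<bullet> e) +
         2 * (?a \<bullet> d) * ((inverse ?N *\<^sub>R v + w x) \<bullet> e))) (at v)"
      by (intro has_derivative_mult has_derivative_mult_right has_derivative_inner_left has_derivative_add_const
          F_has_derivative assms has_derivative_scaleR inv has_derivative_ident)
    then have "((\<lambda>u. frechet_derivative (\<lambda>u. (F x u)\<^sup>2) (at u) e) has_derivative
       (\<lambda>d. 2 * F x v * ((inverse ?N *\<^sub>R d + (- (inverse ?N * (d \<bullet> sgn v) * inverse ?N)) *\<^sub>R v) \<bullet> e) +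
         2 * (?a \<bullet> d) * ((inverse ?N *\<^sub>R v + w x) \<bullet> e))) (at v)"
      by (rule has_derivative_transform_within_open[of _ _ _ _ "- {0}"]) (use assms D1 in \<open>auto simp: sgn_div_norm divide_inverse_commute\<close>)
    from fun_cong[OF frechet_derivative_at[OF this], of d, symmetric]
    have "frechet_derivative (\<lambda>u. frechet_derivative (\<lambda>u. (F x u)\<^sup>2) (at u) e) (at v) d
      = 2 * F x v * (((d \<bullet> e) * inverse ?N - (inverse ?N * (d \<bullet> sgn v) * inverse ?N) * (v \<bullet> e)))
        + 2 * (?a \<bullet> d) * ((inverse ?N *\<^sub>R v + w x) \<bullet> e)"
      by (simp only: inner_add_left inner_scaleR_left) (simp add: mult.commute)
    moreover have "inverse ?N *\<^sub>R v = sgn v" by (simp add: sgn_div_norm)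
    moreover have "d \<bullet> sgn v = (v \<bullet> d) * inverse ?N"
      by (simp add: sgn_div_norm inner_commute)
    ultimately show ?thesis
      using assms by (simp add: divide_inverse power3_eq_cube mult_ac)
  qed
  have quad: "z \<bullet> (hessian (\<lambda>u. (F x u)\<^sup>2) v *v z)
    = 2 * (?a \<bullet> z)\<^sup>2 + 2 * F x v * ((z \<bullet> z) / ?N - (v \<bullet> z)\<^sup>2 / ?N ^ 3)"
    unfolding hessian_def matrix_vector_mult_def D2
    by (simp add: inner_2[of z] sum_2 inner_axis inner_axis_axis axis_eq_axis power2_eq_square)
      (simp add: inner_2 axis_def algebra_simps add_divide_distrib diff_divide_distrib)
  have N: "?N\<^sup>2 = v \<bullet> v" "?N > 0" using assms by (simp_all add: power2_norm_eq_inner)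
  \<comment> \<open>Lagrange's identity: the defect in the Cauchy-Schwarz inequality for z and v is
    the square of their determinant.\<close>
  define \<delta> where "\<delta> = z $ 1 * v $ 2 - z $ 2 * v $ 1"
  have "(z \<bullet> z) * ?N\<^sup>2 - (v \<bullet> z)\<^sup>2 = \<delta>\<^sup>2"
    unfolding N \<delta>_def by (simp add: inner_2 power2_eq_square algebra_simps)
  moreover have "(z \<bullet> z) / ?N - (v \<bullet> z)\<^sup>2 / ?N ^ 3 = ((z \<bullet> z) * ?N\<^sup>2 - (v \<bullet> z)\<^sup>2) / ?N ^ 3"
    using N(2) by (simp add: field_simps power2_eq_square power3_eq_cube)
  ultimately have quad': "z \<bullet> (hessian (\<lambda>u. (F x u)\<^sup>2) v *v z) = 2 * (?a \<bullet> z)\<^sup>2 + 2 * F x v * (\<delta>\<^sup>2 / ?N ^ 3)"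
    using quad by simp
  show ?thesis
  proof (cases "\<delta> = 0")
    case False
    then have "0 < 2 * F x v * (\<delta>\<^sup>2 / ?N ^ 3)"
      using F_pos[OF assms(1), of x] N(2) by simp
    then show ?thesis using quad' zero_le_power2[of "?a \<bullet> z"] by linarith
  next
    case True
    define c where "c = (z \<bullet> v) / (v \<bullet> v)"
    have "(v \<bullet> v) *\<^sub>R z = (z \<bullet> v) *\<^sub>R v"
      using True by (simp add: vec_eq_iff forall_2 inner_2 \<delta>_def algebra_simps)
    then have "z = c *\<^sub>R v"
      using assms(1) unfolding c_def by (metis (no_types, lifting) divide_inverse_commute inner_eq_zero_iff left_inverse scaleR_one scaleR_scaleR)
    moreover from this have "c \<noteq> 0" using assms(2) by auto
    moreover have "?a \<bullet> (c *\<^sub>R v) = c * F x v"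
      using N by (simp add: F_eq inner_add_left sgn_div_norm field_simps power2_eq_square)
    ultimately have "(?a \<bullet> z)\<^sup>2 > 0"
      using F_pos[OF assms(1), of x] by simp
    then show ?thesis using quad' True by simp
  qed
qed

lemma Ck_F: "Ck_on k (\<lambda>(x, v). F x v) {(x, v). v \<noteq> 0}"
proof -
  let ?S = "{(x, v). v \<noteq> 0} :: ((real^2) \<times> (real^2)) set"
  have "?S = UNIV \<times> (- {0})" by auto
  then have S: "open ?S"
    using open_Times[OF open_UNIV open_Compl[OF closed_singleton]] by metis
  have "smooth (\<lambda>q::(real^2) \<times> (real^2). snd q \<bullet> snd q)"
    unfolding inner_2 by (intro smooth_intros)
  then have 1: "Ck_on k (\<lambda>q. sqrt (snd q \<bullet> snd q)) ?S"
    by (intro Ck_on_compose[OF S _ _ Ck_on_sqrt] Ck_on_subset[OF smoothD]) auto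
  have "smooth (\<lambda>q::(real^2) \<times> (real^2). w (fst q))"
    by (intro smooth_compose[OF smooth_w] smooth_intros)
  then have "smooth (\<lambda>q::(real^2) \<times> (real^2). w (fst q) \<bullet> snd q)"
    unfolding inner_2 by (intro smooth_intros)
  then have "Ck_on k (\<lambda>q. w (fst q) \<bullet> snd q) ?S"
    by (intro Ck_on_subset[OF smoothD]) auto
  from Ck_on_add[OF S 1 this] show ?thesis
    by (simp add: F_eq case_prod_beta' norm_eq_sqrt_inner)
qed

lemma finsler_metric_F: "finsler_metric F"
  unfolding finsler_metric_def
proof (intro conjI allI impI)
  show "torus_periodic F"
    unfolding torus_periodic_def by (auto simp: fun_eq_iff F_eq w_periodic)
  show "0 \<le> F x v" for x v
    using F_pos[of v x] by (cases "v = 0") (auto simp: F_eq)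
  have "continuous_on UNIV (\<lambda>q::(real^2)\<times>(real^2). norm (snd q) + w (fst q) \<bullet> snd q)"
    by (intro continuous_intros continuous_on_compose2[OF smooth_continuous_on[OF smooth_w, of UNIV]]) auto
  then show "continuous_on UNIV (\<lambda>(x, v). F x v)"
    by (simp add: F_eq case_prod_beta')
  show "Ck_on 2 (\<lambda>(x, v). F x v) {(x, v). v \<noteq> 0}" by (rule Ck_F)
  show "F x (l *\<^sub>R v) = l * F x v" if "0 < l" for x v l
    using that by (simp add: F_eq algebra_simps)
  show "v = 0" if "F x v = 0" for x v
    using F_pos[of v x] that by force
  show "0 < z \<bullet> (hessian (\<lambda>u. (F x u)\<^sup>2) v *v z)" if "v \<noteq> 0" "z \<noteq> 0" for x v z
    by (rule hessian_F_sq[OF that])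
qed

lemma randers_metric_F: "randers_metric F"
proof -
  have "riemannian_metric flat_metric"
    unfolding riemannian_metric_def
    by (auto simp: torus_periodic_def flat_metric_def fun_eq_iff smooth_const inner_commute
        bilinear_def linear_iff inner_add_left inner_add_right)
  moreover have "one_form (\<lambda>x v. t * frechet_derivative h (at x) v)"
    unfolding one_form_def
  proof (intro conjI allI)
    have "frechet_derivative h (at x) = (\<lambda>v. grad h x \<bullet> v)" for x
      using frechet_derivative_eq_grad[OF smooth_differentiable[OF smooth_h]] by blast
    then show "torus_periodic (\<lambda>x v. t * frechet_derivative h (at x) v)"
      by (simp add: torus_periodic_def grad_periodic[OF smooth_h periodic_h])
    show "smooth (\<lambda>x. t * frechet_derivative h (at x) v)" for v
      by (intro smooth_intros smooth_frechet_derivative smooth_h)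
    show "linear (\<lambda>v. t * frechet_derivative h (at x) v)" for x
      using linear_compose_scale_right[OF has_derivative_linear[OF smooth_has_derivative[OF smooth_h]], of t x]
      by simp
  qed
  ultimately show ?thesis
    using finsler_metric_F unfolding randers_metric_def by blast
qed

end

section \<open>Geodesic flow and closed geodesics\<close>

text \<open>\<open>g\<close> solves f(g, y) = s for its first argument. Differentiability comes from
  the rule for inverse maps; the formula for \<open>g'\<close> involves only derivatives of
  \<open>f\<close> at \<open>(g q, snd q)\<close> and a reciprocal, so regularity of order k yields
  order k + 1.\<close>

lemma smooth_implicit:
  fixes f g :: "real \<times> 'a::euclidean_space \<Rightarrow> real"
  assumes f: "smooth f" and nz: "\<And>q. frechet_derivative f (at q) (1, 0) \<noteq> 0"
    and fg: "\<And>q. f (g q, snd q) = fst q" and g: "continuous_on UNIV g"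
  shows "smooth g"
proof (rule smoothI)
  let ?D = "\<lambda>q. frechet_derivative f (at (g q, snd q))"
  let ?g' = "\<lambda>q v. (fst v - ?D q (0, snd v)) * inverse (?D q (1, 0))"
  have D: "(f has_derivative ?D q) (at (g q, snd q))" for q
    by (rule smooth_has_derivative[OF f])
  have lin: "linear (?D q)" for q
    using D has_derivative_linear by blast
  have bl: "bounded_linear (?D q)" for q
    using D has_derivative_bounded_linear by blast
  have der: "(g has_derivative ?g' q) (at q)" for q
  proof -
    \<comment> \<open>Carrying \<open>snd\<close> along makes the implicit problem an inversion:
      this map is a right inverse of \<open>(f q, snd q)\<close>.\<close>
    have "((\<lambda>q. (g q, snd q)) has_derivative (\<lambda>v. (?g' q v, snd v))) (at q)"
    proof (rule has_derivative_inverse_basic[where T = UNIV])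
      have "(f has_derivative ?D q) (at (g q, snd q))" by (rule D)
      then show "((\<lambda>q. (f q, snd q)) has_derivative (\<lambda>v. (?D q v, snd v))) (at (g q, snd q))"
        by (intro has_derivative_Pair has_derivative_snd has_derivative_ident)
      have "bounded_linear (\<lambda>v. ?D q (0, snd v))"
        by (rule bounded_linear_compose[OF bl]) (intro bounded_linear_Pair bounded_linear_zero bounded_linear_snd)
      from bounded_linear_compose[OF bounded_linear_mult_left bounded_linear_sub[OF bounded_linear_fst this]]
      have "bounded_linear (?g' q)" .
      from bounded_linear_Pair[OF this bounded_linear_snd]
      show "bounded_linear (\<lambda>v. (?g' q v, snd v))" .
      have "?D q v - ?D q (0, snd v) = fst v * ?D q (1, 0)" for v
        using linear_add[OF lin, of q "fst v *\<^sub>R (1, 0)" "(0, snd v)"] linear_cmul[OF lin, of q "fst v" "(1, 0)"]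
        by simp
      then have "?g' q (?D q v, snd v) = fst v" for v
        using nz[of "(g q, snd q)"] by (simp del: diff_Pair)
      then show "(\<lambda>v. (?g' q v, snd v)) \<circ> (\<lambda>v. (?D q v, snd v)) = id"
        by (simp add: fun_eq_iff)
      show "continuous (at q) (\<lambda>q. (g q, snd q))"
      proof (rule continuous_Pair[OF _ continuous_snd[OF continuous_ident]])
        show "isCont g q"
          using g continuous_on_eq_continuous_at[OF open_UNIV, of g] by blast
      qed
      show "(f (g z, snd z), snd (g z, snd z)) = z" for z
        by (simp add: fg)
    qed auto
    from has_derivative_fst[OF this] show ?thesis by simp
  qed
  show "Ck_on k g UNIV" for k
  proof (induction k)
    case 0
    show ?case using g by simp
  next
    case (Suc k)
    have N: "Ck_on k (\<lambda>q. (g q, snd q)) UNIV"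
      by (intro Ck_on_Pair Suc Ck_on_bounded_linear bounded_linear_snd open_UNIV)
    have Dk: "Ck_on k (\<lambda>q. ?D q v) UNIV" for v
      by (rule Ck_on_compose[OF open_UNIV open_UNIV subset_UNIV _ N])
        (rule smoothD[OF smooth_frechet_derivative[OF f]])
    have "Ck_on k (\<lambda>q. inverse (?D q (1, 0))) UNIV"
      by (rule Ck_on_compose[OF open_UNIV _ _ Ck_on_inverse Dk]) (use nz in auto)
    then show ?case
      by (intro Ck_on_SucI[OF open_UNIV der] Ck_on_mult Ck_on_diff Ck_on_const Dk open_UNIV)
  qed
qed

section \<open>Geodesics parametrized by Finsler length\<close>

context randers_potential
begin

text \<open>Finsler arc length along the line through \<open>p\<close> as a function of the
  Euclidean arc length \<open>\<sigma>\<close>. The additive constant is chosen so that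
  \<open>K 0 p = t * h (fst p)\<close>; \<open>S\<close> below is the inverse function.\<close>

definition K :: "real \<Rightarrow> hm \<Rightarrow> real" where
  "K \<sigma> p = \<sigma> + t * h (fst p + \<sigma> *\<^sub>R dir (snd p))"

lemma h_has_derivative: "(h has_derivative (\<lambda>v. grad h x \<bullet> v)) (at x)"
proof -
  have "frechet_derivative h (at x) = (\<lambda>v. grad h x \<bullet> v)"
    using frechet_derivative_eq_grad[OF smooth_differentiable[OF smooth_h]] by blast
  then show ?thesis
    using smooth_has_derivative[OF smooth_h, of x] by simp
qed

lemma h_has_derivative_along:
  assumes "(c has_vector_derivative v) (at s)"
  shows "((\<lambda>s. t * h (c s)) has_real_derivative w (c s) \<bullet> v) (at s)"
proof -
  have "((\<lambda>s. h (c s)) has_derivative (\<lambda>r. grad h (c s) \<bullet> (r *\<^sub>R v))) (at s)"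
    by (rule has_derivative_compose[OF _ h_has_derivative]) (use assms in \<open>simp add: has_vector_derivative_def\<close>)
  moreover have "(\<lambda>r. t * (grad h (c s) \<bullet> (r *\<^sub>R v))) = (*) (w (c s) \<bullet> v)"
    by (simp add: fun_eq_iff w_def)
  ultimately show ?thesis
    using has_derivative_mult_right[of "\<lambda>s. h (c s)" _ _ t] by (metis has_field_derivative_def)
qed

lemma line_has_vector_derivative: "((\<lambda>\<sigma>. x + \<sigma> *\<^sub>R v) has_vector_derivative v) (at \<sigma>)"
  by (auto intro!: derivative_eq_intros simp: has_vector_derivative_def)

lemma K_has_derivative:
  "((\<lambda>\<sigma>. K \<sigma> p) has_real_derivative speed (fst p + \<sigma> *\<^sub>R dir (snd p), snd p)) (at \<sigma>)"
  using DERIV_add[OF DERIV_ident h_has_derivative_along[OF line_has_vector_derivative]]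
  by (simp add: K_def speed_def)

lemma K_mono:
  assumes "\<sigma> \<le> \<sigma>'"
  shows "(1 - t) * (\<sigma>' - \<sigma>) \<le> K \<sigma>' p - K \<sigma> p"
proof (cases "\<sigma> = \<sigma>'")
  case False
  then obtain z where "K \<sigma>' p - K \<sigma> p = (\<sigma>' - \<sigma>) * speed (fst p + z *\<^sub>R dir (snd p), snd p)"
    using MVT2[of \<sigma> \<sigma>', OF _ K_has_derivative] assms by (metis less_eq_real_def)
  then show ?thesis
    using mult_left_mono[OF speed_ge, of "\<sigma>' - \<sigma>"] assms by (metis diff_ge_0_iff_ge mult.commute)
qed simp

lemma K_dist: "(1 - t) * \<bar>\<sigma>' - \<sigma>\<bar> \<le> \<bar>K \<sigma>' p - K \<sigma> p\<bar>"
  using K_mono[of \<sigma> \<sigma>' p] K_mono[of \<sigma>' \<sigma> p] by (cases "\<sigma> \<le> \<sigma>'") auto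

lemma K_strict_mono:
  assumes "\<sigma> < \<sigma>'"
  shows "K \<sigma> p < K \<sigma>' p"
proof -
  have "0 < (1 - t) * (\<sigma>' - \<sigma>)" using assms t_less by simp
  then show ?thesis using K_mono[of \<sigma> \<sigma>' p] assms by linarith
qed

lemma K_inj: "K \<sigma> p = K \<sigma>' p \<Longrightarrow> \<sigma> = \<sigma>'"
  using K_strict_mono by (metis less_irrefl linorder_less_linear)

lemma K_surj: "\<exists>\<sigma>. K \<sigma> p = c"
proof -
  \<comment> \<open>\<open>K\<close> grows at rate at least 1 - t, so a parameter interval of this
    length covers the gap between \<open>K 0 p\<close> and \<open>c\<close>.\<close>
  define a where "a = \<bar>c - K 0 p\<bar> / (1 - t)"
  have a: "0 \<le> a" "(1 - t) * a = \<bar>c - K 0 p\<bar>"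
    using t_less by (auto simp: a_def)
  have "K (- a) p \<le> c" "c \<le> K a p"
    using K_mono[of "- a" 0 p] K_mono[of 0 a p] a by auto
  moreover have "continuous_on {- a..a} (\<lambda>\<sigma>. K \<sigma> p)"
    using K_has_derivative DERIV_isCont continuous_at_imp_continuous_on by blast
  ultimately show ?thesis
    using IVT'[of "\<lambda>\<sigma>. K \<sigma> p" "- a" c a] a by auto
qed

definition S :: "real \<Rightarrow> hm \<Rightarrow> real" where
  "S c p = (THE \<sigma>. K \<sigma> p = c)"

lemma S_eqI: "K \<sigma> p = c \<Longrightarrow> S c p = \<sigma>"
  unfolding S_def using K_inj by blast

lemma K_S [simp]: "K (S c p) p = c"
  using K_surj S_eqI by metis

lemma smooth_K: "smooth (\<lambda>q. K (fst q) (snd q))"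
  unfolding K_def
  by (intro smooth_intros smooth_compose[OF smooth_h])

lemma smooth_S: "smooth (\<lambda>q. S (fst q) (snd q))"
proof (rule smooth_implicit[OF smooth_K])
  fix q :: "real \<times> hm"
  have "((\<lambda>\<sigma>. (\<sigma>, snd q)) has_derivative (\<lambda>r. (r, 0))) (at (fst q))"
    by (auto intro!: derivative_eq_intros)
  moreover have "((\<lambda>q. K (fst q) (snd q)) has_derivative frechet_derivative (\<lambda>q. K (fst q) (snd q)) (at q))
      (at (fst q, snd q))"
    using smooth_has_derivative[OF smooth_K, of q] by simp
  ultimately have "((\<lambda>\<sigma>. K (fst (\<sigma>, snd q)) (snd (\<sigma>, snd q))) has_derivative
      (\<lambda>r. frechet_derivative (\<lambda>q. K (fst q) (snd q)) (at q) (r, 0))) (at (fst q))"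
    by (rule has_derivative_compose[where f = "\<lambda>\<sigma>. (\<sigma>, snd q)" and g = "\<lambda>q. K (fst q) (snd q)"])
  then have "((\<lambda>\<sigma>. K \<sigma> (snd q)) has_derivative
      (\<lambda>r. frechet_derivative (\<lambda>q. K (fst q) (snd q)) (at q) (r, 0))) (at (fst q))"
    by simp
  moreover have "((\<lambda>\<sigma>. K \<sigma> (snd q)) has_derivative
      (\<lambda>r. speed (fst (snd q) + fst q *\<^sub>R dir (snd (snd q)), snd (snd q)) * r)) (at (fst q))"
    using K_has_derivative[of "snd q" "fst q"] by (simp add: has_field_derivative_def)
  ultimately have "frechet_derivative (\<lambda>q. K (fst q) (snd q)) (at q) (1, 0) =
      speed (fst (snd q) + fst q *\<^sub>R dir (snd (snd q)), snd (snd q))"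
    using has_derivative_unique by (metis (no_types, lifting) mult.right_neutral)
  then show "frechet_derivative (\<lambda>q. K (fst q) (snd q)) (at q) (1, 0) \<noteq> 0"
    using speed_pos[of "(fst (snd q) + fst q *\<^sub>R dir (snd (snd q)), snd (snd q))"] by linarith
next
  have "isCont (\<lambda>q. S (fst q) (snd q)) q" for q
  proof -
    \<comment> \<open>\<open>K_dist\<close> evaluated with the parameter of the fixed
      \<open>q\<close> but the base point of the varying \<open>r\<close>. The bound is continuous
      in \<open>r\<close> and vanishes at \<open>q\<close>, which gives continuity of the inverse
      jointly in all variables.\<close>
    let ?b = "\<lambda>r. \<bar>fst r - K (S (fst q) (snd q)) (snd r)\<bar> / (1 - t)"
    have le: "norm (S (fst r) (snd r) - S (fst q) (snd q)) \<le> ?b r" for r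
      using K_dist[of "S (fst r) (snd r)" "S (fst q) (snd q)" "snd r"] t_less
      by (simp add: field_simps)
    have "isCont ?b q"
    proof -
      have "continuous_on UNIV (\<lambda>r::real \<times> hm. K (S (fst q) (snd q)) (snd r))"
        unfolding K_def
        by (intro smooth_continuous_on smooth_intros smooth_compose[OF smooth_h])
      then have "isCont (\<lambda>r. K (S (fst q) (snd q)) (snd r)) q"
        using continuous_on_eq_continuous_at[OF open_UNIV] by blast
      then show ?thesis
        using t_less by (intro continuous_intros) auto
    qed
    then have lim: "(?b \<longlongrightarrow> 0) (at q)"
      by (simp add: isCont_def)
    have "((\<lambda>r. S (fst r) (snd r) - S (fst q) (snd q)) \<longlongrightarrow> 0) (at q)"
      by (rule Lim_null_comparison[OF always_eventually lim]) (use le in blast)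
    then show ?thesis
      by (simp add: isCont_def LIM_zero_iff)
  qed
  then show "continuous_on UNIV (\<lambda>q. S (fst q) (snd q))"
    by (simp add: continuous_on_eq_continuous_at)
qed auto

lemma S_has_derivative:
  "((\<lambda>s. S (s + c) p) has_real_derivative 1 / speed (fst p + S (s + c) p *\<^sub>R dir (snd p), snd p)) (at s)"
proof -
  have sm: "smooth (\<lambda>s. S (s + c) p)"
    using smooth_compose[OF smooth_S, of "\<lambda>s. (s + c, p)"] by (simp add: smooth_intros)
  then obtain D where D: "((\<lambda>s. S (s + c) p) has_real_derivative D) (at s)"
    using smooth_differentiable real_differentiable_def by blast
  have "((\<lambda>s. K (S (s + c) p) p) has_real_derivative
      speed (fst p + S (s + c) p *\<^sub>R dir (snd p), snd p) * D) (at s)"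
    by (rule DERIV_chain2[OF K_has_derivative D])
  moreover have "((\<lambda>s. K (S (s + c) p) p) has_real_derivative 1) (at s)"
    by (auto intro!: derivative_eq_intros)
  ultimately have "speed (fst p + S (s + c) p *\<^sub>R dir (snd p), snd p) * D = 1"
    by (rule DERIV_unique)
  then have "D = 1 / speed (fst p + S (s + c) p *\<^sub>R dir (snd p), snd p)"
    using speed_pos by (simp add: eq_divide_eq mult.commute less_imp_neq[symmetric])
  then show ?thesis using D by simp
qed

text \<open>Euclidean length travelled in Finsler time \<open>s\<close>; the shift accounts for the
  value \<open>K 0 p = t * h (fst p)\<close> at the start.\<close>

definition \<tau> :: "real \<Rightarrow> hm \<Rightarrow> real" where
  "\<tau> s p = S (s + t * h (fst p)) p"

definition flow :: "real \<Rightarrow> hm \<Rightarrow> hm" where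
  "flow s p = (fst p + \<tau> s p *\<^sub>R dir (snd p), snd p)"

lemma \<tau>_has_derivative: "((\<lambda>s. \<tau> s p) has_real_derivative 1 / speed (flow s p)) (at s)"
  unfolding \<tau>_def flow_def by (rule S_has_derivative)

lemma \<tau>_0: "\<tau> 0 p = 0"
  unfolding \<tau>_def by (rule S_eqI) (simp add: K_def)

lemma \<tau>_eqI: "\<sigma> + t * h (fst p + \<sigma> *\<^sub>R dir (snd p)) = s + t * h (fst p) \<Longrightarrow> \<tau> s p = \<sigma>"
  unfolding \<tau>_def by (rule S_eqI) (simp add: K_def)

lemma \<tau>_eq: "\<tau> s p + t * h (fst p + \<tau> s p *\<^sub>R dir (snd p)) = s + t * h (fst p)"
  using K_S[of "s + t * h (fst p)" p] by (simp add: K_def \<tau>_def)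

lemma flow_has_derivative: "((\<lambda>s. flow s p) has_vector_derivative geodesic_field F (flow s p)) (at s)"
proof -
  have "((\<lambda>s. fst p + \<tau> s p *\<^sub>R dir (snd p)) has_derivative
      (\<lambda>r. (r / speed (flow s p)) *\<^sub>R dir (snd p))) (at s)"
    using \<tau>_has_derivative[of p s] unfolding has_field_derivative_def
    by (auto intro!: derivative_eq_intros)
  then have "((\<lambda>s. (fst p + \<tau> s p *\<^sub>R dir (snd p), snd p)) has_derivative
      (\<lambda>r. ((r / speed (flow s p)) *\<^sub>R dir (snd p), 0))) (at s)"
    by (rule has_derivative_Pair[OF _ has_derivative_const])
  moreover have "snd (flow s p) = snd p" by (simp add: flow_def)
  ultimately show ?thesis
    by (simp add: has_vector_derivative_def geodesic_field_eq flow_def[abs_def])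
qed

section \<open>The flow, its time change and its conjugacy\<close>

lemma geodesic_flow_flow: "geodesic_flow F flow"
  unfolding geodesic_flow_def is_flow_of_def
  using flow_has_derivative by (simp add: flow_def \<tau>_0)

lemma h_translate: "hm_eq p q \<Longrightarrow> h (fst p + v) = h (fst q + v)"
proof -
  assume "hm_eq p q"
  then have "fst q - fst p \<in> lattice" by (simp add: hm_eq_def)
  then have "h (fst p + v + (fst q - fst p)) = h (fst p + v)"
    using periodic_h unfolding torus_periodic_def by blast
  then show ?thesis by (simp add: algebra_simps)
qed

lemma S_hm_eq: "hm_eq p q \<Longrightarrow> S c p = S c q"
  by (rule S_eqI) (use K_S[of c q] h_translate[of p q] hm_eq_invariants(2)[of p q] in \<open>simp add: K_def\<close>)

lemma hm_eq_refl [simp]: "hm_eq p p"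
  by (simp add: hm_eq_def lattice_def)

abbreviation flat_flow :: "real \<Rightarrow> hm \<Rightarrow> hm" where
  "flat_flow s p \<equiv> (fst p + s *\<^sub>R dir (snd p), snd p)"

lemma time_change_flow: "time_change flat_flow flow"
  unfolding time_change_def
proof (intro exI[of _ \<tau>] conjI allI impI)
  have "smooth (\<lambda>q. S (fst q + t * h (fst (snd q))) (snd q))"
    using smooth_compose[OF smooth_S, of "\<lambda>q. (fst q + t * h (fst (snd q)), snd q)"]
    by (simp add: smooth_intros smooth_compose[OF smooth_h])
  then show "smooth (\<lambda>(s, p). \<tau> s p)"
    by (simp add: \<tau>_def case_prod_beta')
  show "\<tau> s p = \<tau> s q" if "hm_eq p q" for s p q
    unfolding \<tau>_def using S_hm_eq[OF that] hm_eq_invariants(3)[OF that] by simp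
  show "0 < deriv (\<lambda>r. \<tau> r p) s" for s p
    using DERIV_imp_deriv[OF \<tau>_has_derivative] speed_pos by simp
qed (simp_all add: \<tau>_0 flow_def)

text \<open>Along \<open>flow\<close> the sum of Euclidean displacement and t h grows at unit rate
  (\<open>\<tau>_eq\<close>), so \<open>?g\<close>, which pushes a point forward by t h, carries
  \<open>flow\<close> to unit speed motion. \<open>?f\<close> is the inverse of \<open>?g\<close>:
  the displacement \<open>S 0 p\<close> solves \<sigma> + t h = 0 along the line.\<close>

lemma smoothly_conjugate_flow: "smoothly_conjugate flat_flow flow"
proof -
  let ?f = "\<lambda>p. (fst p + S 0 p *\<^sub>R dir (snd p), snd p)"
  let ?g = "\<lambda>p. (fst p + (t * h (fst p)) *\<^sub>R dir (snd p), snd p)"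
  have S0: "S 0 p + t * h (fst p + S 0 p *\<^sub>R dir (snd p)) = 0" for p
    using K_S[of 0 p] by (simp add: K_def)
  have fg: "?f (?g p) = p" for p
  proof -
    have "S 0 (?g p) = - (t * h (fst p))"
      by (rule S_eqI) (simp add: K_def)
    then show ?thesis by (simp add: prod_eq_iff)
  qed
  have gf: "?g (?f p) = p" for p
  proof -
    have "t * h (fst (?f p)) = - S 0 p" using S0[of p] by simp
    then show ?thesis by (simp add: prod_eq_iff)
  qed
  have bij: "bij ?f"
    by (rule o_bij[of ?g]) (simp_all only: o_def fg gf id_def)
  have inv: "inv ?f = ?g"
    by (rule inv_unique_comp) (simp_all only: o_def fg gf id_def)
  have hm_f: "hm_eq (?f p) (?f q)" if "hm_eq p q" for p q
    using S_hm_eq[OF that] hm_eq_invariants(2)[OF that] that by (simp add: hm_eq_def)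
  have hm_g: "hm_eq (?g p) (?g q)" if "hm_eq p q" for p q
    using hm_eq_invariants[OF that] that by (simp add: hm_eq_def)
  have "smooth (\<lambda>p. S 0 p)"
    using smooth_compose[OF smooth_S, of "\<lambda>p. (0, p)"] by (simp add: smooth_intros)
  then have f: "smooth ?f"
    by (intro smooth_intros)
  have g: "smooth ?g"
    by (intro smooth_intros smooth_compose[OF smooth_h])
  have fl: "?f (flat_flow s p) = flow s (?f p)" for s p
  proof -
    have \<tau>: "\<tau> s (?f p) = s + S 0 (flat_flow s p) - S 0 p"
      using S0[of p] S0[of "flat_flow s p"] by (intro \<tau>_eqI) (simp add: algebra_simps)
    show ?thesis
      unfolding flow_def \<tau> by (simp add: algebra_simps)
  qed
  show ?thesis
    unfolding smoothly_conjugate_def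
  proof (intro exI[of _ ?f] conjI allI)
    show "bij ?f" by (rule bij)
    show "smooth ?f" by (rule f)
    show "smooth (inv ?f)" unfolding inv by (rule g)
    show "hm_eq p q \<longleftrightarrow> hm_eq (?f p) (?f q)" for p q
      using hm_f[of p q] hm_g[of "?f p" "?f q"] unfolding gf by blast
    show "hm_eq (?f (flat_flow s p)) (flow s (?f p))" for s p
      unfolding fl by (rule hm_eq_refl)
  qed
qed

text \<open>A periodic orbit has constant direction u and runs at unit Finsler speed, so its length
  is its period T. The primitive t h returns to its value after translation by the lattice vector k,
  which leaves k = T u; in particular k = 0 is impossible. Conversely, the straight line in
  direction k closes up after time |k|.\<close>

lemma geodesic_lengths_eq:
  assumes "k \<in> lattice"
  shows "geodesic_lengths F k = (if k = 0 then {} else {norm k})"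
proof -
  have closed: "k \<noteq> 0 \<and> T = norm k \<and> curve_length F T c = norm k" if "closed_geodesic F k T c" for T c
  proof -
    from that obtain \<gamma> where T: "0 < T" and k: "c T - c 0 = k"
      and \<gamma>: "\<And>s. (\<gamma> has_vector_derivative geodesic_field F (\<gamma> s)) (at s)" and c: "c = (\<lambda>s. fst (\<gamma> s))"
      unfolding closed_geodesic_def by blast
    have "((\<lambda>s. snd (\<gamma> s)) has_real_derivative 0) (at s)" for s
      using has_derivative_snd[OF \<gamma>[of s, unfolded has_vector_derivative_def]]
      by (simp add: geodesic_field_eq has_field_derivative_def lambda_zero)
    then have th: "snd (\<gamma> s) = snd (\<gamma> 0)" for s
      using DERIV_isconst_all[of "\<lambda>s. snd (\<gamma> s)"] by blast
    define u where "u = dir (snd (\<gamma> 0))"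
    define \<rho> where "\<rho> s = 1 / speed (\<gamma> s)" for s
    have sp: "speed (\<gamma> s) = 1 + w (c s) \<bullet> u" for s
      by (simp add: speed_def c th[of s] u_def)
    have \<rho>1: "\<rho> s + w (c s) \<bullet> (\<rho> s *\<^sub>R u) = 1" and \<rho>0: "0 < \<rho> s" for s
      using speed_pos[of "\<gamma> s"] sp[of s] by (simp_all add: \<rho>_def field_simps)
    have c': "(c has_vector_derivative \<rho> s *\<^sub>R u) (at s)" for s
      using has_derivative_fst[OF \<gamma>[of s, unfolded has_vector_derivative_def]]
      by (simp add: geodesic_field_eq has_vector_derivative_def \<rho>_def u_def th[of s] c)
    have inner: "((\<lambda>s. c s \<bullet> v) has_real_derivative \<rho> s * (u \<bullet> v)) (at s)" for s v
    proof -
      have "(\<lambda>r. (r *\<^sub>R \<rho> s *\<^sub>R u) \<bullet> v) = (*) (\<rho> s * (u \<bullet> v))"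
        by (simp add: fun_eq_iff)
      then show ?thesis
        using has_derivative_inner_left[OF c'[of s, unfolded has_vector_derivative_def], of v]
        by (metis has_field_derivative_def)
    qed
    have uu: "u \<bullet> u = 1" by (simp add: u_def)
    \<comment> \<open>A first integral: Finsler time is Euclidean displacement plus the increment of
      t h. Comparing s = 0 and s = T eliminates h.\<close>
    have "((\<lambda>s. c s \<bullet> u + t * h (c s) - s) has_real_derivative 0) (at s)" for s
      using DERIV_diff[OF DERIV_add[OF inner[of u s] h_has_derivative_along[OF c'[of s]]] DERIV_ident] \<rho>1[of s]
      by (simp add: uu)
    then have fd: "c T \<bullet> u + t * h (c T) - T = c 0 \<bullet> u + t * h (c 0) - 0"
      using DERIV_isconst_all[of "\<lambda>s. c s \<bullet> u + t * h (c s) - s"] by blast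
    have "h (c 0 + k) = h (c 0)"
      using periodic_h assms by (simp add: torus_periodic_def)
    moreover have cT: "c T = c 0 + k"
      by (simp flip: k)
    ultimately have "h (c T) = h (c 0)"
      by simp
    with fd have kT: "k \<bullet> u = T"
      by (simp add: cT inner_add_left)
    have "((\<lambda>s. c s \<bullet> ndir (snd (\<gamma> 0))) has_real_derivative 0) (at s)" for s
      using inner[of "ndir (snd (\<gamma> 0))" s] by (simp add: u_def)
    then have "c T \<bullet> ndir (snd (\<gamma> 0)) = c 0 \<bullet> ndir (snd (\<gamma> 0))"
      using DERIV_isconst_all[of "\<lambda>s. c s \<bullet> ndir (snd (\<gamma> 0))"] by blast
    then have "k \<bullet> ndir (snd (\<gamma> 0)) = 0"
      using k by (auto simp: inner_diff_left)
    then have kk: "k = T *\<^sub>R u"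
      using dir_ndir_decomp[of k "snd (\<gamma> 0)"] kT by (simp add: u_def)
    then have nT: "norm k = T" using T by (simp add: u_def)
    have "F (c s) (vector_derivative c (at s)) = 1" for s
      using \<rho>1[of s] \<rho>0[of s] by (simp add: vector_derivative_at[OF c'] F_eq u_def)
    then have "curve_length F T c = T"
      using T by (simp add: curve_length_def)
    then show ?thesis using nT T by auto
  qed
  show ?thesis
  proof (cases "k = 0")
    case True
    then show ?thesis using closed by (auto simp: geodesic_lengths_def)
  next
    case False
    then have nk: "0 < norm k" by simp
    obtain \<theta> where \<theta>: "sgn k = dir \<theta>"
      using dir_exists[of "sgn k"] False by (auto simp: norm_sgn)
    have kd: "k = norm k *\<^sub>R dir \<theta>"
      using False by (simp flip: \<theta> add: sgn_div_norm)
    let ?p = "(0, \<theta>) :: hm"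
    \<comment> \<open>A translation by k changes the Euclidean and the Finsler length by the same
      amount |k|, because h has the same value at both ends.\<close>
    have shift: "\<tau> (s + norm k) ?p = \<tau> s ?p + norm k" for s
    proof (rule \<tau>_eqI)
      have "h (\<tau> s ?p *\<^sub>R dir \<theta> + k) = h (\<tau> s ?p *\<^sub>R dir \<theta>)"
        using periodic_h assms by (simp add: torus_periodic_def)
      then have "h ((\<tau> s ?p + norm k) *\<^sub>R dir \<theta>) = h (\<tau> s ?p *\<^sub>R dir \<theta>)"
        by (simp add: scaleR_add_left kd[symmetric])
      then show "\<tau> s ?p + norm k + t * h (fst ?p + (\<tau> s ?p + norm k) *\<^sub>R dir (snd ?p))
          = s + norm k + t * h (fst ?p)"
        using \<tau>_eq[of s ?p] by simp
    qed
    have cg: "closed_geodesic F k (norm k) (\<lambda>s. fst (flow s ?p))"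
      unfolding closed_geodesic_def
    proof (intro conjI exI[of _ "\<lambda>s. flow s ?p"] allI)
      show "fst (flow (norm k) ?p) - fst (flow 0 ?p) = k"
        using shift[of 0] by (simp add: flow_def \<tau>_0 kd[symmetric])
      show "hm_eq (flow (s + norm k) ?p) (flow s ?p)" for s
        using shift[of s] lattice_uminus[OF assms]
        by (simp add: flow_def hm_eq_def scaleR_add_left kd[symmetric])
    qed (use nk flow_has_derivative in auto)
    have "norm k \<in> geodesic_lengths F k"
      unfolding geodesic_lengths_def mem_Collect_eq
      by (intro exI conjI, rule cg, rule closed[OF cg, THEN conjunct2, THEN conjunct2, symmetric])
    moreover have "l = norm k" if l: "l \<in> geodesic_lengths F k" for l
    proof -
      obtain T c where *: "closed_geodesic F k T c" "l = curve_length F T c"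
        using l unfolding geodesic_lengths_def by blast
      show ?thesis
        unfolding *(2) by (rule closed[OF *(1), THEN conjunct2, THEN conjunct2])
    qed
    ultimately have "geodesic_lengths F k = {norm k}"
      by blast
    then show ?thesis
      using False by (simp only: if_False)
  qed
qed

end

section \<open>Comparison with the flat metric\<close>

lemma randers_potential_0: "randers_potential h t \<Longrightarrow> randers_potential h 0"
  by (simp add: randers_potential_def)

text \<open>The flat metric is the member t = 0 of the family, for any \<open>h\<close>. The
  formulas of the locale therefore also compute its volume, geodesic field and lengths, and the
  comparisons reduce to equal right-hand sides.\<close>

lemma flat_finsler_eq: "flat_finsler = randers flat_metric (\<lambda>x v. 0 * frechet_derivative h (at x) v)"
  by (simp add: flat_finsler_def randers_def)

context randers_potential
begin

interpretation flat: randers_potential h 0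
  rewrites "randers flat_metric (\<lambda>x v. 0 * frechet_derivative h (at x) v) = flat_finsler"
  by (rule randers_potential_0) (unfold_locales, simp add: flat_finsler_eq[of h])

lemma same_volume: "ht_volume F = ht_volume flat_finsler"
  by (simp add: ht_volume_def ht_density_eq flat.ht_density_eq)

lemma same_flow: "same_geodesic_flow_up_to_trivial_time_change flat_finsler F"
proof -
  have "geodesic_flow flat_finsler flat_flow"
    unfolding geodesic_flow_def is_flow_of_def
  proof (intro allI conjI)
    fix p s
    have "((\<lambda>s. flat_flow s p) has_vector_derivative (dir (snd p), 0)) (at s)"
      by (auto intro!: derivative_eq_intros simp: has_vector_derivative_def)
    then show "((\<lambda>r. flat_flow r p) has_vector_derivative geodesic_field flat_finsler (flat_flow s p)) (at s)"
      by (simp add: flat.geodesic_field_eq flat.speed_def flat.w_def)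
  qed simp
  then show ?thesis
    unfolding same_geodesic_flow_up_to_trivial_time_change_def trivial_time_change_def
    using geodesic_flow_flow time_change_flow smoothly_conjugate_flow by blast
qed

lemma same_spectrum: "same_marked_length_spectrum F flat_finsler"
  unfolding same_marked_length_spectrum_def
  by (intro exI[of _ id]) (simp add: geodesic_lengths_eq flat.geodesic_lengths_eq)

end

section \<open>Smoothed distance to a lattice translate\<close>

text \<open>The middle of \<open>cell\<close>, so that the cell becomes the square of points whose
  coordinates differ from it by at most 1/2 and every point of it is joined to \<open>center\<close>
  by a segment inside.\<close>

definition center :: "real^2" where
  "center = vector [1/2, 1/2]"

lemma center_nth [simp]: "center $ i = 1/2"
  using forall_2[of "\<lambda>i. center $ i = 1/2"] by (simp add: center_def)

text \<open>A smoothing of the 1-periodic up to sign triangle wave \<open>\<plusminus>(y - 1/2)\<close> by a function with slopes in \<open>[-1, 1]\<close>.\<close>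

definition wave :: "real \<Rightarrow> real \<Rightarrow> real" where
  "wave e y = arcsin ((1 - e) * cos (pi * y)) / pi"

definition wave' :: "real \<Rightarrow> real \<Rightarrow> real" where
  "wave' e y = - (1 - e) * sin (pi * y) / sqrt (1 - ((1 - e) * cos (pi * y))\<^sup>2)"

text \<open>For e = 0 this is the distance to the lattice translates of \<open>center\<close>, since
  the absolute value of arcsin (cos (pi y)) / pi is the distance from y to 1/2 + Z. The factor 1 - e
  in \<open>wave\<close> rounds the kinks at the integers, that is on the cell boundary; the summand
  \<open>e\<^sup>2\<close> rounds the tip at \<open>center\<close>.\<close>

definition potential :: "real \<Rightarrow> real^2 \<Rightarrow> real" where
  "potential e x = sqrt (e\<^sup>2 + (wave e (x $ 1))\<^sup>2 + (wave e (x $ 2))\<^sup>2)"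

context
  fixes e :: real
  assumes e: "0 < e" "e < 1"
begin

lemma wave_arg: "\<bar>(1 - e) * cos y\<bar> < 1"
proof -
  have "\<bar>(1 - e) * cos y\<bar> \<le> (1 - e) * 1"
    unfolding abs_mult using e by (intro mult_mono) auto
  also have "\<dots> < 1" using e by simp
  finally show ?thesis .
qed

lemma wave_arg_sq: "((1 - e) * cos y)\<^sup>2 < 1"
  using wave_arg abs_square_less_1 by blast

lemma wave_has_derivative: "(wave e has_real_derivative wave' e y) (at y)"
proof -
  have "-1 < (1 - e) * cos (pi * y)" "(1 - e) * cos (pi * y) < 1"
    using wave_arg[of "pi * y"] by linarith+
  from DERIV_arcsin[OF this]
  have "((\<lambda>y. arcsin ((1 - e) * cos (pi * y))) has_real_derivative
      inverse (sqrt (1 - ((1 - e) * cos (pi * y))\<^sup>2)) * ((1 - e) * (- sin (pi * y) * pi))) (at y)"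
    by (rule DERIV_chain2[where g = "\<lambda>y. (1 - e) * cos (pi * y)"]) (auto intro!: derivative_eq_intros)
  moreover have eq: "s * ((1 - e) * (- c * pi)) / pi = - (1 - e) * c * s" for s c
    by (simp add: field_simps)
  ultimately show ?thesis
    unfolding wave_def[abs_def] wave'_def divide_inverse[of _ "sqrt _"] eq[symmetric]
    by (intro DERIV_cdivide)
qed

lemma smooth_wave: "smooth f \<Longrightarrow> smooth (\<lambda>x. wave e (f x))"
  unfolding wave_def divide_inverse
  by (intro smooth_intros smooth_arcsin wave_arg)

lemma smooth_wave': "smooth f \<Longrightarrow> smooth (\<lambda>x. wave' e (f x))"
proof -
  assume f: "smooth f"
  have pos: "0 < 1 - ((1 - e) * cos (pi * f x))\<^sup>2" for x
    using wave_arg_sq[of "pi * f x"] by simp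
  have "smooth (\<lambda>x. inverse (sqrt (1 - ((1 - e) * cos (pi * f x))\<^sup>2)))"
  proof (rule smooth_inverse)
    show "smooth (\<lambda>x. sqrt (1 - ((1 - e) * cos (pi * f x))\<^sup>2))"
      by (rule smooth_sqrt[OF _ pos]) (intro smooth_intros f)
    show "sqrt (1 - ((1 - e) * cos (pi * f x))\<^sup>2) \<noteq> 0" for x
      using pos[of x] by simp
  qed
  then show ?thesis
    unfolding wave'_def divide_inverse by (intro smooth_intros f)
qed

lemma potential_pos: "0 < e\<^sup>2 + (wave e a)\<^sup>2 + (wave e b)\<^sup>2"
  using e by (simp add: add_pos_nonneg)

lemma smooth_potential: "smooth (potential e)"
  unfolding potential_def by (intro smooth_sqrt potential_pos smooth_intros smooth_wave)

text \<open>Only the square is 1-periodic: an odd shift changes the sign of the cosine, hence of the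
  odd function arcsin.\<close>

lemma wave_add_Ints:
  assumes "k \<in> \<int>"
  shows "(wave e (y + k))\<^sup>2 = (wave e y)\<^sup>2"
proof -
  obtain n where n: "k = of_int n" using assms by (auto elim: Ints_cases)
  have "cos (pi * (y + k)) = cos (pi * y) * cos (pi * of_int n)"
    by (simp add: n distrib_left cos_add sin_zero_iff_int2 mult.commute[of pi "of_int n"])
  moreover have "sin (pi * of_int n) = 0"
    by (simp add: sin_zero_iff_int2 mult.commute[of pi "of_int n"])
  then have "(cos (pi * of_int n))\<^sup>2 = 1"
    by (simp add: cos_squared_eq)
  then have "cos (pi * of_int n) = 1 \<or> cos (pi * of_int n) = -1"
    by (simp add: power2_eq_1_iff)
  ultimately have "cos (pi * (y + k)) = cos (pi * y) \<or> cos (pi * (y + k)) = - cos (pi * y)"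
    by auto
  moreover have "arcsin (- ((1 - e) * cos (pi * y))) = - arcsin ((1 - e) * cos (pi * y))"
    using wave_arg[of "pi * y"] by (intro arcsin_minus) linarith+
  ultimately have "wave e (y + k) = wave e y \<or> wave e (y + k) = - wave e y"
    by (auto simp: wave_def)
  then show ?thesis by auto
qed

lemma periodic_potential: "torus_periodic (potential e)"
  by (auto simp: torus_periodic_def potential_def lattice_def wave_add_Ints)

lemma abs_wave'_le: "\<bar>wave' e y\<bar> \<le> 1"
proof -
  let ?c = "cos (pi * y)" and ?s = "sin (pi * y)"
  have "(1 - e)\<^sup>2 \<le> 1" using e by (simp add: power_le_one)
  moreover have "((1 - e) * ?s)\<^sup>2 + ((1 - e) * ?c)\<^sup>2 = (1 - e)\<^sup>2"
    by (simp add: power_mult_distrib flip: distrib_left)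
  ultimately have "((1 - e) * ?s)\<^sup>2 \<le> 1 - ((1 - e) * ?c)\<^sup>2"
    by linarith
  then have "\<bar>(1 - e) * ?s\<bar> \<le> sqrt (1 - ((1 - e) * ?c)\<^sup>2)"
    using real_le_rsqrt by (metis abs_ge_zero power2_abs)
  moreover have "0 < sqrt (1 - ((1 - e) * ?c)\<^sup>2)"
    using wave_arg_sq[of "pi * y"] by simp
  ultimately show ?thesis
    by (simp add: wave'_def abs_mult abs_minus_commute)
qed

text \<open>Half the derivative of the square of \<open>wave\<close>; divided by the potential it is
  a component of the gradient.\<close>

definition wave_prod :: "real \<Rightarrow> real" where
  "wave_prod y = wave e y * wave' e y"

lemma smooth_wave_prod: "smooth f \<Longrightarrow> smooth (\<lambda>x. wave_prod (f x))"
  unfolding wave_prod_def by (intro smooth_intros smooth_wave smooth_wave')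

lemma potential_has_derivative:
  "(potential e has_derivative (\<lambda>v. (wave_prod (x $ 1) * v $ 1 + wave_prod (x $ 2) * v $ 2) / potential e x)) (at x)"
proof -
  have sq: "((\<lambda>x. (wave e (x $ i))\<^sup>2) has_derivative (\<lambda>v. 2 * wave_prod (x $ i) * v $ i)) (at x)" for i :: 2
  proof -
    have "((\<lambda>y. (wave e y)\<^sup>2) has_real_derivative 2 * wave_prod (x $ i)) (at (x $ i))"
      by (auto intro!: derivative_eq_intros wave_has_derivative simp: wave_prod_def)
    then have "((\<lambda>y. (wave e y)\<^sup>2) has_derivative (*) (2 * wave_prod (x $ i))) (at (x $ i))"
      by (simp add: has_field_derivative_def)
    from has_derivative_compose[OF bounded_linear.has_derivative[OF bounded_linear_vec_nth has_derivative_ident] this]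
    show ?thesis by simp
  qed
  have "((\<lambda>x. e\<^sup>2 + (wave e (x $ 1))\<^sup>2 + (wave e (x $ 2))\<^sup>2) has_derivative
      (\<lambda>v. 2 * (wave_prod (x $ 1) * v $ 1 + wave_prod (x $ 2) * v $ 2))) (at x)"
    by (rule has_derivative_eq_rhs[OF has_derivative_add[OF has_derivative_add[OF has_derivative_const sq[of 1]] sq[of 2]]])
      (simp add: fun_eq_iff)
  from has_derivative_real_sqrt[OF potential_pos this]
  show ?thesis
    unfolding potential_def[abs_def]
  proof (rule has_derivative_eq_rhs, intro ext)
    have eq: "2 * a * (inverse b / 2) = a / b" for a b :: real
      by (simp add: field_simps)
    fix v
    show "2 * (wave_prod (x $ 1) * v $ 1 + wave_prod (x $ 2) * v $ 2) *
        (inverse (sqrt (e\<^sup>2 + (wave e (x $ 1))\<^sup>2 + (wave e (x $ 2))\<^sup>2)) / 2) =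
        (wave_prod (x $ 1) * v $ 1 + wave_prod (x $ 2) * v $ 2) / sqrt (e\<^sup>2 + (wave e (x $ 1))\<^sup>2 + (wave e (x $ 2))\<^sup>2)"
      by (rule eq)
  qed
qed

lemma grad_potential: "grad (potential e) x = (1 / potential e x) *\<^sub>R vector [wave_prod (x $ 1), wave_prod (x $ 2)]"
  unfolding grad_def frechet_derivative_at[OF potential_has_derivative, symmetric]
  by (simp add: vec_eq_iff forall_2 axis_def)

lemma potential_gt_0: "0 < potential e x"
  unfolding potential_def using potential_pos by simp

text \<open>Slopes of \<open>wave\<close> are at most 1, so the numerators are dominated by the
  values of \<open>wave\<close>, whose squares together with \<open>e\<^sup>2\<close> make up the
  square of the potential.\<close>

lemma norm_grad_potential: "norm (grad (potential e) x) \<le> 1"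
proof -
  have P: "(wave_prod y)\<^sup>2 \<le> (wave e y)\<^sup>2" for y
  proof -
    have "(wave' e y)\<^sup>2 \<le> 1"
      using abs_wave'_le[of y] by (simp add: abs_square_le_1)
    then show ?thesis
      using mult_left_mono[of "(wave' e y)\<^sup>2" 1 "(wave e y)\<^sup>2"] by (simp add: wave_prod_def power_mult_distrib)
  qed
  have "(potential e x)\<^sup>2 = e\<^sup>2 + (wave e (x $ 1))\<^sup>2 + (wave e (x $ 2))\<^sup>2"
    using potential_pos[of "x $ 1" "x $ 2"] by (simp add: potential_def)
  then have "(wave_prod (x $ 1))\<^sup>2 + (wave_prod (x $ 2))\<^sup>2 \<le> (potential e x)\<^sup>2"
    using P[of "x $ 1"] P[of "x $ 2"] zero_le_power2[of e] by linarith
  then have "sqrt ((wave_prod (x $ 1))\<^sup>2 + (wave_prod (x $ 2))\<^sup>2) \<le> potential e x"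
    using real_sqrt_le_mono potential_gt_0[of x] by fastforce
  then show ?thesis
    using potential_gt_0[of x]
    by (simp add: grad_potential norm_eq_sqrt_inner[of "vector _"] inner_2 power2_eq_square)
qed

text \<open>Each numerator depends on a single coordinate. The second derivative is therefore a
  diagonal matrix minus a multiple of the rank one matrix formed from the vector of
  numerators.\<close>

lemma second_derivative_potential_sym:
  "frechet_derivative (grad (potential e)) (at x) v \<bullet> w = frechet_derivative (grad (potential e)) (at x) w \<bullet> v"
proof -
  let ?D = "\<lambda>i. frechet_derivative wave_prod (at (x $ i)) 1" and ?h = "potential e x"
  have DP: "((\<lambda>x. wave_prod (x $ i)) has_derivative (\<lambda>v. v $ i * ?D i)) (at x)" for i :: 2
  proof -
    have "smooth wave_prod" using smooth_wave_prod[OF smooth_ident] by simp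
    then have D: "(wave_prod has_derivative frechet_derivative wave_prod (at (x $ i))) (at (x $ i))"
      by (rule smooth_has_derivative)
    have "frechet_derivative wave_prod (at (x $ i)) s = s * ?D i" for s
      using linear_cmul[OF has_derivative_linear[OF D], of s 1] by simp
    then have "(wave_prod has_derivative (\<lambda>s. s * ?D i)) (at (x $ i))"
      by (intro has_derivative_eq_rhs[OF D] ext)
    from has_derivative_compose[OF bounded_linear.has_derivative[OF bounded_linear_vec_nth has_derivative_ident] this]
    show ?thesis .
  qed
  let ?G = "\<lambda>v. (wave_prod (x $ 1) * v $ 1 + wave_prod (x $ 2) * v $ 2) / ?h"
  have inv: "((\<lambda>x. inverse (potential e x)) has_derivative (\<lambda>v. - (inverse ?h * ?G v * inverse ?h))) (at x)"
    by (rule Deriv.has_derivative_inverse[OF _ potential_has_derivative]) (use potential_gt_0[of x] in simp)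
  have d: "((\<lambda>x. inverse (potential e x) *\<^sub>R (wave_prod (x $ 1) *\<^sub>R axis 1 1 + wave_prod (x $ 2) *\<^sub>R axis 2 1)) has_derivative
     (\<lambda>v. inverse ?h *\<^sub>R ((v $ 1 * ?D 1) *\<^sub>R axis 1 1 + (v $ 2 * ?D 2) *\<^sub>R axis 2 1) +
       (- (inverse ?h * ?G v * inverse ?h)) *\<^sub>R (wave_prod (x $ 1) *\<^sub>R axis 1 1 + wave_prod (x $ 2) *\<^sub>R (axis 2 1 :: real^2)))) (at x)"
    by (intro has_derivative_scaleR inv has_derivative_add has_derivative_scaleR_left DP)
  have g: "grad (potential e) = (\<lambda>x. inverse (potential e x) *\<^sub>R (wave_prod (x $ 1) *\<^sub>R axis 1 1 + wave_prod (x $ 2) *\<^sub>R axis 2 1))"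
    by (simp add: fun_eq_iff grad_potential vector_2_eq inverse_eq_divide)
  have D: "frechet_derivative (grad (potential e)) (at x) =
     (\<lambda>v. inverse ?h *\<^sub>R ((v $ 1 * ?D 1) *\<^sub>R axis 1 1 + (v $ 2 * ?D 2) *\<^sub>R axis 2 1) +
       (- (inverse ?h * ?G v * inverse ?h)) *\<^sub>R (wave_prod (x $ 1) *\<^sub>R axis 1 1 + wave_prod (x $ 2) *\<^sub>R (axis 2 1 :: real^2)))"
    unfolding g by (rule frechet_derivative_at[OF d, symmetric])
  show ?thesis
    unfolding D by (simp add: inner_2 axis_def) (simp add: divide_inverse algebra_simps)
qed

lemma randers_potential_potential: "0 \<le> t \<Longrightarrow> t < 1 \<Longrightarrow> randers_potential (potential e) t"
  by unfold_locales
    (auto simp: smooth_potential periodic_potential norm_grad_potential second_derivative_potential_sym)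

text \<open>One minus the squared slope is e (2 - e) over a denominator that is at least the square
  of cos (pi z). Staying \<open>r\<close> away from the kinks keeps this denominator above the
  square of sin (pi r).\<close>

lemma wave'_lower:
  assumes "\<bar>z\<bar> \<le> 1/2 - r" "0 < r"
  shows "1 - 2 * e / (sin (pi * r))\<^sup>2 \<le> - wave' e (1/2 + z)" "- wave' e (1/2 + z) \<le> 1"
proof -
  let ?c = "cos (pi * z)" and ?s = "sin (pi * z)"
  have arg: "cos (pi * (1/2 + z)) = - ?s" "sin (pi * (1/2 + z)) = ?c"
    by (simp_all add: distrib_left cos_add sin_add)
  have W: "- wave' e (1/2 + z) = (1 - e) * ?c / sqrt (1 - ((1 - e) * ?s)\<^sup>2)"
    by (simp only: wave'_def arg mult_minus_right power2_minus mult_minus_left minus_divide_left minus_minus)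
  have "pi * \<bar>z\<bar> \<le> pi * (1/2 - r)" using assms(1) by (intro mult_left_mono) auto
  then have zr: "pi * \<bar>z\<bar> \<le> pi / 2 - pi * r" by (simp add: algebra_simps)
  have "cos (pi / 2 - pi * r) \<le> cos (pi * \<bar>z\<bar>)"
    using zr assms by (intro cos_monotone_0_pi_le) (auto simp: field_simps)
  then have cs: "sin (pi * r) \<le> ?c"
    by (simp add: cos_diff abs_if split: if_splits)
  have r: "r \<le> 1/2" using assms(1) by linarith
  have sr: "0 < sin (pi * r)"
    using assms r by (intro sin_gt_zero) (auto simp: field_simps)
  have c: "0 < ?c" using cs sr by linarith
  have pos: "0 < 1 - ((1 - e) * ?s)\<^sup>2"
    using wave_arg_sq[of "pi * (1/2 + z)"] unfolding arg by simp
  show "- wave' e (1/2 + z) \<le> 1"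
    using abs_wave'_le[of "1/2 + z"] by linarith
  have nn: "0 \<le> - wave' e (1/2 + z)"
    unfolding W using c e pos by simp
  have sq: "(- wave' e (1/2 + z))\<^sup>2 = ((1 - e) * ?c)\<^sup>2 / (1 - ((1 - e) * ?s)\<^sup>2)"
    unfolding W using pos by (simp add: power_divide)
  have num: "1 - ((1 - e) * ?s)\<^sup>2 - ((1 - e) * ?c)\<^sup>2 = e * (2 - e)"
  proof -
    have "((1 - e) * ?s)\<^sup>2 + ((1 - e) * ?c)\<^sup>2 = (1 - e)\<^sup>2"
      by (simp add: power_mult_distrib flip: distrib_left)
    then show ?thesis by (simp add: power2_eq_square algebra_simps)
  qed
  have den: "(sin (pi * r))\<^sup>2 \<le> 1 - ((1 - e) * ?s)\<^sup>2"
  proof -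
    have "((1 - e) * ?s)\<^sup>2 \<le> ?s\<^sup>2"
      using e by (simp add: power_mult_distrib mult_left_le_one_le power_le_one)
    moreover have "(sin (pi * r))\<^sup>2 \<le> ?c\<^sup>2" using cs sr by (intro power_mono) auto
    ultimately show ?thesis using sin_cos_squared_add[of "pi * z"] by linarith
  qed
  have "1 - (- wave' e (1/2 + z))\<^sup>2 = e * (2 - e) / (1 - ((1 - e) * ?s)\<^sup>2)"
    unfolding sq num[symmetric] using pos by (simp add: diff_divide_distrib)
  also have "\<dots> \<le> (2 * e) / (sin (pi * r))\<^sup>2"
    using e den sr by (intro frac_le) (auto simp: power2_eq_square)
  finally have "1 - 2 * e / (sin (pi * r))\<^sup>2 \<le> (- wave' e (1/2 + z))\<^sup>2" by linarith
  \<comment> \<open>The slope lies in [0, 1], so its square is a lower bound for it.\<close>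
  also have "\<dots> \<le> - wave' e (1/2 + z)"
    using mult_left_mono[of "- wave' e (1/2 + z)" 1 "- wave' e (1/2 + z)"] nn abs_wave'_le[of "1/2 + z"]
    by (simp add: power2_eq_square)
  finally show "1 - 2 * e / (sin (pi * r))\<^sup>2 \<le> - wave' e (1/2 + z)" .
qed

lemma wave_center: "wave e (1/2) = 0"
  by (simp add: wave_def)

lemma wave_lower:
  assumes z: "\<bar>z\<bar> \<le> 1/2 - r" "0 < r"
  obtains k where "- wave e (1/2 + z) = k * z" "1 - 2 * e / (sin (pi * r))\<^sup>2 \<le> k" "k \<le> 1"
proof -
  have D: "((\<lambda>z. - wave e (1/2 + z)) has_real_derivative - wave' e (1/2 + z)) (at z)" for z
    by (auto intro!: derivative_eq_intros DERIV_chain'[OF _ wave_has_derivative])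
  have "\<exists>\<xi>. \<bar>\<xi>\<bar> \<le> \<bar>z\<bar> \<and> - wave e (1/2 + z) = - wave' e (1/2 + \<xi>) * z"
  proof (cases "z = 0")
    case True
    then show ?thesis using wave_center by auto
  next
    case False
    then consider "0 < z" | "z < 0" by linarith
    then show ?thesis
    proof cases
      case 1
      from MVT2[OF this D] obtain \<xi> where "0 < \<xi>" "\<xi> < z"
        "- wave e (1/2 + z) - - wave e (1/2 + 0) = (z - 0) * - wave' e (1/2 + \<xi>)" by blast
      then show ?thesis
        using wave_center by (intro exI[of _ \<xi>]) (simp add: mult.commute)
    next
      case 2
      from MVT2[OF this D] obtain \<xi> where "z < \<xi>" "\<xi> < 0"
        "- wave e (1/2 + 0) - - wave e (1/2 + z) = (0 - z) * - wave' e (1/2 + \<xi>)" by blast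
      then show ?thesis
        using wave_center by (intro exI[of _ \<xi>]) (simp add: mult.commute)
    qed
  qed
  then obtain \<xi> where \<xi>: "\<bar>\<xi>\<bar> \<le> \<bar>z\<bar>" "- wave e (1/2 + z) = - wave' e (1/2 + \<xi>) * z" by blast
  then have "\<bar>\<xi>\<bar> \<le> 1/2 - r" using z by linarith
  from wave'_lower[OF this z(2)] \<xi>(2) show thesis by (intro that) auto
qed

text \<open>How far the gradient is from the unit radial field. The numerator loses a factor 1 -
  \<omega> through the value of \<open>wave\<close> and another through its slope, giving 2 \<omega>
  = 4 e / sin^2; the rounded tip enlarges the denominator to at most e + |z|, which costs e / r
  because |z| is at least r.\<close>

lemma grad_potential_radial:
  assumes r: "0 < r" and er: "e * (4 / (sin (pi * r))\<^sup>2 + 1 / r) \<le> 1"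
    and z: "\<And>i. \<bar>z $ i\<bar> \<le> 1/2 - r" "r \<le> norm z"
  shows "(1 - e * (4 / (sin (pi * r))\<^sup>2 + 1 / r)) * norm z \<le> grad (potential e) (center + z) \<bullet> z"
proof -
  define \<omega> where "\<omega> = 2 * e / (sin (pi * r))\<^sup>2"
  have \<omega>: "0 \<le> \<omega>" using e by (simp add: \<omega>_def)
  have er': "2 * \<omega> + e / r \<le> 1" using er by (simp add: \<omega>_def algebra_simps)
  have \<omega>1: "\<omega> \<le> 1" using er' \<omega> e r by (smt (verit) divide_nonneg_pos)
  have P: "(1 - \<omega>)\<^sup>2 * (z $ i)\<^sup>2 \<le> wave_prod (1/2 + z $ i) * z $ i" and W: "(wave e (1/2 + z $ i))\<^sup>2 \<le> (z $ i)\<^sup>2" for i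
  proof -
    obtain k where k: "- wave e (1/2 + z $ i) = k * z $ i" "1 - \<omega> \<le> k" "k \<le> 1"
      using wave_lower[OF z(1) r] unfolding \<omega>_def by metis
    have w: "1 - \<omega> \<le> - wave' e (1/2 + z $ i)"
      using wave'_lower(1)[OF z(1) r] by (simp add: \<omega>_def)
    have "(1 - \<omega>) * (1 - \<omega>) \<le> k * (- wave' e (1/2 + z $ i))"
      using k w \<omega>1 by (intro mult_mono) auto
    then have "(1 - \<omega>)\<^sup>2 * (z $ i)\<^sup>2 \<le> k * (- wave' e (1/2 + z $ i)) * (z $ i)\<^sup>2"
      unfolding power2_eq_square[of "1 - \<omega>"] by (intro mult_right_mono) auto
    also have "\<dots> = (- wave e (1/2 + z $ i)) * (- wave' e (1/2 + z $ i)) * z $ i"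
      unfolding k by (simp add: power2_eq_square mult_ac)
    finally show "(1 - \<omega>)\<^sup>2 * (z $ i)\<^sup>2 \<le> wave_prod (1/2 + z $ i) * z $ i"
      by (simp add: wave_prod_def)
    have "(wave e (1/2 + z $ i))\<^sup>2 = k\<^sup>2 * (z $ i)\<^sup>2"
      using k(1) by (metis power2_minus power_mult_distrib)
    also have "\<dots> \<le> 1 * (z $ i)\<^sup>2"
      using k \<omega>1 by (intro mult_right_mono) (auto simp: power_le_one)
    finally show "(wave e (1/2 + z $ i))\<^sup>2 \<le> (z $ i)\<^sup>2" by simp
  qed
  let ?h = "potential e (center + z)"
  have nz: "(norm z)\<^sup>2 = (z $ 1)\<^sup>2 + (z $ 2)\<^sup>2"
    unfolding power2_norm_eq_inner inner_2 by (simp add: power2_eq_square)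
  have pz: "0 < norm z" using z(2) r by linarith
  have "?h \<le> sqrt (e\<^sup>2 + (norm z)\<^sup>2)"
    unfolding potential_def nz using W[of 1] W[of 2] by simp
  also have "\<dots> \<le> e + norm z"
    using e by (intro real_le_lsqrt) (auto simp: power2_sum)
  finally have h: "?h \<le> e + norm z" .
  have "(1 - e / r) * (e + norm z) \<le> norm z"
  proof -
    have "e \<le> e / r * norm z" using z(2) r e by (simp add: field_simps)
    moreover have "0 \<le> e / r * e" using e r by simp
    ultimately show ?thesis by (simp add: algebra_simps)
  qed
  moreover have er1: "0 \<le> 1 - e / r" using er' \<omega> by linarith
  moreover from this have "(1 - e / r) * ?h \<le> (1 - e / r) * (e + norm z)"
    by (rule mult_left_mono[OF h])
  ultimately have hz: "(1 - e / r) * ?h \<le> norm z" by linarith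
  have "(1 - e * (4 / (sin (pi * r))\<^sup>2 + 1 / r)) = 1 - 2 * \<omega> - e / r"
    by (simp add: \<omega>_def algebra_simps)
  also have "\<dots> \<le> (1 - \<omega>)\<^sup>2 * (1 - e / r)"
  proof -
    have "0 \<le> \<omega>\<^sup>2 * (1 - e / r)" "0 \<le> 2 * \<omega> * (e / r)" using er1 \<omega> e r by auto
    then show ?thesis by (simp add: power2_eq_square algebra_simps)
  qed
  finally have "(1 - e * (4 / (sin (pi * r))\<^sup>2 + 1 / r)) * norm z * ?h \<le> (1 - \<omega>)\<^sup>2 * (1 - e / r) * norm z * ?h"
    using pz potential_gt_0[of "center + z"] by (intro mult_right_mono) auto
  also have "\<dots> = (1 - \<omega>)\<^sup>2 * norm z * ((1 - e / r) * ?h)"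
    by simp
  also have "\<dots> \<le> (1 - \<omega>)\<^sup>2 * norm z * norm z"
    using hz by (intro mult_left_mono) auto
  also have "\<dots> = (1 - \<omega>)\<^sup>2 * (z $ 1)\<^sup>2 + (1 - \<omega>)\<^sup>2 * (z $ 2)\<^sup>2"
    using nz by (metis distrib_left mult.assoc power2_eq_square)
  also have "\<dots> \<le> wave_prod (1/2 + z $ 1) * z $ 1 + wave_prod (1/2 + z $ 2) * z $ 2"
    using P[of 1] P[of 2] by linarith
  also have "\<dots> = grad (potential e) (center + z) \<bullet> z * ?h"
    using potential_gt_0[of "center + z"] by (simp add: grad_potential inner_2 flip: add_divide_distrib)
  finally show ?thesis
    using potential_gt_0[of "center + z"] by (simp add: mult_le_cancel_right)
qed

end

section \<open>The limit of the gradients at almost every point\<close>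

lemma negligible_rational_lines:
  "negligible {x :: real^2. \<exists>p q r :: int. (p, q) \<noteq> (0, 0) \<and> of_int p * x $ 1 + of_int q * x $ 2 = of_int r / 2}"
proof -
  let ?A = "{s :: int \<times> int \<times> int. (fst s, fst (snd s)) \<noteq> (0, 0)}"
  let ?L = "\<lambda>s :: int \<times> int \<times> int. {x :: real^2. vector [of_int (fst s), of_int (fst (snd s))] \<bullet> x = of_int (snd (snd s)) / 2}"
  have sub: "{x :: real^2. \<exists>p q r :: int. (p, q) \<noteq> (0, 0) \<and> of_int p * x $ 1 + of_int q * x $ 2 = of_int r / 2}
    \<subseteq> (\<Union>s \<in> ?A. ?L s)"
  proof
    fix x :: "real^2"
    assume "x \<in> {x. \<exists>p q r :: int. (p, q) \<noteq> (0, 0) \<and> of_int p * x $ 1 + of_int q * x $ 2 = of_int r / 2}"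
    then obtain p q r :: int where "(p, q) \<noteq> (0, 0)" "of_int p * x $ 1 + of_int q * x $ 2 = of_int r / 2"
      by blast
    then show "x \<in> (\<Union>s \<in> ?A. ?L s)"
      by (intro UN_I[of "(p, q, r)"]) (simp_all add: inner_2)
  qed
  have "negligible {x :: real^2. vector [of_int p, of_int q] \<bullet> x = of_int r / 2}"
    if "(p, q) \<noteq> (0, 0)" for p q r :: int
  proof (rule negligible_hyperplane)
    have "vector [of_int p, of_int q] \<noteq> (0 :: real^2)"
      using that by (auto simp: vec_eq_iff forall_2)
    then show "vector [of_int p, of_int q] \<noteq> (0 :: real^2) \<or> of_int r / 2 \<noteq> (0::real)" by blast
  qed
  then have "negligible (\<Union>s \<in> ?A. ?L s)"
    by (intro negligible_countable_Union countable_image) auto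
  then show ?thesis
    using sub by (rule negligible_subset)
qed

text \<open>Right-hand sides in multiples of 1/2 occur because the rays start at lattice translates
  of (1/2, 1/2). The cases (p, q) = (1, 0) and (0, 1) remove the cell boundaries and the lines
  through the centres parallel to the axes; the remaining ones remove rational slopes.\<close>

lemma grad_potential_tendsto:
  fixes x :: "real^2"
  assumes "\<nexists>p q r :: int. (p, q) \<noteq> (0, 0) \<and> of_int p * x $ 1 + of_int q * x $ 2 = of_int r / 2"
  shows "\<exists>u :: real^2. norm u = 1 \<and> u $ 1 \<noteq> 0 \<and> u $ 2 / u $ 1 \<notin> \<rat> \<and>
       ((\<lambda>e. grad (potential e) x) \<longlongrightarrow> u) (at_right 0)"
proof -
  define k :: "real^2" where "k = (\<chi> i. of_int \<lfloor>x $ i\<rfloor>)"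
  define z where "z = x - k - center"
  have k: "k \<in> lattice" by (simp add: lattice_def k_def)
  have x: "x = center + z + k" by (simp add: z_def)
  have nh: "x $ i \<noteq> of_int r / 2" for i and r :: int
  proof -
    have "x $ 1 \<noteq> of_int r / 2 \<and> x $ 2 \<noteq> of_int r / 2"
      using assms by (metis Pair_inject add.left_neutral add.right_neutral mult_cancel_right1 mult_zero_left
          of_int_0 of_int_1 zero_neq_one)
    then show ?thesis using forall_2[of "\<lambda>i. x $ i \<noteq> of_int r / 2"] by blast
  qed
  have z0: "z $ i \<noteq> 0" for i
    using nh[of i "2 * \<lfloor>x $ i\<rfloor> + 1"] by (auto simp: z_def k_def field_simps)
  have zb: "\<bar>z $ i\<bar> < 1/2" for i
  proof -
    have "z $ i = x $ i - of_int \<lfloor>x $ i\<rfloor> - 1/2" by (simp add: z_def k_def)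
    moreover have "x $ i \<noteq> of_int \<lfloor>x $ i\<rfloor>" using nh[of i "2 * \<lfloor>x $ i\<rfloor>"] by simp
    ultimately show ?thesis
      using floor_correct[of "x $ i"] unfolding abs_less_iff by linarith
  qed
  define u where "u = sgn z"
  have zne: "z \<noteq> 0" using z0[of 1] by auto
  have nu: "norm u = 1" by (simp add: u_def norm_sgn zne)
  have uz: "u $ i = z $ i / norm z" for i by (simp add: u_def sgn_div_norm divide_inverse_commute)
  have slope: "u $ 2 / u $ 1 \<notin> \<rat>"
  proof
    assume "u $ 2 / u $ 1 \<in> \<rat>"
    then have "z $ 2 / z $ 1 \<in> \<rat>" using zne by (simp add: uz)
    then obtain p q :: int where q: "q \<noteq> 0" "z $ 2 / z $ 1 = of_int p / of_int q"
      by (metis Rats_cases' less_irrefl)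
    then have "of_int q * z $ 2 = of_int p * z $ 1"
      using z0[of 1] by (simp add: field_simps)
    then have "of_int (- p) * x $ 1 + of_int q * x $ 2
        = of_int (q * (2 * \<lfloor>x $ 2\<rfloor> + 1) - p * (2 * \<lfloor>x $ 1\<rfloor> + 1)) / 2"
      by (simp add: z_def k_def field_simps)
    then show False using assms q(1) by blast
  qed
  \<comment> \<open>The margin of this particular point: with it
    \<open>grad_potential_radial\<close> applies for all small e.\<close>
  define r where "r = Min {1/2 - \<bar>z $ 1\<bar>, 1/2 - \<bar>z $ 2\<bar>, norm z}"
  have r: "0 < r" "r \<le> norm z" "\<bar>z $ 1\<bar> \<le> 1/2 - r" "\<bar>z $ 2\<bar> \<le> 1/2 - r"
    using zb[of 1] zb[of 2] zne by (auto simp: r_def)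
  have ri: "\<bar>z $ i\<bar> \<le> 1/2 - r" for i
    using r(3,4) forall_2[of "\<lambda>i. \<bar>z $ i\<bar> \<le> 1/2 - r"] by blast
  define c where "c = 4 / (sin (pi * r))\<^sup>2 + 1 / r"
  have c: "0 < c" using r(1) by (simp add: c_def add_nonneg_pos)
  have "\<forall>\<^sub>F e in at_right 0. norm (grad (potential e) x - u) \<le> sqrt (2 * (e * c))"
  proof (rule eventually_at_rightI[of 0 "min 1 (1 / c)"])
    fix e assume "e \<in> {0<..<min 1 (1 / c)}"
    then have e: "0 < e" "e < 1" "e * c \<le> 1" using c by (auto simp: field_simps)
    have g: "grad (potential e) x = grad (potential e) (center + z)"
      unfolding x by (rule grad_periodic[OF smooth_potential[OF e(1,2)] periodic_potential[OF e(1,2)] k])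
    have "(1 - e * c) * norm z \<le> grad (potential e) (center + z) \<bullet> z"
      unfolding c_def by (rule grad_potential_radial[OF e(1,2) r(1) _ ri r(2)]) (use e(3) in \<open>simp add: c_def\<close>)
    moreover have "grad (potential e) (center + z) \<bullet> z = norm z * (grad (potential e) x \<bullet> u)"
      using zne by (simp add: u_def sgn_div_norm g)
    ultimately have gu: "1 - e * c \<le> grad (potential e) x \<bullet> u"
      using zne by (simp add: mult.commute)
    \<comment> \<open>Both vectors have norm at most 1, so a scalar product close to 1 forces them
      together.\<close>
    have "(norm (grad (potential e) x - u))\<^sup>2 = (norm (grad (potential e) x))\<^sup>2 + (norm u)\<^sup>2 - 2 * (grad (potential e) x \<bullet> u)"
      by (simp add: power2_norm_eq_inner inner_diff_left inner_diff_right inner_commute)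
    also have "\<dots> \<le> 2 * (e * c)"
      using gu nu power_le_one[OF norm_ge_zero norm_grad_potential[OF e(1,2)], of x 2] by simp
    finally show "norm (grad (potential e) x - u) \<le> sqrt (2 * (e * c))"
      by (rule real_le_rsqrt)
  qed (use c in auto)
  moreover have "((\<lambda>e. sqrt (2 * (e * c))) \<longlongrightarrow> 0) (at_right 0)"
    by (auto intro!: tendsto_eq_intros)
  ultimately have "((\<lambda>e. grad (potential e) x - u) \<longlongrightarrow> 0) (at_right 0)"
    by (rule Lim_null_comparison)
  then have "((\<lambda>e. grad (potential e) x) \<longlongrightarrow> u) (at_right 0)"
    by (simp add: LIM_zero_iff)
  then show ?thesis
    using nu slope z0[of 1] zne by (intro exI[of _ u]) (simp add: uz)
qed

lemma AE_grad_potential_tendsto: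
  "AE x in lborel. \<exists>u :: real^2. norm u = 1 \<and> u $ 1 \<noteq> 0 \<and> u $ 2 / u $ 1 \<notin> \<rat> \<and>
       ((\<lambda>e. grad (potential e) x) \<longlongrightarrow> u) (at_right 0)"
proof -
  let ?N = "{x :: real^2. \<exists>p q r :: int. (p, q) \<noteq> (0, 0) \<and> of_int p * x $ 1 + of_int q * x $ 2 = of_int r / 2}"
  have "AE x in lebesgue. x \<notin> ?N"
    by (rule AE_not_in) (use negligible_rational_lines in \<open>simp only: negligible_iff_null_sets\<close>)
  then have "AE x in lborel. x \<notin> ?N"
    by (simp add: AE_completion_iff)
  then show ?thesis
    by (rule AE_mp) (intro AE_I2 impI grad_potential_tendsto, blast)
qed

section \<open>Lebesgue measure on the plane\<close>

lemma Basis_real2: "(Basis :: (real^2) set) = {axis 1 1, axis 2 1}"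
  by (auto simp: Basis_vec_def UNIV_2)

lemma continuous_on_vector_2 [continuous_intros]:
  "continuous_on A f \<Longrightarrow> continuous_on A g \<Longrightarrow> continuous_on A (\<lambda>x. vector [f x, g x] :: real^2)"
  unfolding vector_2_eq by (intro continuous_intros)

lemma measurable_vector_2 [measurable]:
  "f \<in> borel_measurable M \<Longrightarrow> g \<in> borel_measurable M \<Longrightarrow> (\<lambda>x. vector [f x, g x] :: real^2) \<in> borel_measurable M"
  unfolding vector_2_eq
  by (intro borel_measurable_add borel_measurable_scaleR borel_measurable_const)

lemma lborel_real2: "lborel = distr (lborel \<Otimes>\<^sub>M lborel) borel (\<lambda>(a, b). vector [a, b] :: real^2)"
proof (rule lborel_eqI)
  fix l u :: "real^2"
  assume le: "\<And>b. b \<in> Basis \<Longrightarrow> l \<bullet> b \<le> u \<bullet> b"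
  have lu: "l $ i \<le> u $ i" for i
    using le[of "axis i 1"] by (simp add: inner_axis Basis_vec_def) (metis exhaust_2)
  have "(\<lambda>(a, b). vector [a, b] :: real^2) -` box l u \<inter> space (lborel \<Otimes>\<^sub>M lborel)
      = {l $ 1<..<u $ 1} \<times> {l $ 2<..<u $ 2}"
    by (auto simp: mem_box Basis_real2 inner_axis space_pair_measure)
  then have "emeasure (distr (lborel \<Otimes>\<^sub>M lborel) borel (\<lambda>(a, b). vector [a, b] :: real^2)) (box l u)
      = emeasure (lborel \<Otimes>\<^sub>M lborel) ({l $ 1<..<u $ 1} \<times> {l $ 2<..<u $ 2})"
    by (subst emeasure_distr) auto
  also have "\<dots> = ennreal (u $ 1 - l $ 1) * ennreal (u $ 2 - l $ 2)"
    using lu by (subst lborel.emeasure_pair_measure_Times) auto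
  also have "\<dots> = ennreal (\<Prod>b\<in>Basis. (u - l) \<bullet> b)"
    using lu by (simp add: Basis_real2 axis_eq_axis inner_axis ennreal_mult)
  finally show "emeasure (distr (lborel \<Otimes>\<^sub>M lborel) borel (\<lambda>(a, b). vector [a, b] :: real^2)) (box l u)
      = ennreal (\<Prod>b\<in>Basis. (u - l) \<bullet> b)" .
qed simp

lemma nn_integral_real2:
  assumes [measurable]: "f \<in> borel_measurable borel"
  shows "(\<integral>\<^sup>+x. f x \<partial>(lborel :: (real^2) measure)) = (\<integral>\<^sup>+a. \<integral>\<^sup>+b. f (vector [a, b]) \<partial>lborel \<partial>lborel)"
  by (subst lborel_real2, subst nn_integral_distr) (auto simp: lborel.nn_integral_fst[symmetric])

lemma cell_eq: "cell = cbox (vector [0, 0]) (vector [1, 1])"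
  by (auto simp: cell_def mem_box Basis_real2 inner_axis forall_2)

lemma compact_cell: "compact cell"
  by (simp add: cell_eq)

lemma sets_cell [measurable]: "cell \<in> sets borel"
  using compact_cell by (simp add: borel_compact)

text \<open>Slopes \<open>m\<close> relative to the two axes as coordinates in two pairs of opposite triangles of the square.\<close>

lemma nn_integral_slopes:
  fixes g :: "real \<Rightarrow> real \<Rightarrow> ennreal"
  assumes [measurable]: "(\<lambda>(a, b). g a b) \<in> borel_measurable borel"
  shows "(\<integral>\<^sup>+a. \<integral>\<^sup>+b. g a b * indicator {p. \<bar>snd p\<bar> \<le> \<bar>fst p\<bar> \<and> \<bar>fst p\<bar> \<le> 1/2} (a, b) \<partial>lborel \<partial>lborel)
    = (\<integral>\<^sup>+a. (\<integral>\<^sup>+m. ennreal \<bar>a\<bar> * g a (a * m) * indicator {-1..1} m \<partial>lborel) * indicator {-1/2..1/2} a \<partial>lborel)"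
proof (rule nn_integral_cong_AE, rule AE_mp[OF AE_lborel_singleton[of 0]], intro AE_I2 impI)
  fix a :: real assume a: "a \<noteq> 0"
  have [measurable]: "(\<lambda>b. g a b) \<in> borel_measurable borel"
    using measurable_compose[OF _ assms, of "\<lambda>b. (a, b)" borel] by (simp add: borel_prod[symmetric])
  have [measurable]: "(\<lambda>b. indicator {p. \<bar>snd p\<bar> \<le> \<bar>fst p\<bar> \<and> \<bar>fst p\<bar> \<le> 1/2} (a, b) :: ennreal) \<in> borel_measurable borel"
    by (simp add: indicator_def)
  have "(\<integral>\<^sup>+b. g a b * indicator {p. \<bar>snd p\<bar> \<le> \<bar>fst p\<bar> \<and> \<bar>fst p\<bar> \<le> 1/2} (a, b) \<partial>lborel)
    = ennreal \<bar>a\<bar> * (\<integral>\<^sup>+m. g a (a * m) * indicator {p. \<bar>snd p\<bar> \<le> \<bar>fst p\<bar> \<and> \<bar>fst p\<bar> \<le> 1/2} (a, a * m) \<partial>lborel)"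
    using a by (subst nn_integral_real_affine[of _ a 0]) auto
  also have "\<dots> = (\<integral>\<^sup>+m. ennreal \<bar>a\<bar> * (g a (a * m) * indicator {p. \<bar>snd p\<bar> \<le> \<bar>fst p\<bar> \<and> \<bar>fst p\<bar> \<le> 1/2} (a, a * m)) \<partial>lborel)"
    by (rule nn_integral_cmult[symmetric]) measurable
  also have "\<dots> = (\<integral>\<^sup>+m. ennreal \<bar>a\<bar> * g a (a * m) * indicator {-1..1} m * indicator {-1/2..1/2} a \<partial>lborel)"
  proof (rule nn_integral_cong)
    fix m
    have "\<bar>a * m\<bar> \<le> \<bar>a\<bar> \<longleftrightarrow> m \<in> {-1..1}"
      using a by (simp add: abs_mult) linarith
    then show "ennreal \<bar>a\<bar> * (g a (a * m) * indicator {p. \<bar>snd p\<bar> \<le> \<bar>fst p\<bar> \<and> \<bar>fst p\<bar> \<le> 1/2} (a, a * m))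
      = ennreal \<bar>a\<bar> * g a (a * m) * indicator {-1..1} m * indicator {-1/2..1/2} a"
      by (auto simp: indicator_def mult.assoc)
  qed
  also have "\<dots> = (\<integral>\<^sup>+m. ennreal \<bar>a\<bar> * g a (a * m) * indicator {-1..1} m \<partial>lborel) * indicator {-1/2..1/2} a"
    by (rule nn_integral_multc) measurable
  finally show "(\<integral>\<^sup>+b. g a b * indicator {p. \<bar>snd p\<bar> \<le> \<bar>fst p\<bar> \<and> \<bar>fst p\<bar> \<le> 1/2} (a, b) \<partial>lborel)
    = (\<integral>\<^sup>+m. ennreal \<bar>a\<bar> * g a (a * m) * indicator {-1..1} m \<partial>lborel) * indicator {-1/2..1/2} a" .
qed

text \<open>The diagonals, a null set, cut the square around \<open>center\<close> into a left-right
  and a top-bottom pair of triangles. The two summands are these pairs, with a signed coordinate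
  \<open>a\<close> along the respective axis and area element |a| da dm.\<close>

lemma nn_integral_cell_slopes:
  fixes v :: "real^2 \<Rightarrow> ennreal"
  assumes [measurable]: "v \<in> borel_measurable borel"
  shows "(\<integral>\<^sup>+x. v x * indicator cell x \<partial>lborel) =
    (\<integral>\<^sup>+a. (\<integral>\<^sup>+m. ennreal \<bar>a\<bar> * v (center + vector [a, a * m]) * indicator {-1..1} m \<partial>lborel) * indicator {-1/2..1/2} a \<partial>lborel) +
    (\<integral>\<^sup>+a. (\<integral>\<^sup>+m. ennreal \<bar>a\<bar> * v (center + vector [a * m, a]) * indicator {-1..1} m \<partial>lborel) * indicator {-1/2..1/2} a \<partial>lborel)"
proof -
  let ?T = "{p::real \<times> real. \<bar>snd p\<bar> \<le> \<bar>fst p\<bar> \<and> \<bar>fst p\<bar> \<le> 1/2}"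
  let ?g = "\<lambda>a b. v (center + vector [a, b])"
  have T: "?T \<in> sets borel"
    by (intro borel_closed closed_Collect_conj closed_Collect_le continuous_intros)
  have mg: "(\<lambda>p. ?g (fst p) (snd p)) \<in> borel_measurable borel"
    by (rule measurable_compose[OF _ assms]) (intro borel_measurable_continuous_onI continuous_intros)
  have mT: "(\<lambda>p. indicator ?T (fst p, snd p) :: ennreal) \<in> borel_measurable borel"
    using T by simp
  have mT': "(\<lambda>p. indicator ?T (snd p, fst p) :: ennreal) \<in> borel_measurable borel"
  proof -
    have "(\<lambda>p::real \<times> real. (snd p, fst p)) \<in> borel_measurable borel"
      by (intro borel_measurable_continuous_onI continuous_intros)
    from measurable_compose[OF this borel_measurable_indicator[OF T]] show ?thesis .
  qed
  have m1: "(\<lambda>p. ?g (fst p) (snd p) * indicator ?T (fst p, snd p)) \<in> borel_measurable (lborel \<Otimes>\<^sub>M lborel)"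
    and m2: "(\<lambda>p. ?g (fst p) (snd p) * indicator ?T (snd p, fst p)) \<in> borel_measurable (lborel \<Otimes>\<^sub>M lborel)"
    using mg mT mT' by (simp_all add: lborel_prod)
  have "(\<integral>\<^sup>+x. v x * indicator cell x \<partial>lborel) = (\<integral>\<^sup>+z. v (center + z) * indicator cell (center + z) \<partial>lborel)"
    by (subst lborel_distr_plus[of center, symmetric], subst nn_integral_distr) auto
  also have "\<dots> = (\<integral>\<^sup>+a. \<integral>\<^sup>+b. ?g a b * indicator cell (center + vector [a, b]) \<partial>lborel \<partial>lborel)"
    by (subst nn_integral_real2) auto
  also have "\<dots> = (\<integral>\<^sup>+a. \<integral>\<^sup>+b. ?g a b * indicator ?T (a, b) + ?g a b * indicator ?T (b, a) \<partial>lborel \<partial>lborel)"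
  proof (rule nn_integral_cong)
    fix a :: real
    have "AE b in lborel. b \<noteq> a \<and> b \<noteq> - a"
      using AE_lborel_singleton[of a] AE_lborel_singleton[of "- a"] by eventually_elim auto
    then show "(\<integral>\<^sup>+b. ?g a b * indicator cell (center + vector [a, b]) \<partial>lborel)
        = (\<integral>\<^sup>+b. ?g a b * indicator ?T (a, b) + ?g a b * indicator ?T (b, a) \<partial>lborel)"
    proof (intro nn_integral_cong_AE, eventually_elim)
      case (elim b)
      have "center + vector [a, b] \<in> cell \<longleftrightarrow> \<bar>a\<bar> \<le> 1/2 \<and> \<bar>b\<bar> \<le> 1/2"
        by (auto simp: cell_def forall_2 abs_le_iff)
      moreover have "\<bar>a\<bar> \<noteq> \<bar>b\<bar>" using elim by linarith
      ultimately show ?case by (auto simp: indicator_def)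
    qed
  qed
  also have "\<dots> = (\<integral>\<^sup>+p. ?g (fst p) (snd p) * indicator ?T (fst p, snd p) + ?g (fst p) (snd p) * indicator ?T (snd p, fst p) \<partial>(lborel \<Otimes>\<^sub>M lborel))"
    using lborel.nn_integral_fst[OF borel_measurable_add[OF m1 m2]] by simp
  also have "\<dots> = (\<integral>\<^sup>+p. ?g (fst p) (snd p) * indicator ?T (fst p, snd p) \<partial>(lborel \<Otimes>\<^sub>M lborel))
      + (\<integral>\<^sup>+p. ?g (fst p) (snd p) * indicator ?T (snd p, fst p) \<partial>(lborel \<Otimes>\<^sub>M lborel))"
    by (rule nn_integral_add[OF m1 m2])
  also have "\<dots> = (\<integral>\<^sup>+a. \<integral>\<^sup>+b. ?g a b * indicator ?T (a, b) \<partial>lborel \<partial>lborel)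
      + (\<integral>\<^sup>+b. \<integral>\<^sup>+a. ?g a b * indicator ?T (b, a) \<partial>lborel \<partial>lborel)"
    using lborel.nn_integral_fst[OF m1] lborel_pair.nn_integral_snd[OF m2]
    by simp
  also have "(\<integral>\<^sup>+a. \<integral>\<^sup>+b. ?g a b * indicator ?T (a, b) \<partial>lborel \<partial>lborel) =
    (\<integral>\<^sup>+a. (\<integral>\<^sup>+m. ennreal \<bar>a\<bar> * ?g a (a * m) * indicator {-1..1} m \<partial>lborel) * indicator {-1/2..1/2} a \<partial>lborel)"
    by (rule nn_integral_slopes) (use mg in \<open>simp add: case_prod_beta'\<close>)
  also have "(\<integral>\<^sup>+b. \<integral>\<^sup>+a. ?g a b * indicator ?T (b, a) \<partial>lborel \<partial>lborel) =
    (\<integral>\<^sup>+a. (\<integral>\<^sup>+m. ennreal \<bar>a\<bar> * ?g (a * m) a * indicator {-1..1} m \<partial>lborel) * indicator {-1/2..1/2} a \<partial>lborel)"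
  proof (rule nn_integral_slopes)
    have "(\<lambda>p::real \<times> real. center + vector [snd p, fst p]) \<in> borel_measurable borel"
      by (intro borel_measurable_continuous_onI continuous_intros)
    from measurable_compose[OF this assms]
    show "(\<lambda>(a, b). ?g b a) \<in> borel_measurable borel" by (simp add: case_prod_beta')
  qed
  finally show ?thesis .
qed

section \<open>Polar coordinates adapted to the square\<close>

lemma nn_integral_eq_integral_Icc:
  fixes f :: "real \<Rightarrow> real"
  assumes "continuous_on {a..b} f" "\<And>x. x \<in> {a..b} \<Longrightarrow> 0 \<le> f x"
  shows "(\<integral>\<^sup>+x. ennreal (f x) * indicator {a..b} x \<partial>lborel) = ennreal (integral {a..b} f)"
proof -
  have int: "set_integrable lborel {a..b} f"
    by (rule borel_integrable_atLeastAtMost'[OF assms(1)])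
  have "(\<integral>\<^sup>+x. ennreal (f x) * indicator {a..b} x \<partial>lborel) = (\<integral>\<^sup>+x. ennreal (indicator {a..b} x *\<^sub>R f x) \<partial>lborel)"
    by (intro nn_integral_cong) (auto simp: indicator_def)
  also have "\<dots> = ennreal (\<integral>x. indicator {a..b} x *\<^sub>R f x \<partial>lborel)"
    by (rule nn_integral_eq_integral[OF int[unfolded set_integrable_def]]) (auto simp: indicator_def assms(2))
  also have "\<dots> = ennreal (integral {a..b} f)"
    using set_borel_integral_eq_integral(2)[OF int] by (simp add: set_lebesgue_integral_def)
  finally show ?thesis .
qed

text \<open>The four sides of the square with half side 1, each traversed by m in [-1, 1]. The map
  (r, m) to \<open>center + r *\<^sub>R sector s m\<close> plays the role of polar coordinates: r is
  the maximum norm of the displacement from \<open>center\<close>, and the area element is r dr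
  dm.\<close>

definition sector :: "bool \<times> bool \<Rightarrow> real \<Rightarrow> real^2" where
  "sector s m = (if fst s then -1 else 1) *\<^sub>R (if snd s then vector [m, 1] else vector [1, m])"

text \<open>The radial integral is the inner one because the later estimates run along a ray of
  fixed slope before they are integrated over the slopes.\<close>

lemma set_integral_cell:
  fixes v :: "real^2 \<Rightarrow> real"
  assumes v: "continuous_on UNIV v" "\<And>x. 0 \<le> v x"
  shows "(LINT x:cell|lborel. v x) =
    (\<Sum>s\<in>UNIV. integral {-1..1} (\<lambda>m. integral {0..1/2} (\<lambda>r. r * v (center + r *\<^sub>R sector s m))))"
proof -
  have cont: "continuous_on A (\<lambda>x. v (f x))" if "continuous_on A f" for f :: "'a::topological_space \<Rightarrow> real^2" and A
    by (rule continuous_on_compose2[OF v(1) that]) auto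
  have sector_cont: "continuous_on A (\<lambda>x. sector s (f x))" if "continuous_on A f" for s and f :: "'a::topological_space \<Rightarrow> real" and A
    unfolding sector_def by (cases "fst s"; cases "snd s") (auto intro!: continuous_intros that)
  let ?I = "\<lambda>s a. integral {-1..1} (\<lambda>m. \<bar>a\<bar> * v (center + a *\<^sub>R sector s m))"
  have contI: "continuous_on A (?I s)" for s A
    unfolding cbox_interval[symmetric]
    by (rule integral_continuous_on_param) (auto simp: case_prod_beta' intro!: continuous_intros cont sector_cont)
  have nnI: "0 \<le> ?I s a" for s a
    by (rule integral_nonneg) (auto simp: v intro!: integrable_continuous_interval continuous_intros cont sector_cont)
  have part: "(\<integral>\<^sup>+a. (\<integral>\<^sup>+m. ennreal \<bar>a\<bar> * ennreal (v (center + a *\<^sub>R sector s m)) * indicator {-1..1} m \<partial>lborel) * indicator {-1/2..1/2} a \<partial>lborel)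
     = ennreal (integral {-1/2..1/2} (?I s))" for s
  proof -
    have "(\<integral>\<^sup>+m. ennreal \<bar>a\<bar> * ennreal (v (center + a *\<^sub>R sector s m)) * indicator {-1..1} m \<partial>lborel) = ennreal (?I s a)" for a
      by (subst nn_integral_eq_integral_Icc[symmetric])
        (auto simp: ennreal_mult v intro!: continuous_intros cont sector_cont)
    then show ?thesis
      using nn_integral_eq_integral_Icc[OF contI nnI] by (simp only:)
  qed
  \<comment> \<open>A signed radius covers two opposite triangles; the reflection a to -a turns the
    negative half into the opposite sector.\<close>
  have half: "integral {-1/2..1/2} (?I (False, b)) =
      integral {-1..1} (\<lambda>m. integral {0..1/2} (\<lambda>r. r * v (center + r *\<^sub>R sector (False, b) m)))
      + integral {-1..1} (\<lambda>m. integral {0..1/2} (\<lambda>r. r * v (center + r *\<^sub>R sector (True, b) m)))" for b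
  proof -
    let ?s = "(False, b)"
    have sw: "integral {0..1/2} (?I s') = integral {-1..1} (\<lambda>m. integral {0..1/2} (\<lambda>r. r * v (center + r *\<^sub>R sector s' m)))" for s'
    proof -
      have "integral (cbox 0 (1/2)) (\<lambda>a. integral (cbox (-1) 1) (\<lambda>m. \<bar>a\<bar> * v (center + a *\<^sub>R sector s' m))) =
        integral (cbox (-1) 1) (\<lambda>m. integral (cbox 0 (1/2)) (\<lambda>a. \<bar>a\<bar> * v (center + a *\<^sub>R sector s' m)))"
        by (rule integral_swap_continuous)
          (auto simp: case_prod_beta' intro!: continuous_intros cont sector_cont)
      moreover have "integral {0..1/2} (\<lambda>a. \<bar>a\<bar> * v (center + a *\<^sub>R sector s' m))
          = integral {0..1/2} (\<lambda>r. r * v (center + r *\<^sub>R sector s' m))" for m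
        by (rule integral_cong) auto
      ultimately show ?thesis
        unfolding cbox_interval by simp
    qed
    have "integral {-1/2..1/2} (?I ?s) = integral {-1/2..0} (?I ?s) + integral {0..1/2} (?I ?s)"
      by (rule Henstock_Kurzweil_Integration.integral_combine[symmetric])
        (rule integrable_continuous_interval[OF contI] | simp)+
    also have "integral {-1/2..0} (?I ?s) = integral {0..1/2} (\<lambda>a. ?I ?s (- a))"
      using Henstock_Kurzweil_Integration.integral_reflect_real[of "1/2" 0 "\<lambda>a. ?I ?s (- a)"]
      by (simp only: minus_minus minus_zero minus_divide_left)
    also have "(\<lambda>a. ?I ?s (- a)) = ?I (True, b)"
      by (auto simp: sector_def fun_eq_iff)
    finally show ?thesis
      by (simp only: sw add.commute)
  qed
  have cc: "integrable lborel (\<lambda>x. indicator cell x *\<^sub>R v x)"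
    by (rule borel_integrable_compact[OF compact_cell]) (use v in \<open>auto intro: continuous_on_subset\<close>)
  have "ennreal (LINT x:cell|lborel. v x) = (\<integral>\<^sup>+x. ennreal (indicator cell x *\<^sub>R v x) \<partial>lborel)"
    unfolding set_lebesgue_integral_def
    by (rule nn_integral_eq_integral[OF cc, symmetric]) (auto simp: v)
  also have "\<dots> = (\<integral>\<^sup>+x. ennreal (v x) * indicator cell x \<partial>lborel)"
    by (intro nn_integral_cong) (auto simp: indicator_def)
  also have "\<dots> = ennreal (integral {-1/2..1/2} (?I (False, False))) + ennreal (integral {-1/2..1/2} (?I (False, True)))"
  proof -
    have mv: "(\<lambda>x. ennreal (v x)) \<in> borel_measurable borel"
      using borel_measurable_continuous_onI[OF v(1)] by simp
    have 1: "center + vector [a, a * m] = center + a *\<^sub>R sector (False, False) m"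
      and 2: "center + vector [a * m, a] = center + a *\<^sub>R sector (False, True) m" for a m
      by (simp_all add: sector_def vec_eq_iff forall_2)
    show ?thesis
      unfolding nn_integral_cell_slopes[OF mv] 1 2 part ..
  qed
  also have "\<dots> = ennreal (integral {-1/2..1/2} (?I (False, False)) + integral {-1/2..1/2} (?I (False, True)))"
    by (intro ennreal_plus[symmetric] integral_nonneg integrable_continuous_interval contI nnI)
  finally have eq: "(LINT x:cell|lborel. v x) = integral {-1/2..1/2} (?I (False, False)) + integral {-1/2..1/2} (?I (False, True))"
  proof (rule ennreal_inj[THEN iffD1, rotated 2])
    show "0 \<le> (LINT x:cell|lborel. v x)"
      unfolding set_lebesgue_integral_def by (rule Bochner_Integration.integral_nonneg) (simp add: v)
  qed (intro add_nonneg_nonneg integral_nonneg integrable_continuous_interval contI nnI)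
  have U: "(UNIV :: (bool \<times> bool) set) = {(False, False), (False, True), (True, False), (True, True)}"
    by auto
  show ?thesis
    unfolding eq half U by (simp add: algebra_simps)
qed

section \<open>A Poincare inequality focused at a point\<close>

text \<open>Cauchy-Schwarz for the integral of \<open>g'\<close> with the integrand split as p q.
  Young's inequality with a free parameter l, optimized at the end, avoids integrals of square
  roots.\<close>

lemma increment_sq_le:
  fixes g g' p q :: "real \<Rightarrow> real"
  assumes ab: "a \<le> b"
    and g: "\<And>x. x \<in> {a..b} \<Longrightarrow> (g has_real_derivative g' x) (at x)"
    and p: "continuous_on {a..b} p" "\<And>x. x \<in> {a..b} \<Longrightarrow> 0 \<le> p x"
    and q: "continuous_on {a..b} q" "\<And>x. x \<in> {a..b} \<Longrightarrow> 0 \<le> q x"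
    and le: "\<And>x. x \<in> {a..b} \<Longrightarrow> (g' x)\<^sup>2 \<le> p x * q x"
  shows "(g b - g a)\<^sup>2 \<le> integral {a..b} p * integral {a..b} q"
proof -
  define D where "D = \<bar>g b - g a\<bar>"
  let ?P = "integral {a..b} p" and ?Q = "integral {a..b} q"
  have P: "0 \<le> ?P" and Q: "0 \<le> ?Q"
    using p q by (auto intro!: integral_nonneg integrable_continuous_interval)
  have int_g: "(g' has_integral (g b - g a)) {a..b}"
    by (rule fundamental_theorem_of_calculus[OF ab])
      (use g has_field_derivative_at_within has_real_derivative_iff_has_vector_derivative in blast)
  have amgm: "x * y \<le> ((x + y) / 2)\<^sup>2" for x y :: real
    using zero_le_power2[of "x - y"] by (simp add: power2_eq_square field_simps)
  have young: "2 * D \<le> l * ?P + ?Q / l" if l: "0 < l" for l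
  proof -
    have int: "((\<lambda>x. (l * p x + q x / l) / 2) has_integral (l * ?P + ?Q / l) / 2) {a..b}"
      using integrable_integral[OF integrable_continuous_interval[OF p(1)]]
        integrable_integral[OF integrable_continuous_interval[OF q(1)]]
      by (intro has_integral_divide has_integral_add has_integral_mult_right)
    have pt: "\<bar>g' x\<bar> \<le> (l * p x + q x / l) / 2" if "x \<in> {a..b}" for x
    proof (rule power2_le_imp_le)
      have "\<bar>g' x\<bar>\<^sup>2 \<le> (l * p x) * (q x / l)" using le[OF that] l by simp
      also have "\<dots> \<le> ((l * p x + q x / l) / 2)\<^sup>2"
        by (rule amgm)
      finally show "\<bar>g' x\<bar>\<^sup>2 \<le> ((l * p x + q x / l) / 2)\<^sup>2" .
      show "0 \<le> (l * p x + q x / l) / 2" using p(2)[OF that] q(2)[OF that] l by simp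
    qed
    have "g b - g a \<le> (l * ?P + ?Q / l) / 2"
      by (rule has_integral_le[OF int_g int]) (use pt abs_le_iff in blast)
    moreover have "- (g b - g a) \<le> (l * ?P + ?Q / l) / 2"
      by (rule has_integral_le[OF has_integral_neg[OF int_g] int]) (use pt abs_le_iff in blast)
    ultimately have "D \<le> (l * ?P + ?Q / l) / 2"
      unfolding D_def by (rule abs_leI)
    then show ?thesis by simp
  qed
  have "D\<^sup>2 \<le> ?P * ?Q"
  proof (cases "D = 0")
    case True
    then show ?thesis using P Q by simp
  next
    case False
    then have D: "0 < D" by (simp add: D_def)
    show ?thesis
    proof (cases "?P = 0")
      case True
      \<comment> \<open>With P = 0 the optimal l is infinite; this finite one is large enough to
        contradict D > 0. In the other case l = D / P is used.\<close>
      have "2 * D \<le> ?Q / ((?Q + 1) / D)" using young[of "(?Q + 1) / D"] D Q True by simp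
      also have "\<dots> = D * (?Q / (?Q + 1))" by simp
      also have "\<dots> \<le> D * 1" using D Q by (intro mult_left_mono) auto
      finally show ?thesis using D by simp
    next
      case False
      then have P': "0 < ?P" using P by simp
      have "2 * D \<le> D + ?Q / (D / ?P)" using young[of "D / ?P"] D P' by simp
      then have "D \<le> ?P * ?Q / D" by (simp add: mult.commute)
      then show ?thesis using D by (simp add: field_simps power2_eq_square)
    qed
  qed
  then show ?thesis by (simp add: D_def)
qed

lemma increment_sq_le_Icc:
  fixes g :: "real \<Rightarrow> real"
  assumes ab: "a \<le> x" "x \<le> y" "y \<le> b"
    and g: "\<And>x. x \<in> {a..b} \<Longrightarrow> (g has_real_derivative g' x) (at x)"
    and u: "continuous_on {a..b} u" "\<And>x. x \<in> {a..b} \<Longrightarrow> (g' x)\<^sup>2 \<le> u x"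
  shows "(g y - g x)\<^sup>2 \<le> (b - a) * integral {a..b} u"
proof -
  have u0: "0 \<le> u x" if "x \<in> {a..b}" for x
    using u(2)[OF that] zero_le_power2[of "g' x"] by linarith
  have "(g y - g x)\<^sup>2 \<le> integral {x..y} (\<lambda>_. 1) * integral {x..y} u"
    by (rule increment_sq_le[where g' = g'])
      (use ab g u u0 in \<open>auto intro: continuous_on_subset\<close>)
  also have "\<dots> = (y - x) * integral {x..y} u" using ab by simp
  also have "\<dots> \<le> (b - a) * integral {a..b} u"
    using ab u u0
    by (intro mult_mono integral_subset_le integrable_continuous_interval integral_nonneg)
      (auto intro: continuous_on_subset)
  finally show ?thesis .
qed

text \<open>The area element supplies only the weight s, so the split is K / s times s u(s). The
  first factor integrates to the logarithm that governs the whole argument.\<close>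

lemma increment_sq_le_log:
  fixes g :: "real \<Rightarrow> real"
  assumes ab: "0 < a" "a \<le> b" "b \<le> c"
    and g: "\<And>x. x \<in> {a..b} \<Longrightarrow> (g has_real_derivative g' x) (at x)"
    and u: "continuous_on {0..c} u" "\<And>x. x \<in> {0..c} \<Longrightarrow> 0 \<le> u x"
    and le: "\<And>x. x \<in> {a..b} \<Longrightarrow> (g' x)\<^sup>2 \<le> K * u x" and K: "0 \<le> K"
  shows "(g b - g a)\<^sup>2 \<le> K * ln (b / a) * integral {0..c} (\<lambda>s. s * u s)"
proof -
  have ln: "((\<lambda>s. K / s) has_integral K * ln (b / a)) {a..b}"
  proof -
    have "((\<lambda>s. K / s) has_integral (K * ln b - K * ln a)) {a..b}"
    proof (rule fundamental_theorem_of_calculus[OF ab(2)])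
      fix s assume "s \<in> {a..b}"
      then have "((\<lambda>s. K * ln s) has_real_derivative K / s) (at s within {a..b})"
        using ab by (auto intro!: derivative_eq_intros)
      then show "((\<lambda>s. K * ln s) has_vector_derivative K / s) (at s within {a..b})"
        by (simp add: has_real_derivative_iff_has_vector_derivative)
    qed
    then show ?thesis using ab by (simp add: ln_div right_diff_distrib)
  qed
  have su: "continuous_on {a..b} (\<lambda>s. s * u s)"
    using ab u by (auto intro!: continuous_intros intro: continuous_on_subset)
  have "(g b - g a)\<^sup>2 \<le> integral {a..b} (\<lambda>s. K / s) * integral {a..b} (\<lambda>s. s * u s)"
  proof (rule increment_sq_le[OF ab(2) g])
    show "continuous_on {a..b} (\<lambda>s. K / s)" using ab by (intro continuous_intros) auto
    show "(g' x)\<^sup>2 \<le> K / x * (x * u x)" if "x \<in> {a..b}" for x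
      using le[OF that] that ab by simp
  qed (use su ab u K in auto)
  also have "integral {a..b} (\<lambda>s. K / s) = K * ln (b / a)"
    by (rule integral_unique[OF ln])
  also have "K * ln (b / a) * integral {a..b} (\<lambda>s. s * u s) \<le> K * ln (b / a) * integral {0..c} (\<lambda>s. s * u s)"
  proof (rule mult_left_mono)
    show "integral {a..b} (\<lambda>s. s * u s) \<le> integral {0..c} (\<lambda>s. s * u s)"
      using ab u su by (intro integral_subset_le integrable_continuous_interval) (auto intro!: continuous_intros)
    show "0 \<le> K * ln (b / a)" using K ab by simp
  qed
  finally show ?thesis .
qed

text \<open>Moves from r to r' along one ray. The stretch inside the core is stiff and costs \<eta>
  times a logarithm; the stretches outside it cost O(\<rho>), once the factor r of the area element
  is included. The factors 2 in the hypotheses bound the squared length 1 + m^2 of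
  \<open>sector\<close>. The coefficients come from (x + y + z)^2 <= 3 (x^2 + y^2 + z^2) and r <=
  1/2.\<close>

lemma radial_bound:
  fixes g :: "real \<Rightarrow> real"
  assumes \<rho>: "0 < \<rho>" "\<rho> < 1/4" and \<eta>: "0 \<le> \<eta>"
    and g: "\<And>x. (g has_real_derivative g' x) (at x)"
    and u: "continuous_on {0..1/2} u" "\<And>x. x \<in> {0..1/2} \<Longrightarrow> 0 \<le> u x"
    and le: "\<And>x. x \<in> {0..1/2} \<Longrightarrow> (g' x)\<^sup>2 \<le> 2 * u x"
    and le': "\<And>x. x \<in> {\<rho>..1/2 - \<rho>} \<Longrightarrow> (g' x)\<^sup>2 \<le> 2 * \<eta> * u x"
    and r: "r \<in> {0..1/2}" and r': "r' \<in> {\<rho>..1/2 - \<rho>}"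
  shows "r * (g r - k)\<^sup>2 \<le> (12 * \<rho> + 3 * \<eta> * ln ((1/2 - \<rho>) / \<rho>)) * integral {0..1/2} (\<lambda>s. s * u s)
    + 3/2 * (g r' - k)\<^sup>2"
proof -
  define e where "e = integral {0..1/2} (\<lambda>s. s * u s)"
  define L where "L = ln ((1/2 - \<rho>) / \<rho>)"
  \<comment> \<open>The point of the core nearest to r; the path goes from r to c and then inside
    the core to r'.\<close>
  define c where "c = min (max r \<rho>) (1/2 - \<rho>)"
  have e: "0 \<le> e"
    unfolding e_def using u by (intro integral_nonneg integrable_continuous_interval) (auto intro!: continuous_intros)
  have middle: "(g y - g x)\<^sup>2 \<le> 2 * \<eta> * L * e" if "\<rho> \<le> x" "x \<le> y" "y \<le> 1/2 - \<rho>" for x y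
  proof -
    have "(g y - g x)\<^sup>2 \<le> 2 * \<eta> * ln (y / x) * e"
      unfolding e_def by (rule increment_sq_le_log[where g' = g']) (use that \<rho> \<eta> g u le' in auto)
    also have "\<dots> \<le> 2 * \<eta> * L * e"
      unfolding L_def using that \<rho> \<eta> e by (intro mult_right_mono mult_left_mono) (auto intro!: frac_le)
    finally show ?thesis .
  qed
  have c: "c \<in> {\<rho>..1/2 - \<rho>}" using \<rho> by (auto simp: c_def)
  have "(g c - g r')\<^sup>2 \<le> 2 * \<eta> * L * e"
    using middle[of c r'] middle[of r' c] c r' by (cases "c \<le> r'") (auto simp: power2_commute)
  then have 2: "r * (g c - g r')\<^sup>2 \<le> \<eta> * L * e"
    using mult_mono[of r "1/2" "(g c - g r')\<^sup>2" "2 * \<eta> * L * e"] r by simp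
  have 1: "r * (g r - g c)\<^sup>2 \<le> 4 * \<rho> * e"
  proof -
    consider "r = 0" | "0 < r" "r < \<rho>" | "r \<in> {\<rho>..1/2 - \<rho>}" | "1/2 - \<rho> < r"
      using r by fastforce
    then show ?thesis
    proof cases
      case 1
      then show ?thesis using \<rho> e by simp
    next
      case 2
      then have cr: "c = \<rho>" using \<rho> by (simp add: c_def)
      have "(g \<rho> - g r)\<^sup>2 \<le> 2 * ln (\<rho> / r) * e"
        unfolding e_def by (rule increment_sq_le_log[where g' = g']) (use 2 \<rho> g u le in auto)
      \<comment> \<open>The logarithm is unbounded as r tends to 0, but r ln (\<rho> / r) is at most
        \<rho> - r. This is where the weight r on the left-hand side is essential.\<close>
      also have "\<dots> \<le> 2 * (\<rho> / r - 1) * e"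
        using 2 \<rho> e by (intro mult_right_mono mult_left_mono ln_le_minus_one) auto
      finally have "r * (g \<rho> - g r)\<^sup>2 \<le> r * (2 * (\<rho> / r - 1) * e)"
        using 2 by (intro mult_left_mono) auto
      also have "\<dots> = 2 * (\<rho> - r) * e" using 2 by (simp add: field_simps)
      also have "\<dots> \<le> 4 * \<rho> * e" using 2 e by (intro mult_right_mono) auto
      finally show ?thesis by (simp add: cr power2_commute)
    next
      case 3
      then have "c = r" by (simp add: c_def)
      then show ?thesis using \<rho> e by simp
    next
      case 4
      then have cr: "c = 1/2 - \<rho>" using \<rho> by (simp add: c_def)
      have "(g r - g (1/2 - \<rho>))\<^sup>2 \<le> 2 * ln (r / (1/2 - \<rho>)) * e"
        unfolding e_def by (rule increment_sq_le_log[where g' = g']) (use 4 \<rho> g u le r in auto)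
      also have "\<dots> \<le> 2 * (4 * \<rho>) * e"
      proof -
        \<comment> \<open>Near the outer boundary the two radii are within \<rho> of each other and
          at least 1/4, so the logarithm is at most 4 \<rho>.\<close>
        have "ln (r / (1/2 - \<rho>)) \<le> r / (1/2 - \<rho>) - 1"
          using 4 \<rho> by (intro ln_le_minus_one) auto
        also have "\<dots> = (r - (1/2 - \<rho>)) / (1/2 - \<rho>)" using \<rho> by (simp add: field_simps)
        also have "\<dots> \<le> \<rho> / (1/4)" using r \<rho> 4 by (intro frac_le) auto
        finally show ?thesis using e by (intro mult_right_mono mult_left_mono) auto
      qed
      finally have "(g r - g c)\<^sup>2 \<le> 8 * \<rho> * e" by (simp add: cr)
      then show ?thesis
        using mult_mono[of r "1/2" "(g r - g c)\<^sup>2" "8 * \<rho> * e"] r by simp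
    qed
  qed
  have 3: "r * (g r' - k)\<^sup>2 \<le> 1/2 * (g r' - k)\<^sup>2"
    using r by (intro mult_right_mono) auto
  have "(g r - k)\<^sup>2 \<le> 3 * ((g r - g c)\<^sup>2 + (g c - g r')\<^sup>2 + (g r' - k)\<^sup>2)"
  proof -
    have "(x + y + z)\<^sup>2 \<le> 3 * (x\<^sup>2 + y\<^sup>2 + z\<^sup>2)" for x y z :: real
      using zero_le_power2[of "x - y"] zero_le_power2[of "y - z"] zero_le_power2[of "x - z"]
      by (simp add: power2_eq_square algebra_simps)
    from this[of "g r - g c" "g c - g r'" "g r' - k"] show ?thesis by simp
  qed
  then have "r * (g r - k)\<^sup>2 \<le> r * (3 * ((g r - g c)\<^sup>2 + (g c - g r')\<^sup>2 + (g r' - k)\<^sup>2))"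
    using r by (intro mult_left_mono) auto
  also have "\<dots> = 3 * (r * (g r - g c)\<^sup>2) + 3 * (r * (g c - g r')\<^sup>2) + 3 * (r * (g r' - k)\<^sup>2)"
    by (simp add: algebra_simps)
  also have "\<dots> \<le> 3 * (4 * \<rho> * e) + 3 * (\<eta> * L * e) + 3 * (1/2 * (g r' - k)\<^sup>2)"
    using 1 2 3 by linarith
  finally show ?thesis
    unfolding e_def L_def by (simp add: algebra_simps)
qed

section \<open>The inequality on the square\<close>

definition sector' :: "bool \<times> bool \<Rightarrow> real^2" where
  "sector' s = (if fst s then -1 else 1) *\<^sub>R (if snd s then axis 1 1 else axis 2 1)"

lemma sector_eq: "sector s m = sector s 0 + m *\<^sub>R sector' s"
  by (auto simp: sector_def sector'_def vec_eq_iff forall_2 axis_def)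

lemma norm_sector: "(norm (sector s m))\<^sup>2 = 1 + m\<^sup>2"
  unfolding power2_norm_eq_inner inner_2 by (auto simp: sector_def power2_eq_square)

lemma norm_sector' [simp]: "norm (sector' s) = 1"
  by (auto simp: sector'_def)

lemma abs_sector_nth: "\<bar>m\<bar> \<le> 1 \<Longrightarrow> \<bar>sector s m $ i\<bar> \<le> 1"
  using exhaust_2[of i] by (cases "fst s"; cases "snd s") (auto simp: sector_def)

lemma continuous_on_sector [continuous_intros]:
  "continuous_on A f \<Longrightarrow> continuous_on A (\<lambda>x. sector s (f x))"
  unfolding sector_eq[of s "f _"] by (intro continuous_intros)

text \<open>Here \<open>c\<close> is an energy density that dominates all directional derivatives,
  and by the factor \<eta> better the radial ones on the core. Averaging with weight dr / r finds
  one square around \<open>center\<close> that carries little energy, so \<phi> is nearly a constant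
  k on it; every other point is compared with that square along its ray. The three terms of the
  bound are the parts outside the core, the stiff radial part, and the oscillation on the chosen
  square.\<close>

lemma focal_poincare:
  fixes \<phi> c :: "real^2 \<Rightarrow> real" and D :: "real^2 \<Rightarrow> real^2"
  assumes \<rho>: "0 < \<rho>" "\<rho> < 1/4" and \<eta>: "0 \<le> \<eta>"
    and \<phi>: "\<And>x. (\<phi> has_derivative (\<lambda>v. D x \<bullet> v)) (at x)"
    and c: "continuous_on UNIV c"
    and full: "\<And>x v. (D x \<bullet> v)\<^sup>2 \<le> (norm v)\<^sup>2 * c x"
    and radial: "\<And>z. \<rho> \<le> norm z \<Longrightarrow> (\<And>i. \<bar>z $ i\<bar> \<le> 1/2 - \<rho>) \<Longrightarrow>
       (D (center + z) \<bullet> z)\<^sup>2 \<le> (norm z)\<^sup>2 * (\<eta> * c (center + z))"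
  obtains k where "(LINT x:cell|lborel. (\<phi> x - k)\<^sup>2) \<le>
    (6 * \<rho> + 3/2 * \<eta> * ln ((1/2 - \<rho>) / \<rho>) + 48 / ln ((1/2 - \<rho>) / \<rho>)) * (LINT x:cell|lborel. c x)"
proof -
  define L where "L = ln ((1/2 - \<rho>) / \<rho>)"
  have L: "0 < L" unfolding L_def using \<rho> by (intro ln_gt_zero) (simp add: field_simps)
  have c0: "0 \<le> c x" for x
    using order_trans[OF zero_le_power2 full[of x "axis 1 1"]] by simp
  have cont_c: "continuous_on A (\<lambda>x. c (f x))" if "continuous_on A f" for f :: "'a::topological_space \<Rightarrow> real^2" and A
    by (rule continuous_on_compose2[OF c that]) auto
  let ?x = "\<lambda>s r m. center + r *\<^sub>R sector s m"
  have cont_cx: "continuous_on A (\<lambda>p. c (?x s (f p) (h p)))"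
    if "continuous_on A f" "continuous_on A h" for f h :: "'a::topological_space \<Rightarrow> real" and A s
    by (intro cont_c continuous_intros that)
  define e where "e s m = integral {0..1/2} (\<lambda>r. r * c (?x s r m))" for s m
  define E where "E = (LINT x:cell|lborel. c x)"
  have E: "E = (\<Sum>s\<in>UNIV. integral {-1..1} (e s))"
    unfolding E_def e_def by (rule set_integral_cell[OF c c0])
  have cont_e: "continuous_on A (e s)" for A s
    unfolding e_def cbox_interval[symmetric]
    by (rule integral_continuous_on_param) (auto simp: case_prod_beta' intro!: continuous_intros cont_cx)

  have gr: "((\<lambda>r. \<phi> (?x s r m)) has_real_derivative D (?x s r m) \<bullet> sector s m) (at r)" for s r m
  proof -
    have "((\<lambda>r. ?x s r m) has_derivative (\<lambda>t. t *\<^sub>R sector s m)) (at r)"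
      by (auto intro!: derivative_eq_intros)
    from has_derivative_compose[OF this \<phi>] show ?thesis
      by (simp add: has_field_derivative_def mult_commute_abs)
  qed
  have gm: "((\<lambda>m. \<phi> (?x s r m)) has_real_derivative r * (D (?x s r m) \<bullet> sector' s)) (at m)" for s r m
  proof -
    have "((\<lambda>m. center + r *\<^sub>R (sector s 0 + m *\<^sub>R sector' s)) has_derivative (\<lambda>t. r *\<^sub>R t *\<^sub>R sector' s)) (at m)"
      by (auto intro!: derivative_eq_intros)
    from has_derivative_compose[OF this[folded sector_eq] \<phi>] show ?thesis
      unfolding has_field_derivative_def by (rule has_derivative_eq_rhs) (simp add: fun_eq_iff)
  qed

  \<comment> \<open>Bounds the tangential energy on the square of radius r: the derivative of \<phi>
    in the slope carries a factor r. At the same time \<kappa>(r) / r is the radial density of the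
    total energy E.\<close>
  define \<kappa> where "\<kappa> r = (\<Sum>s\<in>UNIV. integral {-1..1} (\<lambda>m. r * (r * c (?x s r m))))" for r
  have cont_part: "continuous_on A (\<lambda>r. integral {-1..1} (\<lambda>m. r * c (?x s r m)))" for A s
    unfolding cbox_interval[symmetric]
    by (rule integral_continuous_on_param) (auto simp: case_prod_beta' intro!: continuous_intros cont_cx)
  have \<kappa>: "\<kappa> r = r * (\<Sum>s\<in>UNIV. integral {-1..1} (\<lambda>m. r * c (?x s r m)))" for r
    unfolding \<kappa>_def sum_distrib_left by (intro sum.cong refl integral_mult_right)
  obtain r' where r': "r' \<in> {\<rho>..1/2 - \<rho>}" and \<kappa>L: "\<kappa> r' * L \<le> E"
  proof -
    have cont_\<kappa>: "continuous_on A \<kappa>" for A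
      unfolding \<kappa> by (intro continuous_intros cont_part)
    \<comment> \<open>Comparing the minimum of \<kappa> with its integral against dr / r, which has
      total mass L on the core, yields \<kappa>(r') L <= E.\<close>
    obtain r' where r': "r' \<in> {\<rho>..1/2 - \<rho>}" and min: "\<And>r. r \<in> {\<rho>..1/2 - \<rho>} \<Longrightarrow> \<kappa> r' \<le> \<kappa> r"
      using continuous_attains_inf[OF _ _ cont_\<kappa>, of "{\<rho>..1/2 - \<rho>}"] \<rho> by auto
    let ?S = "\<lambda>r. \<Sum>s\<in>UNIV. integral {-1..1} (\<lambda>m. r * c (?x s r m))"
    have ln: "((\<lambda>s. \<kappa> r' / s) has_integral \<kappa> r' * L) {\<rho>..1/2 - \<rho>}"
    proof -
      have "((\<lambda>s. \<kappa> r' / s) has_integral (\<kappa> r' * ln (1/2 - \<rho>) - \<kappa> r' * ln \<rho>)) {\<rho>..1/2 - \<rho>}"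
      proof (rule fundamental_theorem_of_calculus)
        fix s assume "s \<in> {\<rho>..1/2 - \<rho>}"
        then have "((\<lambda>s. \<kappa> r' * ln s) has_real_derivative \<kappa> r' / s) (at s within {\<rho>..1/2 - \<rho>})"
          using \<rho> by (auto intro!: derivative_eq_intros)
        then show "((\<lambda>s. \<kappa> r' * ln s) has_vector_derivative \<kappa> r' / s) (at s within {\<rho>..1/2 - \<rho>})"
          by (simp add: has_real_derivative_iff_has_vector_derivative)
      qed (use \<rho> in auto)
      then show ?thesis using \<rho> by (simp add: L_def ln_div right_diff_distrib)
    qed
    have contS: "continuous_on A ?S" for A
      by (intro continuous_intros cont_part)
    have S0: "0 \<le> ?S r" if "0 \<le> r" for r
      using that c0 by (intro sum_nonneg integral_nonneg integrable_continuous_interval)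
        (auto intro!: continuous_intros cont_cx)
    have "\<kappa> r' * L \<le> integral {\<rho>..1/2 - \<rho>} ?S"
    proof (rule has_integral_le[OF ln integrable_integral[OF integrable_continuous_interval[OF contS]]])
      fix r assume r: "r \<in> {\<rho>..1/2 - \<rho>}"
      then show "\<kappa> r' / r \<le> ?S r"
        using min[OF r] \<rho> unfolding \<kappa>[of r] by (simp add: field_simps)
    qed
    also have "\<dots> \<le> integral {0..1/2} ?S"
      using \<rho> S0 by (intro integral_subset_le integrable_continuous_interval contS) auto
    also have "\<dots> = (\<Sum>s\<in>UNIV. integral {0..1/2} (\<lambda>r. integral {-1..1} (\<lambda>m. r * c (?x s r m))))"
      by (intro integral_sum integrable_continuous_interval cont_part) auto
    also have "\<dots> = E"
      unfolding E e_def
    proof (rule sum.cong[OF refl])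
      fix s
      have "integral (cbox 0 (1/2)) (\<lambda>r. integral (cbox (-1) 1) (\<lambda>m. r * c (?x s r m)))
        = integral (cbox (-1) 1) (\<lambda>m. integral (cbox 0 (1/2)) (\<lambda>r. r * c (?x s r m)))"
        by (rule integral_swap_continuous) (auto simp: case_prod_beta' intro!: continuous_intros cont_cx)
      then show "integral {0..1/2} (\<lambda>r. integral {-1..1} (\<lambda>m. r * c (?x s r m)))
        = integral {-1..1} (\<lambda>m. integral {0..1/2} (\<lambda>r. r * c (?x s r m)))"
        by (simp add: cbox_interval)
    qed
    finally show thesis using r' by (intro that)
  qed
  have r'0: "0 < r'" using r' \<rho> by auto

  \<comment> \<open>Oscillation along one side of the chosen square; the factor 2 is the length of
    the slope interval.\<close>
  have side: "(\<phi> (?x s r' m) - \<phi> (?x s r' m'))\<^sup>2 \<le> 2 * \<kappa> r'" if "\<bar>m\<bar> \<le> 1" "\<bar>m'\<bar> \<le> 1" for s m m'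
  proof -
    have *: "(\<phi> (?x s r' m) - \<phi> (?x s r' m'))\<^sup>2 \<le> 2 * integral {-1..1} (\<lambda>m. r' * (r' * c (?x s r' m)))"
      if "m' \<le> m" "-1 \<le> m'" "m \<le> 1" for m m'
    proof -
      have "(r' * (D (?x s r' m) \<bullet> sector' s))\<^sup>2 \<le> r' * (r' * c (?x s r' m))" for m
        using mult_left_mono[OF full[of "?x s r' m" "sector' s"], of "r'\<^sup>2"]
        by (simp add: power_mult_distrib power2_eq_square mult_ac)
      then show ?thesis
        using increment_sq_le_Icc[where g = "\<lambda>m. \<phi> (?x s r' m)" and g' = "\<lambda>m. r' * (D (?x s r' m) \<bullet> sector' s)"
            and u = "\<lambda>m. r' * (r' * c (?x s r' m))", OF that(2,1,3) gm]
        by (simp add: continuous_intros cont_cx)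
    qed
    have le: "integral {-1..1} (\<lambda>m. r' * (r' * c (?x s r' m))) \<le> \<kappa> r'"
      unfolding \<kappa>_def
      by (rule member_le_sum[of s UNIV "\<lambda>s. integral {-1..1} (\<lambda>m. r' * (r' * c (?x s r' m)))"])
        (use c0 r'0 in \<open>auto intro!: mult_nonneg_nonneg integral_nonneg integrable_continuous_interval continuous_intros cont_cx\<close>)
    have "(\<phi> (?x s r' m) - \<phi> (?x s r' m'))\<^sup>2 \<le> 2 * integral {-1..1} (\<lambda>m. r' * (r' * c (?x s r' m)))"
    proof (cases "m' \<le> m")
      case True
      then show ?thesis using that by (intro *) auto
    next
      case False
      then show ?thesis using that by (subst power2_commute, intro *) auto
    qed
    then show ?thesis using le by linarith
  qed
  \<comment> \<open>The value at the corner (1, 1). Adjacent sides share corners, so every point of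
    the square reaches this one along at most two sides: the oscillation is at most 2 d, and (2 d)^2
    = 8 \<kappa>(r').\<close>
  define k where "k = \<phi> (?x (False, False) r' 1)"
  have slice: "(\<phi> (?x s r' m) - k)\<^sup>2 \<le> 8 * (E / L)" if m: "m \<in> {-1..1}" for s m
  proof -
    define d where "d = sqrt (2 * \<kappa> r')"
    have \<kappa>0: "0 \<le> \<kappa> r'"
      using order_trans[OF zero_le_power2 side[of 1 0]] by simp
    have d: "0 \<le> d" "d\<^sup>2 = 2 * \<kappa> r'" using \<kappa>0 by (simp_all add: d_def)
    have sided: "\<bar>\<phi> (?x s r' m) - \<phi> (?x s r' m')\<bar> \<le> d" if "\<bar>m\<bar> \<le> 1" "\<bar>m'\<bar> \<le> 1" for s m m'
      using real_sqrt_le_mono[OF side[OF that]] by (simp add: d_def)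
    have corners: "?x (False, True) r' 1 = ?x (False, False) r' 1"
      "?x (True, False) r' (-1) = ?x (False, True) r' (-1)"
      "?x (True, True) r' (-1) = ?x (False, False) r' (-1)"
      by (simp_all add: sector_def vec_eq_iff forall_2)
    have "\<bar>m\<bar> \<le> 1" using m by auto
    then have "\<bar>\<phi> (?x s r' m) - k\<bar> \<le> 2 * d"
      using sided[of m 1 "(False, False)"] sided[of m 1 "(False, True)"]
        sided[of m "-1" "(True, False)"] sided[of "-1" 1 "(False, True)"]
        sided[of m "-1" "(True, True)"] sided[of "-1" 1 "(False, False)"]
      unfolding k_def corners by (cases s; cases "fst s"; cases "snd s") (auto simp: abs_le_iff)
    then have "(\<phi> (?x s r' m) - k)\<^sup>2 \<le> (2 * d)\<^sup>2"
      using d(1) by (metis abs_ge_zero power2_abs power_mono)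
    also have "\<dots> = 8 * \<kappa> r'" using d(2) by (simp add: power_mult_distrib)
    also have "\<dots> \<le> 8 * (E / L)" using \<kappa>L L by (simp add: field_simps)
    finally show ?thesis .
  qed

  \<comment> \<open>The coefficient from \<open>radial_bound\<close>; the constant 12 below is 3/2
    times the 8 from \<open>slice\<close>.\<close>
  define B where "B = 12 * \<rho> + 3 * \<eta> * L"
  have bound: "r * (\<phi> (?x s r m) - k)\<^sup>2 \<le> B * e s m + 12 * (E / L)"
    if r: "r \<in> {0..1/2}" and m: "m \<in> {-1..1}" for s r m
  proof -
    have m2: "m\<^sup>2 \<le> 1" using m by (simp add: abs_square_le_1 abs_le_iff)
    have "r * (\<phi> (?x s r m) - k)\<^sup>2 \<le> (12 * \<rho> + 3 * \<eta> * ln ((1/2 - \<rho>) / \<rho>)) * integral {0..1/2} (\<lambda>r. r * c (?x s r m))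
        + 3/2 * (\<phi> (?x s r' m) - k)\<^sup>2"
    proof (rule radial_bound[OF \<rho> \<eta> gr _ _ _ _ r r'])
      show "continuous_on {0..1/2} (\<lambda>r. c (?x s r m))" by (intro cont_cx continuous_intros)
      show "(D (?x s r m) \<bullet> sector s m)\<^sup>2 \<le> 2 * c (?x s r m)" for r
      proof -
        have "(D (?x s r m) \<bullet> sector s m)\<^sup>2 \<le> (1 + m\<^sup>2) * c (?x s r m)"
          using full[of "?x s r m" "sector s m"] by (simp add: norm_sector)
        also have "\<dots> \<le> 2 * c (?x s r m)" using m2 c0 by (intro mult_right_mono) auto
        finally show ?thesis .
      qed
      show "(D (?x s r m) \<bullet> sector s m)\<^sup>2 \<le> 2 * \<eta> * c (?x s r m)" if "r \<in> {\<rho>..1/2 - \<rho>}" for r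
      proof -
        have r0: "0 < r" using that \<rho> by auto
        have n1: "1 \<le> norm (sector s m)"
          by (rule power2_le_imp_le) (simp_all add: norm_sector)
        have rho_r: "\<rho> \<le> r" using that by auto
        have "r * 1 \<le> r * norm (sector s m)"
          using n1 r0 by (intro mult_left_mono) auto
        then have "\<rho> \<le> r * norm (sector s m)"
          using rho_r by linarith
        then have "\<rho> \<le> norm (r *\<^sub>R sector s m)"
          using r0 by simp
        moreover have "\<bar>(r *\<^sub>R sector s m) $ i\<bar> \<le> 1/2 - \<rho>" for i
        proof -
          have "\<bar>(r *\<^sub>R sector s m) $ i\<bar> = r * \<bar>sector s m $ i\<bar>" using r0 by (simp add: abs_mult)
          also have "\<dots> \<le> r * 1" using abs_sector_nth[of m s i] m r0 by (intro mult_left_mono) auto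
          finally show ?thesis using that by auto
        qed
        ultimately have "(D (?x s r m) \<bullet> (r *\<^sub>R sector s m))\<^sup>2 \<le> (norm (r *\<^sub>R sector s m))\<^sup>2 * (\<eta> * c (?x s r m))"
          by (rule radial)
        then have "r\<^sup>2 * (D (?x s r m) \<bullet> sector s m)\<^sup>2 \<le> r\<^sup>2 * ((1 + m\<^sup>2) * (\<eta> * c (?x s r m)))"
          by (simp add: power_mult_distrib norm_sector)
        then have "(D (?x s r m) \<bullet> sector s m)\<^sup>2 \<le> (1 + m\<^sup>2) * (\<eta> * c (?x s r m))"
          using r0 by simp
        also have "\<dots> \<le> 2 * (\<eta> * c (?x s r m))" using m2 \<eta> c0 by (intro mult_right_mono) auto
        finally show ?thesis by simp
      qed
    qed (use c0 in auto)
    also have "\<dots> \<le> B * e s m + 12 * (E / L)"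
      using slice[OF m, of s] unfolding B_def e_def L_def by linarith
    finally show ?thesis .
  qed

  have cont_\<phi>: "continuous_on UNIV \<phi>"
    by (intro continuous_at_imp_continuous_on ballI has_derivative_continuous[OF \<phi>])
  have cont_\<phi>x: "continuous_on A (\<lambda>p. \<phi> (?x s (f p) (h p)))"
    if "continuous_on A f" "continuous_on A h" for f h :: "'a::topological_space \<Rightarrow> real" and A s
    by (rule continuous_on_compose2[OF cont_\<phi>]) (auto intro!: continuous_intros that)
  have "(LINT x:cell|lborel. (\<phi> x - k)\<^sup>2) =
    (\<Sum>s\<in>UNIV. integral {-1..1} (\<lambda>m. integral {0..1/2} (\<lambda>r. r * (\<phi> (?x s r m) - k)\<^sup>2)))"
    by (rule set_integral_cell) (auto intro!: continuous_intros cont_\<phi>)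
  also have "\<dots> \<le> (\<Sum>s\<in>UNIV. integral {-1..1} (\<lambda>m. 1/2 * (B * e s m + 12 * (E / L))))"
  proof (intro sum_mono integral_le)
    fix s :: "bool \<times> bool"
    have "continuous_on (cbox (-1) 1) (\<lambda>m. integral (cbox 0 (1/2)) (\<lambda>r. r * (\<phi> (?x s r m) - k)\<^sup>2))"
      by (rule integral_continuous_on_param) (auto simp: case_prod_beta' intro!: continuous_intros cont_\<phi>x)
    then show "(\<lambda>m. integral {0..1/2} (\<lambda>r. r * (\<phi> (?x s r m) - k)\<^sup>2)) integrable_on {-1..1}"
      using integrable_continuous_interval by (simp add: cbox_interval)
    show "(\<lambda>m. 1/2 * (B * e s m + 12 * (E / L))) integrable_on {-1..1}"
      by (intro integrable_continuous_interval continuous_intros cont_e)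
    fix m :: real assume m: "m \<in> {-1..1}"
    have "integral {0..1/2} (\<lambda>r. r * (\<phi> (?x s r m) - k)\<^sup>2) \<le> integral {0..1/2 :: real} (\<lambda>r. B * e s m + 12 * (E / L))"
      by (intro integral_le integrable_continuous_interval continuous_intros cont_\<phi>x bound m)
    then show "integral {0..1/2} (\<lambda>r. r * (\<phi> (?x s r m) - k)\<^sup>2) \<le> 1/2 * (B * e s m + 12 * (E / L))"
      by simp
  qed
  \<comment> \<open>The radial interval has length 1/2 and the slope interval length 2: B is halved,
    12 E / L stays, and the four sectors give 48 E / L.\<close>
  also have "\<dots> = (\<Sum>s\<in>UNIV. B / 2 * integral {-1..1} (e s) + 12 * (E / L))"
  proof (rule sum.cong[OF refl])
    fix s :: "bool \<times> bool"
    have "((\<lambda>m. B / 2 * e s m + 6 * (E / L)) has_integral (B / 2 * integral {-1..1} (e s) + 12 * (E / L))) {-1..1}"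
    proof (rule has_integral_add[OF has_integral_mult_right])
      show "(e s has_integral integral {-1..1} (e s)) {-1..1}"
        by (intro integrable_integral integrable_continuous_interval cont_e)
      show "((\<lambda>m. 6 * (E / L)) has_integral 12 * (E / L)) {-1..1::real}"
        using has_integral_const_real[of "6 * (E / L)" "-1" 1] by simp
    qed
    then show "integral {-1..1} (\<lambda>m. 1/2 * (B * e s m + 12 * (E / L))) = B / 2 * integral {-1..1} (e s) + 12 * (E / L)"
      by (intro integral_unique) (simp add: algebra_simps)
  qed
  also have "\<dots> = B / 2 * E + 48 * (E / L)"
    unfolding E sum.distrib sum_distrib_left[symmetric] by simp
  also have "\<dots> = (6 * \<rho> + 3/2 * \<eta> * L + 48 / L) * E"
    by (simp add: B_def algebra_simps add_divide_distrib)
  finally show thesis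
    unfolding E_def L_def by (rule that)
qed

section \<open>Approximation of periodic Sobolev functions by trigonometric polynomials\<close>

text \<open>As a measure in its own right the cell has mass 1, so constants are integrable and mean
  values are integrals.\<close>

abbreviation cellM :: "(real^2) measure" where
  "cellM \<equiv> restrict_space lborel cell"

lemma cell_vector: "vector [a, b] \<in> cell \<longleftrightarrow> a \<in> {0..1} \<and> b \<in> {0..1}"
  by (auto simp: cell_def forall_2)

lemma space_cellM [simp]: "space cellM = cell"
  by (simp add: space_restrict_space)

lemma measurable_cellM: "f \<in> borel_measurable borel \<Longrightarrow> f \<in> borel_measurable cellM"
  by (rule measurable_restrict_space1) simp

lemma nn_integral_cellM: "(\<integral>\<^sup>+x. f x \<partial>cellM) = (\<integral>\<^sup>+x. f x * indicator cell x \<partial>lborel)"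
  by (simp add: nn_integral_restrict_space)

lemma nn_integral_cellM_prod:
  assumes [measurable]: "f \<in> borel_measurable borel" "g \<in> borel_measurable borel"
  shows "(\<integral>\<^sup>+x. f (x $ 1) * g (x $ 2) \<partial>cellM) =
    (\<integral>\<^sup>+a. f a * indicator {0..1} a \<partial>lborel) * (\<integral>\<^sup>+b. g b * indicator {0..1} b \<partial>lborel)"
proof -
  have nth [measurable]: "(\<lambda>x::real^2. x $ i) \<in> borel_measurable borel" for i
    by (intro borel_measurable_continuous_onI continuous_intros)
  have "(\<integral>\<^sup>+x. f (x $ 1) * g (x $ 2) \<partial>cellM)
      = (\<integral>\<^sup>+a. \<integral>\<^sup>+b. f a * g b * indicator cell (vector [a, b]) \<partial>lborel \<partial>lborel)"
    unfolding nn_integral_cellM by (subst nn_integral_real2) simp_all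
  also have "\<dots> = (\<integral>\<^sup>+a. \<integral>\<^sup>+b. (f a * indicator {0..1} a) * (g b * indicator {0..1} b) \<partial>lborel \<partial>lborel)"
    by (intro nn_integral_cong) (auto simp: indicator_def cell_vector)
  also have "\<dots> = (\<integral>\<^sup>+a. (f a * indicator {0..1} a) * (\<integral>\<^sup>+b. g b * indicator {0..1} b \<partial>lborel) \<partial>lborel)"
    by (simp add: nn_integral_cmult)
  also have "\<dots> = (\<integral>\<^sup>+a. f a * indicator {0..1} a \<partial>lborel) * (\<integral>\<^sup>+b. g b * indicator {0..1} b \<partial>lborel)"
    by (simp add: nn_integral_multc)
  finally show ?thesis .
qed

lemma emeasure_cellM: "emeasure cellM cell = 1"
proof -
  have "emeasure cellM cell = (\<integral>\<^sup>+x. 1 * 1 \<partial>cellM)"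
    by simp
  also have "\<dots> = 1"
    by (subst nn_integral_cellM_prod[of "\<lambda>_. 1" "\<lambda>_. 1"]) simp_all
  finally show ?thesis .
qed

lemma measure_cellM [simp]: "measure cellM cell = 1"
  by (simp add: measure_def emeasure_cellM)

interpretation cell: finite_measure cellM
  by standard (simp add: emeasure_cellM)

lemma cell_pair: "pair_sigma_finite cellM cellM"
  by standard

lemma set_integrable_cell:
  fixes f :: "real^2 \<Rightarrow> real"
  shows "set_integrable lborel cell f \<longleftrightarrow> integrable cellM f"
  unfolding set_integrable_def by (rule integrable_restrict_space[symmetric]) simp

lemma set_integral_cellM:
  fixes f :: "real^2 \<Rightarrow> real"
  shows "(LINT x:cell|lborel. f x) = (\<integral>x. f x \<partial>cellM)"
  unfolding set_lebesgue_integral_def by (rule integral_restrict_space[symmetric]) simp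

lemma bounded_on_cell:
  fixes b :: "real^2 \<Rightarrow> real"
  assumes "continuous_on UNIV b"
  obtains B where "0 < B" "\<And>x. x \<in> cell \<Longrightarrow> \<bar>b x\<bar> \<le> B"
proof -
  have "bounded (b ` cell)"
    using compact_continuous_image[OF continuous_on_subset[OF assms] compact_cell] by (simp add: compact_imp_bounded)
  then obtain B where "0 < B" "\<And>x. x \<in> cell \<Longrightarrow> norm (b x) \<le> B"
    unfolding bounded_pos by auto
  then show thesis by (intro that[of B]) auto
qed

lemma integrable_continuous_mult_L2:
  fixes u b :: "real^2 \<Rightarrow> real"
  assumes u: "u \<in> borel_measurable borel" "integrable cellM (\<lambda>x. (u x)\<^sup>2)" and b: "continuous_on UNIV b"
  shows "integrable cellM (\<lambda>x. b x * u x)"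
proof -
  obtain B where B: "0 < B" "\<And>x. x \<in> cell \<Longrightarrow> \<bar>b x\<bar> \<le> B"
    using bounded_on_cell[OF b] by blast
  have "integrable cellM (\<lambda>x. B * (1 + (u x)\<^sup>2))"
    using u(2) by simp
  then show ?thesis
  proof (rule Bochner_Integration.integrable_bound)
    show "(\<lambda>x. b x * u x) \<in> borel_measurable cellM"
      using u(1) borel_measurable_continuous_onI[OF b] by (intro measurable_cellM) simp
    have "norm (b x * u x) \<le> norm (B * (1 + (u x)\<^sup>2))" if "x \<in> cell" for x
    proof -
      have "\<bar>u x\<bar> \<le> 1 + (u x)\<^sup>2"
        using zero_le_power2[of "\<bar>u x\<bar> - 1"] by (simp add: power2_diff abs_if split: if_splits)
      then have "\<bar>b x\<bar> * \<bar>u x\<bar> \<le> B * (1 + (u x)\<^sup>2)"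
        using B that by (intro mult_mono) auto
      then show ?thesis using B by (simp add: abs_mult add_nonneg_nonneg)
    qed
    then show "AE x in cellM. norm (b x * u x) \<le> norm (B * (1 + (u x)\<^sup>2))"
      by (intro AE_I2) simp
  qed
qed

lemma integrable_L2:
  fixes u :: "real^2 \<Rightarrow> real"
  assumes u: "u \<in> borel_measurable borel" "integrable cellM (\<lambda>x. (u x)\<^sup>2)"
  shows "integrable cellM u"
  using integrable_continuous_mult_L2[OF u, of "\<lambda>_. 1"] by simp

lemma integrable_continuous_cellM:
  fixes b :: "real^2 \<Rightarrow> real"
  shows "continuous_on UNIV b \<Longrightarrow> integrable cellM b"
  using integrable_continuous_mult_L2[of "\<lambda>_. 1" b] by simp

lemma integrable_diff_sq:
  fixes u v :: "real^2 \<Rightarrow> real"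
  assumes u: "u \<in> borel_measurable borel" "integrable cellM (\<lambda>x. (u x)\<^sup>2)"
    and v: "v \<in> borel_measurable borel" "integrable cellM (\<lambda>x. (v x)\<^sup>2)"
  shows "integrable cellM (\<lambda>x. (u x - v x)\<^sup>2)"
proof -
  have "integrable cellM (\<lambda>x. 2 * (u x)\<^sup>2 + 2 * (v x)\<^sup>2)"
    using u(2) v(2) by simp
  then show ?thesis
  proof (rule Bochner_Integration.integrable_bound)
    show "(\<lambda>x. (u x - v x)\<^sup>2) \<in> borel_measurable cellM"
      using u(1) v(1) by (intro measurable_cellM) simp
    have le: "(u x - v x)\<^sup>2 \<le> 2 * (u x)\<^sup>2 + 2 * (v x)\<^sup>2" for x
      using zero_le_power2[of "u x + v x"] by (simp add: power2_eq_square algebra_simps)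
    have "norm ((u x - v x)\<^sup>2) \<le> norm (2 * (u x)\<^sup>2 + 2 * (v x)\<^sup>2)" for x
      unfolding real_norm_def abs_power2 by (rule order_trans[OF le abs_ge_self])
    then show "AE x in cellM. norm ((u x - v x)\<^sup>2) \<le> norm (2 * (u x)\<^sup>2 + 2 * (v x)\<^sup>2)" by simp
  qed
qed

lemma diff_sq_le3: "(x - w)\<^sup>2 \<le> 3 * ((x - y)\<^sup>2 + (y - z)\<^sup>2 + (z - w)\<^sup>2)" for x y z w :: real
proof -
  have "(a + b + c)\<^sup>2 \<le> 3 * (a\<^sup>2 + b\<^sup>2 + c\<^sup>2)" for a b c :: real
    using zero_le_power2[of "a - b"] zero_le_power2[of "b - c"] zero_le_power2[of "a - c"]
    by (simp add: power2_eq_square algebra_simps)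
  from this[of "x - y" "y - z" "z - w"] show ?thesis by simp
qed

subsection \<open>Density of continuous functions\<close>

lemma clip_tendsto: "((\<lambda>n. max (- real n) (min (real n) x)) \<longlongrightarrow> x) sequentially"
proof (rule tendsto_eventually)
  obtain N :: nat where N: "\<bar>x\<bar> \<le> real N" using real_arch_simple by blast
  have "max (- real n) (min (real n) x) = x" if "N \<le> n" for n
    using N that by (auto simp: max_def min_def abs_le_iff)
  then show "\<forall>\<^sub>F n in sequentially. max (- real n) (min (real n) x) = x"
    by (auto simp: eventually_sequentially)
qed

text \<open>Truncation makes the function bounded; a bounded measurable function is an almost
  everywhere limit of continuous ones, which may be truncated at the same level. Both steps are
  dominated. The uniform bound \<open>B\<close> is kept because the convolutions of \<open>g\<close>
  must be dominated as well.\<close>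

lemma continuous_dense_L2:
  fixes u :: "real^2 \<Rightarrow> real"
  assumes u: "u \<in> borel_measurable borel" "integrable cellM (\<lambda>x. (u x)\<^sup>2)" and \<delta>: "0 < \<delta>"
  obtains g B where "continuous_on UNIV g" "\<And>x. \<bar>g x\<bar> \<le> B" "(\<integral>x. (u x - g x)\<^sup>2 \<partial>cellM) < \<delta>"
proof -
  define v where "v n x = max (- real n) (min (real n) (u x))" for n :: nat and x
  have mv: "v n \<in> borel_measurable borel" for n
    using u(1) unfolding v_def by simp
  have "(\<lambda>n. \<integral>x. (u x - v n x)\<^sup>2 \<partial>cellM) \<longlonglongrightarrow> (\<integral>x. 0 \<partial>cellM)"
  proof (rule integral_dominated_convergence[where w = "\<lambda>x. (u x)\<^sup>2"])
    have "(\<lambda>n. (u x - v n x)\<^sup>2) \<longlonglongrightarrow> (u x - u x)\<^sup>2" for x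
      unfolding v_def by (intro tendsto_intros clip_tendsto)
    then show "AE x in cellM. (\<lambda>n. (u x - v n x)\<^sup>2) \<longlonglongrightarrow> 0" by simp
    have "\<bar>u x - v n x\<bar> \<le> \<bar>u x\<bar>" for n x
      by (auto simp: v_def max_def min_def abs_if)
    then show "AE x in cellM. norm ((u x - v n x)\<^sup>2) \<le> (u x)\<^sup>2" for n
      by (simp add: abs_le_square_iff)
    show "(\<lambda>x. (u x - v n x)\<^sup>2) \<in> borel_measurable cellM" for n
      using u(1) mv[of n] by (intro measurable_cellM) simp
  qed (use u in auto)
  then have "\<forall>\<^sub>F n in sequentially. (\<integral>x. (u x - v n x)\<^sup>2 \<partial>cellM) < \<delta> / 4"
    using \<delta> by (intro order_tendstoD(2)[of _ 0]) auto
  then obtain n where n: "(\<integral>x. (u x - v n x)\<^sup>2 \<partial>cellM) < \<delta> / 4"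
    by (auto simp: eventually_sequentially)
  have vB: "\<bar>v n x\<bar> \<le> real n" for x
    by (auto simp: v_def)
  have "v n measurable_on UNIV"
    using mv by (intro lebesgue_measurable_imp_measurable_on_real) (auto intro: measurable_completion)
  then obtain N f where N: "negligible N" and f: "\<And>k. continuous_on UNIV (f k)"
    and lim: "\<And>x. x \<notin> N \<Longrightarrow> (\<lambda>k. f k x) \<longlonglongrightarrow> v n x"
    unfolding measurable_on_def by auto
  define g where "g k x = max (- real n) (min (real n) (f k x))" for k x
  have g: "continuous_on UNIV (g k)" for k
    unfolding g_def by (intro continuous_intros f)
  have gB: "\<bar>g k x\<bar> \<le> real n" for k x
    by (auto simp: g_def)
  have "AE x in lebesgue. x \<notin> N"
    using N by (intro AE_not_in) (simp add: negligible_iff_null_sets)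
  then have "AE x in lborel. x \<notin> N"
    by (simp add: AE_completion_iff)
  then have AE_N: "AE x in cellM. x \<notin> N"
    by (simp add: AE_restrict_space_iff) (elim eventually_mono, simp)
  have "(\<lambda>k. \<integral>x. (v n x - g k x)\<^sup>2 \<partial>cellM) \<longlonglongrightarrow> (\<integral>x. 0 \<partial>cellM)"
  proof (rule integral_dominated_convergence[where w = "\<lambda>x. (2 * real n)\<^sup>2"])
    show "AE x in cellM. (\<lambda>k. (v n x - g k x)\<^sup>2) \<longlonglongrightarrow> 0"
      using AE_N
    proof eventually_elim
      case (elim x)
      have "(\<lambda>k. (v n x - g k x)\<^sup>2) \<longlonglongrightarrow> (v n x - max (- real n) (min (real n) (v n x)))\<^sup>2"
        unfolding g_def by (intro tendsto_intros lim[OF elim])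
      moreover have "max (- real n) (min (real n) (v n x)) = v n x"
        using vB[of x] by (auto simp: max_def min_def abs_le_iff)
      ultimately show ?case by simp
    qed
    have "\<bar>v n x - g k x\<bar> \<le> \<bar>2 * real n\<bar>" for k x
      using vB[of x] gB[of k x] by linarith
    then show "AE x in cellM. norm ((v n x - g k x)\<^sup>2) \<le> (2 * real n)\<^sup>2" for k
      unfolding real_norm_def abs_power2 abs_le_square_iff by (intro AE_I2)
    show "(\<lambda>x. (v n x - g k x)\<^sup>2) \<in> borel_measurable cellM" for k
      using mv borel_measurable_continuous_onI[OF g] by (intro measurable_cellM) simp
  qed auto
  then have "\<forall>\<^sub>F k in sequentially. (\<integral>x. (v n x - g k x)\<^sup>2 \<partial>cellM) < \<delta> / 4"
    using \<delta> by (intro order_tendstoD(2)[of _ 0]) auto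
  then obtain k where k: "(\<integral>x. (v n x - g k x)\<^sup>2 \<partial>cellM) < \<delta> / 4"
    by (auto simp: eventually_sequentially)
  have mg: "g k \<in> borel_measurable borel"
    by (rule borel_measurable_continuous_onI[OF g])
  have iv: "integrable cellM (\<lambda>x. (v n x)\<^sup>2)"
    by (rule cell.integrable_const_bound[of _ "(real n)\<^sup>2"])
      (use vB mv in \<open>auto simp: abs_le_square_iff[symmetric] intro!: measurable_cellM\<close>)
  have ig: "integrable cellM (\<lambda>x. (g k x)\<^sup>2)"
    by (rule integrable_continuous_cellM) (intro continuous_intros g)
  have "(\<integral>x. (u x - g k x)\<^sup>2 \<partial>cellM) \<le> (\<integral>x. 2 * (u x - v n x)\<^sup>2 + 2 * (v n x - g k x)\<^sup>2 \<partial>cellM)"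
  proof (rule integral_mono)
    show "integrable cellM (\<lambda>x. (u x - g k x)\<^sup>2)"
      by (rule integrable_diff_sq[OF u mg ig])
    show "integrable cellM (\<lambda>x. 2 * (u x - v n x)\<^sup>2 + 2 * (v n x - g k x)\<^sup>2)"
      using integrable_diff_sq[OF u mv iv] integrable_diff_sq[OF mv iv mg ig] by simp
    show "(u x - g k x)\<^sup>2 \<le> 2 * (u x - v n x)\<^sup>2 + 2 * (v n x - g k x)\<^sup>2" for x
      using zero_le_power2[of "(u x - v n x) - (v n x - g k x)"] by (simp add: power2_eq_square algebra_simps)
  qed
  also have "\<dots> = 2 * (\<integral>x. (u x - v n x)\<^sup>2 \<partial>cellM) + 2 * (\<integral>x. (v n x - g k x)\<^sup>2 \<partial>cellM)"
    using integrable_diff_sq[OF u mv iv] integrable_diff_sq[OF mv iv mg ig] by simp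
  also have "\<dots> < \<delta>" using n k by simp
  finally show thesis using g gB by (intro that)
qed

subsection \<open>The kernel\<close>

definition knorm :: "nat \<Rightarrow> real" where
  "knorm N = integral {0..1} (\<lambda>s. cos (pi * s) ^ (2 * N))"

text \<open>Inserting a factor sin (pi s) on half the interval makes the integrand an exact
  derivative. The resulting bound is only polynomial in N, which suffices against the geometric
  decay of the kernel away from the origin.\<close>

lemma knorm_lower: "1 / (pi * (1 + real (2 * N))) \<le> knorm N"
proof -
  have int: "((\<lambda>s. cos (pi * s) ^ (2 * N) * sin (pi * s)) has_integral
      (- (cos (pi * (1/2)) ^ Suc (2 * N) / (pi * (1 + real (2 * N)))) - - (cos (pi * 0) ^ Suc (2 * N) / (pi * (1 + real (2 * N)))))) {0..1/2}"
  proof (rule fundamental_theorem_of_calculus)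
    fix s :: real
    have "((\<lambda>s. cos (pi * s)) has_real_derivative (- sin (pi * s) * pi)) (at s within {0..1/2})"
      by (auto intro!: derivative_eq_intros)
    note DERIV_minus[OF DERIV_cdivide[OF DERIV_power_Suc[OF this, of "2 * N"], of "pi * (1 + real (2 * N))"]]
    moreover have eq: "- (c * ((- a * pi) * b) / (pi * c)) = b * a" if "0 < c" for a b c :: real
      using that by (simp add: field_simps)
    have "- ((1 + real (2 * N)) * ((- sin (pi * s) * pi) * cos (pi * s) ^ (2 * N)) / (pi * (1 + real (2 * N))))
        = cos (pi * s) ^ (2 * N) * sin (pi * s)"
      by (rule eq) simp
    ultimately show "((\<lambda>s. - (cos (pi * s) ^ Suc (2 * N) / (pi * (1 + real (2 * N))))) has_vector_derivative
       cos (pi * s) ^ (2 * N) * sin (pi * s)) (at s within {0..1/2})"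
      unfolding has_real_derivative_iff_has_vector_derivative[symmetric] by metis
  qed simp
  have int': "((\<lambda>s. cos (pi * s) ^ (2 * N)) has_integral integral {0..1/2} (\<lambda>s. cos (pi * s) ^ (2 * N))) {0..1/2}"
    by (intro integrable_integral integrable_continuous_interval continuous_intros)
  have "cos (pi * (1/2)) ^ Suc (2 * N) = 0" by simp
  with has_integral_le[OF int int']
  have "1 / (pi * (1 + real (2 * N))) \<le> integral {0..1/2} (\<lambda>s. cos (pi * s) ^ (2 * N))"
    by (simp add: mult_left_le)
  also have "\<dots> \<le> knorm N"
    unfolding knorm_def
    by (intro integral_subset_le integrable_continuous_interval continuous_intros) (auto simp: power_mult)
  finally show ?thesis .
qed

lemma knorm_pos: "0 < knorm N"
proof -
  have "0 < 1 / (pi * (1 + real (2 * N)))"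
    by (intro divide_pos_pos mult_pos_pos) auto
  then show ?thesis using knorm_lower[of N] by (rule less_le_trans)
qed

text \<open>The de la Vallee Poussin kernel with period 1. It is nonnegative with integral 1, and as
  a trigonometric polynomial it makes convolutions finite sums of smooth functions.\<close>

definition kern1 :: "nat \<Rightarrow> real \<Rightarrow> real" where
  "kern1 N s = cos (pi * s) ^ (2 * N) / knorm N"

lemma kern1_nonneg: "0 \<le> kern1 N s"
  using knorm_pos[of N] by (simp add: kern1_def power_mult)

lemma kern1_minus: "kern1 N (- s) = kern1 N s"
  by (simp add: kern1_def)

lemma kern1_add_Ints:
  assumes "k \<in> \<int>"
  shows "kern1 N (s + k) = kern1 N s"
proof -
  obtain n where n: "k = of_int n" using assms by (auto elim: Ints_cases)
  have s: "sin (pi * of_int n) = 0"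
    by (simp add: sin_zero_iff_int2 mult.commute[of pi "of_int n"])
  then have "(cos (pi * of_int n))\<^sup>2 = 1"
    by (simp add: cos_squared_eq)
  then have "(cos (pi * (s + k)))\<^sup>2 = (cos (pi * s))\<^sup>2"
    by (simp add: n distrib_left cos_add s power_mult_distrib)
  then show ?thesis by (simp add: kern1_def power_mult)
qed

lemma continuous_on_kern1 [continuous_intros]:
  fixes f :: "'a::t2_space \<Rightarrow> real"
  shows "continuous_on A f \<Longrightarrow> continuous_on A (\<lambda>x. kern1 N (f x))"
  unfolding kern1_def divide_inverse by (auto intro!: continuous_intros)

lemma integral_shift_real:
  fixes f :: "real \<Rightarrow> real"
  shows "integral {a..b} (\<lambda>x. f (x + c)) = integral {a + c..b + c} f"
  using integral_shift_Icc_real[of a b f c] by (simp add: o_def add.commute)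

lemma integral_periodic:
  fixes f :: "real \<Rightarrow> real"
  assumes T: "0 < T" and f: "continuous_on UNIV f" and per: "\<And>s k. f (s + T * of_int k) = f s"
  shows "integral {a..a + T} f = integral {0..T} f"
proof -
  have i: "f integrable_on {x..y}" for x y
    using f continuous_on_subset integrable_continuous_interval by blast
  \<comment> \<open>The interval of length T contains the multiple T n of the period; the part to
    its left is moved to the right end.\<close>
  define n where "n = \<lceil>a / T\<rceil>"
  have "a / T \<le> of_int n" "of_int n \<le> a / T + 1" unfolding n_def by linarith+
  then have n: "a \<le> T * of_int n" "T * of_int n \<le> a + T"
    using T by (simp_all add: field_simps)
  have shift: "integral {x..y} f = integral {x + T * of_int k..y + T * of_int k} f" for x y k
    using integral_shift_real[of x y f "T * of_int k"] by (simp add: per)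
  have "integral {a..a + T} f = integral {a..T * of_int n} f + integral {T * of_int n..a + T} f"
    using n i by (intro Henstock_Kurzweil_Integration.integral_combine[symmetric]) auto
  also have "integral {a..T * of_int n} f = integral {a + T..T * of_int n + T} f"
    using shift[of a "T * of_int n" 1] by simp
  also have "\<dots> + integral {T * of_int n..a + T} f = integral {T * of_int n..T * of_int n + T} f"
    using n i T by (subst add.commute, intro Henstock_Kurzweil_Integration.integral_combine) auto
  also have "\<dots> = integral {0..T} f"
    using shift[of 0 T n] by (simp add: add.commute)
  finally show ?thesis .
qed

lemma integral_kern1: "integral {a..a + 1} (kern1 N) = 1"
proof -
  have "integral {a..a + 1} (kern1 N) = integral {0..1} (kern1 N)"
    using continuous_on_kern1[OF continuous_on_id, of UNIV N]
    by (intro integral_periodic) (simp_all add: kern1_add_Ints)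
  also have "\<dots> = 1"
    using knorm_pos[of N] unfolding kern1_def[abs_def] by (simp add: knorm_def)
  finally show ?thesis .
qed

lemma nn_integral_kern1: "(\<integral>\<^sup>+y. ennreal (kern1 N (x - y)) * indicator {0..1} y \<partial>lborel) = 1"
proof -
  have c: "continuous_on A (kern1 N)" for A
    using continuous_on_kern1[OF continuous_on_id] by simp
  have "(\<integral>\<^sup>+y. ennreal (kern1 N (x - y)) * indicator {0..1} y \<partial>lborel) = ennreal (integral {0..1} (\<lambda>y. kern1 N (x - y)))"
    by (intro nn_integral_eq_integral_Icc continuous_intros kern1_nonneg)
  also have "integral {0..1} (\<lambda>y. kern1 N (x - y)) = integral {0..1} (\<lambda>y. kern1 N (y + - x))"
    by (rule integral_cong) (metis kern1_minus minus_diff_eq diff_conv_add_uminus)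
  also have "\<dots> = integral {0 + - x..1 + - x} (kern1 N)"
    by (rule integral_shift_real)
  also have "\<dots> = 1"
    using integral_kern1[of "- x" N] by (simp add: add.commute)
  finally show ?thesis by (simp only: ennreal_1)
qed

definition kern :: "nat \<Rightarrow> real^2 \<Rightarrow> real" where
  "kern N z = kern1 N (z $ 1) * kern1 N (z $ 2)"

lemma kern_nonneg: "0 \<le> kern N z"
  by (simp add: kern_def kern1_nonneg)

lemma kern_minus: "kern N (x - y) = kern N (y - x)"
  using kern1_minus[of N "x $ 1 - y $ 1"] kern1_minus[of N "x $ 2 - y $ 2"] by (simp add: kern_def)

lemma smooth_kern: "smooth f \<Longrightarrow> smooth (\<lambda>x. kern N (f x))"
  unfolding kern_def kern1_def divide_inverse by (intro smooth_intros)

lemma continuous_on_kern [continuous_intros]: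
  fixes f :: "'a::t2_space \<Rightarrow> real^2"
  shows "continuous_on A f \<Longrightarrow> continuous_on A (\<lambda>x. kern N (f x))"
  unfolding kern_def by (intro continuous_intros)

lemma kern_periodic: "k \<in> lattice \<Longrightarrow> kern N (z + k) = kern N z"
  by (simp add: kern_def lattice_def kern1_add_Ints)

lemma nn_integral_kern: "(\<integral>\<^sup>+y. ennreal (kern N (x - y)) \<partial>cellM) = 1"
proof -
  have m: "(\<lambda>y. ennreal (kern1 N (a - y))) \<in> borel_measurable borel" for a
    by (intro measurable_compose[OF _ measurable_ennreal] borel_measurable_continuous_onI continuous_intros)
  have "(\<integral>\<^sup>+y. ennreal (kern N (x - y)) \<partial>cellM) = (\<integral>\<^sup>+y. ennreal (kern1 N (x $ 1 - y $ 1)) * ennreal (kern1 N (x $ 2 - y $ 2)) \<partial>cellM)"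
    by (simp add: kern_def ennreal_mult kern1_nonneg)
  also have "\<dots> = 1"
    by (subst nn_integral_cellM_prod[OF m m]) (simp add: nn_integral_kern1)
  finally show ?thesis .
qed

lemma continuous_kern_left: "continuous_on UNIV (\<lambda>y. kern N (x - y))"
  by (intro continuous_intros)

lemma integral_kern: "(\<integral>y. kern N (x - y) \<partial>cellM) = 1"
proof -
  have "integrable cellM (\<lambda>y. kern N (x - y))"
    by (rule integrable_continuous_cellM[OF continuous_kern_left])
  from nn_integral_eq_integral[OF this] nn_integral_kern[of N x]
  show ?thesis
    by (simp add: kern_nonneg ennreal_eq_1)
qed

definition conv :: "nat \<Rightarrow> (real^2 \<Rightarrow> real) \<Rightarrow> real^2 \<Rightarrow> real" where
  "conv N u x = (\<integral>y. kern N (x - y) * u y \<partial>cellM)"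

subsection \<open>Convolution is smooth\<close>

text \<open>Finite sums of products of a function of x and one of y. The kernel belongs to this
  class by the addition theorem for the cosine, and integrating over y then only produces
  constants.\<close>

inductive separable :: "(real^2 \<Rightarrow> real^2 \<Rightarrow> real) \<Rightarrow> bool" where
  separable_mult: "smooth a \<Longrightarrow> smooth b \<Longrightarrow> separable (\<lambda>x y. a x * b y)"
| separable_add: "separable K \<Longrightarrow> separable L \<Longrightarrow> separable (\<lambda>x y. K x y + L x y)"

lemma separable_times:
  assumes "separable K" "separable L"
  shows "separable (\<lambda>x y. K x y * L x y)"
  using assms
proof (induction K)
  case (separable_mult a b)
  from separable_mult(3,1,2) show ?case
  proof (induction L)
    case (separable_mult c d)
    have "separable (\<lambda>x y. (a x * c x) * (b y * d y))"
      by (intro separable.separable_mult smooth_intros separable_mult)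
    then show ?case by (simp add: mult_ac)
  next
    case (separable_add K L)
    then show ?case by (simp add: distrib_left separable.separable_add)
  qed
next
  case (separable_add K L)
  then show ?case by (simp add: distrib_right separable.separable_add)
qed

lemma separable_power: "separable K \<Longrightarrow> separable (\<lambda>x y. K x y ^ n)"
proof (induction n)
  case 0
  have "separable (\<lambda>x y. 1 * 1)" by (intro separable_mult smooth_intros)
  then show ?case by simp
qed (simp add: separable_times)

lemma separable_kern: "separable (\<lambda>x y. kern N (x - y))"
proof -
  have sep: "separable (\<lambda>x y. cos (pi * (x $ i - y $ i)))" for i
  proof -
    have "separable (\<lambda>x y. cos (pi * x $ i) * cos (pi * y $ i) + sin (pi * x $ i) * sin (pi * y $ i))"
      by (intro separable_add separable_mult smooth_intros)
    then show ?thesis by (simp add: cos_diff right_diff_distrib)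
  qed
  have "separable (\<lambda>x y. inverse (knorm N) * 1)"
    by (intro separable_mult smooth_intros)
  then have "separable (\<lambda>x y. kern1 N (x $ i - y $ i))" for i
    using separable_times[OF separable_power[OF sep[of i], of "2 * N"]] by (simp add: kern1_def divide_inverse)
  then show ?thesis
    using separable_times by (simp add: kern_def)
qed

text \<open>For a product the integral is \<open>a\<close> times a constant, so differentiation
  never has to pass under an integral sign. The parts form one conjunction because the sum case uses
  integrability and smoothness of both summands at once.\<close>

lemma separable_integral:
  assumes "separable K" and u: "u \<in> borel_measurable borel" "integrable cellM (\<lambda>x. (u x)\<^sup>2)"
  shows "smooth (\<lambda>x. \<integral>y. K x y * u y \<partial>cellM) \<and>
    (\<forall>y. smooth (\<lambda>x. K x y)) \<and> (\<forall>x. integrable cellM (\<lambda>y. K x y * u y)) \<and>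
    (\<forall>x v. integrable cellM (\<lambda>y. frechet_derivative (\<lambda>x. K x y) (at x) v * u y)) \<and>
    (\<forall>x. ((\<lambda>x. \<integral>y. K x y * u y \<partial>cellM) has_derivative
      (\<lambda>v. \<integral>y. frechet_derivative (\<lambda>x. K x y) (at x) v * u y \<partial>cellM)) (at x))"
  using assms(1)
proof (induction K)
  case (separable_mult a b)
  have int: "integrable cellM (\<lambda>y. b y * u y)"
    by (rule integrable_continuous_mult_L2[OF u smooth_continuous_on[OF separable_mult(2)]])
  have eq: "(\<integral>y. c * b y * u y \<partial>cellM) = c * (\<integral>y. b y * u y \<partial>cellM)" for c
    by (simp add: mult.assoc)
  have fr: "frechet_derivative (\<lambda>x. a x * b y) (at x) = (\<lambda>v. frechet_derivative a (at x) v * b y)" for x y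
    by (rule frechet_derivative_at[symmetric])
      (intro has_derivative_mult_left smooth_has_derivative separable_mult)
  show ?case
    unfolding fr eq
  proof (intro conjI allI)
    show "smooth (\<lambda>x. a x * (\<integral>y. b y * u y \<partial>cellM))" by (intro smooth_intros separable_mult)
    show "smooth (\<lambda>x. a x * b y)" for y by (intro smooth_intros separable_mult)
    show "integrable cellM (\<lambda>y. a x * b y * u y)" for x using int by (simp add: mult.assoc)
    show "integrable cellM (\<lambda>y. frechet_derivative a (at x) v * b y * u y)" for x v
      using int by (simp add: mult.assoc)
    show "((\<lambda>x. a x * (\<integral>y. b y * u y \<partial>cellM)) has_derivative
        (\<lambda>v. frechet_derivative a (at x) v * (\<integral>y. b y * u y \<partial>cellM))) (at x)" for x
      by (intro has_derivative_mult_left smooth_has_derivative separable_mult)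
  qed
next
  case (separable_add K L)
  have fr: "frechet_derivative (\<lambda>x. K x y + L x y) (at x) =
      (\<lambda>v. frechet_derivative (\<lambda>x. K x y) (at x) v + frechet_derivative (\<lambda>x. L x y) (at x) v)" for x y
    by (rule frechet_derivative_at[symmetric])
      (intro has_derivative_add smooth_has_derivative; use separable_add in blast)
  have eq: "(\<integral>y. (K x y + L x y) * u y \<partial>cellM) = (\<integral>y. K x y * u y \<partial>cellM) + (\<integral>y. L x y * u y \<partial>cellM)" for x
    unfolding distrib_right using separable_add by (intro Bochner_Integration.integral_add) blast+
  have eq': "(\<integral>y. (frechet_derivative (\<lambda>x. K x y) (at x) v + frechet_derivative (\<lambda>x. L x y) (at x) v) * u y \<partial>cellM)
    = (\<integral>y. frechet_derivative (\<lambda>x. K x y) (at x) v * u y \<partial>cellM) + (\<integral>y. frechet_derivative (\<lambda>x. L x y) (at x) v * u y \<partial>cellM)" for x v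
    unfolding distrib_right using separable_add by (intro Bochner_Integration.integral_add) blast+
  show ?case
    unfolding fr eq eq'
  proof (intro conjI allI)
    show "smooth (\<lambda>x. (\<integral>y. K x y * u y \<partial>cellM) + (\<integral>y. L x y * u y \<partial>cellM))"
      by (rule smooth_add) (use separable_add in blast)+
    show "smooth (\<lambda>x. K x y + L x y)" for y
      by (rule smooth_add) (use separable_add in blast)+
    show "integrable cellM (\<lambda>y. (K x y + L x y) * u y)" for x
      unfolding distrib_right by (rule Bochner_Integration.integrable_add) (use separable_add in blast)+
    show "integrable cellM (\<lambda>y. (frechet_derivative (\<lambda>x. K x y) (at x) v + frechet_derivative (\<lambda>x. L x y) (at x) v) * u y)" for x v
      unfolding distrib_right by (rule Bochner_Integration.integrable_add) (use separable_add in blast)+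
    show "((\<lambda>x. (\<integral>y. K x y * u y \<partial>cellM) + (\<integral>y. L x y * u y \<partial>cellM)) has_derivative
        (\<lambda>v. (\<integral>y. frechet_derivative (\<lambda>x. K x y) (at x) v * u y \<partial>cellM) +
          (\<integral>y. frechet_derivative (\<lambda>x. L x y) (at x) v * u y \<partial>cellM))) (at x)" for x
      by (rule has_derivative_add) (use separable_add in blast)+
  qed
qed

lemma smooth_conv:
  assumes "u \<in> borel_measurable borel" "integrable cellM (\<lambda>x. (u x)\<^sup>2)"
  shows "smooth (conv N u)"
  using separable_integral[OF separable_kern assms] by (simp add: conv_def[abs_def])

text \<open>The derivative of \<open>kern N (x - y)\<close> in x is minus the one in y, and as a
  function of y the kernel is a smooth periodic test function, so the definition of the weak
  gradient applies to it.\<close>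

lemma grad_conv:
  assumes f: "f \<in> borel_measurable borel" "integrable cellM (\<lambda>x. (f x)\<^sup>2)" and G: "is_weak_grad f G"
  shows "grad (conv N f) x $ i = conv N (\<lambda>y. G y $ i) x"
proof -
  let ?\<psi> = "\<lambda>y. kern N (x - y)"
  have D: "(kern N has_derivative frechet_derivative (kern N) (at z)) (at z)" for z
    by (rule smooth_has_derivative[OF smooth_kern[OF smooth_ident]])
  have "frechet_derivative (\<lambda>x. kern N (x - y)) (at x) v = frechet_derivative (kern N) (at (x - y)) v" for y v
  proof -
    have "((\<lambda>x. x - y) has_derivative (\<lambda>v. v)) (at x)" by (auto intro!: derivative_eq_intros)
    from has_derivative_compose[OF this D] show ?thesis
      by (simp add: frechet_derivative_at[symmetric])
  qed
  moreover have "((\<lambda>x. \<integral>y. kern N (x - y) * f y \<partial>cellM) has_derivative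
      (\<lambda>v. \<integral>y. frechet_derivative (\<lambda>x. kern N (x - y)) (at x) v * f y \<partial>cellM)) (at x)"
    using separable_integral[OF separable_kern f] by blast
  ultimately have g: "grad (conv N f) x $ i = (\<integral>y. frechet_derivative (kern N) (at (x - y)) (axis i 1) * f y \<partial>cellM)"
    by (simp add: grad_def conv_def[abs_def] frechet_derivative_at[symmetric])
  have g\<psi>: "grad ?\<psi> y $ i = - frechet_derivative (kern N) (at (x - y)) (axis i 1)" for y
  proof -
    have "((\<lambda>y. x - y) has_derivative (\<lambda>v. - v)) (at y)" by (auto intro!: derivative_eq_intros)
    from has_derivative_compose[OF this D]
    have "frechet_derivative ?\<psi> (at y) = (\<lambda>v. frechet_derivative (kern N) (at (x - y)) (- v))"
      by (rule frechet_derivative_at[symmetric])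
    then show ?thesis
      using linear_neg[OF has_derivative_linear[OF D[of "x - y"]]] by (simp add: grad_def)
  qed
  have "smooth ?\<psi>" by (intro smooth_kern smooth_intros)
  moreover have "torus_periodic ?\<psi>"
  proof -
    have "kern N (x - (y + k)) = kern N (x - y)" if "k \<in> lattice" for y k
      using kern_periodic[OF lattice_uminus[OF that], of N "x - y"] by (simp add: algebra_simps)
    then show ?thesis by (simp add: torus_periodic_def)
  qed
  ultimately have "(LINT y:cell|lborel. f y * grad ?\<psi> y $ i) = - (LINT y:cell|lborel. G y $ i * ?\<psi> y)"
    using G unfolding is_weak_grad_def by blast
  then show ?thesis
    unfolding g conv_def set_integral_cellM g\<psi> by (simp add: mult.commute)
qed

subsection \<open>Convergence\<close>

lemma conv_sq_le:
  assumes u: "u \<in> borel_measurable borel" "integrable cellM (\<lambda>x. (u x)\<^sup>2)"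
  shows "(conv N u x)\<^sup>2 \<le> (\<integral>y. kern N (x - y) * (u y)\<^sup>2 \<partial>cellM)" "integrable cellM (\<lambda>y. kern N (x - y) * (u y)\<^sup>2)"
proof -
  let ?k = "\<lambda>y. kern N (x - y)" and ?c = "conv N u x"
  have i0: "integrable cellM ?k" by (rule integrable_continuous_cellM[OF continuous_kern_left])
  have i1: "integrable cellM (\<lambda>y. ?k y * u y)"
    by (rule integrable_continuous_mult_L2[OF u continuous_kern_left])
  obtain B where B: "0 < B" "\<And>y. y \<in> cell \<Longrightarrow> \<bar>?k y\<bar> \<le> B"
    using bounded_on_cell[OF continuous_kern_left] by blast
  show i2: "integrable cellM (\<lambda>y. ?k y * (u y)\<^sup>2)"
  proof (rule Bochner_Integration.integrable_bound[of _ "\<lambda>y. B * (u y)\<^sup>2"])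
    show "(\<lambda>y. ?k y * (u y)\<^sup>2) \<in> borel_measurable cellM"
      using u(1) borel_measurable_continuous_onI[OF continuous_kern_left] by (intro measurable_cellM) simp
    show "AE y in cellM. norm (?k y * (u y)\<^sup>2) \<le> norm (B * (u y)\<^sup>2)"
      using B by (intro AE_I2) (auto simp: abs_mult intro!: mult_right_mono)
  qed (use u in simp)
  \<comment> \<open>Jensen's inequality in the form that the variance of u under the probability
    density \<open>?k\<close> is nonnegative.\<close>
  have "0 \<le> (\<integral>y. ?k y * (u y - ?c)\<^sup>2 \<partial>cellM)"
    by (intro Bochner_Integration.integral_nonneg) (simp add: kern_nonneg)
  also have "(\<lambda>y. ?k y * (u y - ?c)\<^sup>2) = (\<lambda>y. ?k y * (u y)\<^sup>2 - (2 * ?c) * (?k y * u y) + ?c\<^sup>2 * ?k y)"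
    by (simp add: fun_eq_iff power2_eq_square algebra_simps)
  also have "(\<integral>y. ?k y * (u y)\<^sup>2 - (2 * ?c) * (?k y * u y) + ?c\<^sup>2 * ?k y \<partial>cellM)
      = (\<integral>y. ?k y * (u y)\<^sup>2 \<partial>cellM) - (2 * ?c) * (\<integral>y. ?k y * u y \<partial>cellM) + ?c\<^sup>2 * (\<integral>y. ?k y \<partial>cellM)"
    using i0 i1 i2 by simp
  also have "\<dots> = (\<integral>y. ?k y * (u y)\<^sup>2 \<partial>cellM) - ?c\<^sup>2"
    by (simp add: integral_kern conv_def[symmetric] power2_eq_square)
  finally show "?c\<^sup>2 \<le> (\<integral>y. ?k y * (u y)\<^sup>2 \<partial>cellM)" by simp
qed

text \<open>Jensen's inequality pointwise, then Tonelli; the kernel is even, so it has mass 1 in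
  either variable.\<close>

lemma conv_L2_le:
  assumes u: "u \<in> borel_measurable borel" "integrable cellM (\<lambda>x. (u x)\<^sup>2)"
  shows "(\<integral>x. (conv N u x)\<^sup>2 \<partial>cellM) \<le> (\<integral>x. (u x)\<^sup>2 \<partial>cellM)"
proof -
  interpret pair_sigma_finite cellM cellM by (rule cell_pair)
  have ic: "integrable cellM (\<lambda>x. (conv N u x)\<^sup>2)"
    by (intro integrable_continuous_cellM continuous_intros smooth_continuous_on smooth_conv u)
  have mk: "(\<lambda>p. kern N (fst p - snd p)) \<in> borel_measurable (cellM \<Otimes>\<^sub>M cellM)"
  proof -
    have "(\<lambda>p::(real^2)\<times>(real^2). kern N (fst p - snd p)) \<in> borel_measurable (borel \<Otimes>\<^sub>M borel)"
      unfolding borel_prod by (intro borel_measurable_continuous_onI continuous_intros)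
    moreover have "(\<lambda>p. p) \<in> cellM \<Otimes>\<^sub>M cellM \<rightarrow>\<^sub>M borel \<Otimes>\<^sub>M borel"
      using measurable_Pair[OF measurable_compose[OF measurable_fst measurable_cellM[of "\<lambda>x. x"]]
          measurable_compose[OF measurable_snd measurable_cellM[of "\<lambda>x. x"]]] by simp
    ultimately show ?thesis by (rule measurable_compose[rotated])
  qed
  have m: "(\<lambda>p. ennreal (kern N (fst p - snd p)) * ennreal ((u (snd p))\<^sup>2)) \<in> borel_measurable (cellM \<Otimes>\<^sub>M cellM)"
    by (intro borel_measurable_times_ennreal measurable_compose[OF _ measurable_ennreal] borel_measurable_power
        mk measurable_compose[OF measurable_snd measurable_cellM[OF u(1)]])
  have "ennreal (\<integral>x. (conv N u x)\<^sup>2 \<partial>cellM) = (\<integral>\<^sup>+x. ennreal ((conv N u x)\<^sup>2) \<partial>cellM)"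
    by (rule nn_integral_eq_integral[OF ic, symmetric]) simp
  also have "\<dots> \<le> (\<integral>\<^sup>+x. \<integral>\<^sup>+y. ennreal (kern N (x - y)) * ennreal ((u y)\<^sup>2) \<partial>cellM \<partial>cellM)"
  proof (rule nn_integral_mono)
    fix x
    have "ennreal ((conv N u x)\<^sup>2) \<le> ennreal (\<integral>y. kern N (x - y) * (u y)\<^sup>2 \<partial>cellM)"
      by (intro ennreal_leI conv_sq_le(1) u)
    also have "\<dots> = (\<integral>\<^sup>+y. ennreal (kern N (x - y) * (u y)\<^sup>2) \<partial>cellM)"
      by (rule nn_integral_eq_integral[OF conv_sq_le(2)[OF u], symmetric]) (simp add: kern_nonneg)
    finally show "ennreal ((conv N u x)\<^sup>2) \<le> (\<integral>\<^sup>+y. ennreal (kern N (x - y)) * ennreal ((u y)\<^sup>2) \<partial>cellM)"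
      by (simp add: ennreal_mult kern_nonneg)
  qed
  also have "\<dots> = (\<integral>\<^sup>+y. \<integral>\<^sup>+x. ennreal (kern N (x - y)) * ennreal ((u y)\<^sup>2) \<partial>cellM \<partial>cellM)"
    using Fubini[OF m] by simp
  also have "\<dots> = (\<integral>\<^sup>+y. ennreal ((u y)\<^sup>2) \<partial>cellM)"
  proof (rule nn_integral_cong)
    fix y
    have "(\<lambda>x. ennreal (kern N (x - y))) \<in> borel_measurable cellM"
      by (intro measurable_cellM measurable_compose[OF _ measurable_ennreal] borel_measurable_continuous_onI continuous_intros)
    then have "(\<integral>\<^sup>+x. ennreal (kern N (x - y)) * ennreal ((u y)\<^sup>2) \<partial>cellM)
        = (\<integral>\<^sup>+x. ennreal (kern N (x - y)) \<partial>cellM) * ennreal ((u y)\<^sup>2)"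
      by (rule nn_integral_multc)
    also have "\<dots> = ennreal ((u y)\<^sup>2)"
      using nn_integral_kern[of N y] by (simp add: kern_minus[of N _ y])
    finally show "(\<integral>\<^sup>+x. ennreal (kern N (x - y)) * ennreal ((u y)\<^sup>2) \<partial>cellM) = ennreal ((u y)\<^sup>2)" .
  qed
  also have "\<dots> = ennreal (\<integral>x. (u x)\<^sup>2 \<partial>cellM)"
    by (rule nn_integral_eq_integral[OF u(2)]) simp
  finally show ?thesis
    by (subst (asm) ennreal_le_iff) (auto intro!: Bochner_Integration.integral_nonneg)
qed

text \<open>Restricted to interior points because \<open>g\<close> is not assumed periodic: near the
  boundary the periodic kernel also puts mass on the opposite side of the cell, where
  \<open>g\<close> may take other values.\<close>

lemma conv_tendsto:
  assumes g: "continuous_on UNIV g" "\<And>x. \<bar>g x\<bar> \<le> B" and x: "\<And>i. 0 < x $ i" "\<And>i. x $ i < 1"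
  shows "(\<lambda>N. conv N g x) \<longlonglongrightarrow> g x"
proof (rule LIMSEQ_I)
  fix \<epsilon> :: real assume \<epsilon>: "0 < \<epsilon>"
  have B: "0 \<le> B" using g(2)[of 0] by linarith
  have "isCont g x" using g(1) by (simp add: continuous_on_eq_continuous_at)
  then obtain \<delta> where \<delta>: "0 < \<delta>" "\<And>y. dist y x < \<delta> \<Longrightarrow> dist (g y) (g x) < \<epsilon> / 2"
    unfolding continuous_at_eps_delta using \<epsilon> by (metis half_gt_zero)
  \<comment> \<open>Keeps x at distance d from the boundary. A coordinate difference of absolute
    value at least d then also stays below 1 - d, so the cosine is bounded by q < 1 at both ends of
    the period.\<close>
  define d where "d = Min {\<delta> / 2, x $ 1, x $ 2, 1 - x $ 1, 1 - x $ 2}"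
  have d: "0 < d" "d \<le> \<delta> / 2" "d \<le> x $ 1" "d \<le> x $ 2" "d \<le> 1 - x $ 1" "d \<le> 1 - x $ 2"
  proof -
    show "0 < d" using \<delta>(1) x by (simp add: d_def)
    have "d \<le> a" if "a \<in> {\<delta> / 2, x $ 1, x $ 2, 1 - x $ 1, 1 - x $ 2}" for a
      unfolding d_def using that by (intro Min_le) auto
    then show "d \<le> \<delta> / 2" "d \<le> x $ 1" "d \<le> x $ 2" "d \<le> 1 - x $ 1" "d \<le> 1 - x $ 2"
      by blast+
  qed
  have d2: "d \<le> 1/2" using d by linarith
  define q where "q = cos (pi * d)"
  have q: "0 \<le> q" "q < 1"
  proof -
    have "pi * d \<le> pi / 2" using d2 by simp
    then show "0 \<le> q" unfolding q_def using d(1) by (intro cos_ge_zero) (auto intro: order_trans[of _ 0])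
    have "cos (pi * d) < cos 0" using d(1) d2 by (intro cos_monotone_0_pi) auto
    then show "q < 1" by (simp add: q_def)
  qed
  have far1: "\<bar>cos (pi * (x $ i - y $ i))\<bar> \<le> q" if "y \<in> cell" "d \<le> \<bar>x $ i - y $ i\<bar>" for y i
  proof -
    have xi: "d \<le> x $ i" "d \<le> 1 - x $ i"
      using d(3-6) exhaust_2[of i] by auto
    have yi: "0 \<le> y $ i" "y $ i \<le> 1" using that(1) by (auto simp: cell_def)
    define s where "s = \<bar>x $ i - y $ i\<bar>"
    have s: "d \<le> s" "s \<le> 1 - d" using that(2) xi yi by (auto simp: s_def abs_le_iff)
    have "cos (pi * (x $ i - y $ i)) = cos (pi * s)"
      by (simp add: s_def abs_if) (metis cos_minus minus_diff_eq mult_minus_right)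
    moreover have "cos (pi * s) \<le> q"
      unfolding q_def using s d(1) by (intro cos_monotone_0_pi_le) auto
    moreover have "- q \<le> cos (pi * s)"
    proof -
      have "cos (pi * (1 - d)) \<le> cos (pi * s)"
        using s d(1) by (intro cos_monotone_0_pi_le) auto
      moreover have "cos (pi * (1 - d)) = - q"
        by (simp add: q_def right_diff_distrib cos_diff)
      ultimately show ?thesis by simp
    qed
    ultimately show ?thesis by (simp add: abs_le_iff)
  qed
  \<comment> \<open>Bound for the kernel outside the ball of radius \<delta>: q^(2 N) from the
    powers of the cosine, times the squared polynomial bound for 1 / \<open>knorm N\<close>.\<close>
  define r where "r N = (q ^ N * (pi * (1 + real (2 * N))))\<^sup>2" for N
  have far: "kern N (x - y) \<le> r N" if y: "y \<in> cell" "\<delta> \<le> dist y x" for y N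
  proof -
    have "norm (y - x) \<le> \<bar>y $ 1 - x $ 1\<bar> + \<bar>y $ 2 - x $ 2\<bar>"
      using norm_le_l1_cart[of "y - x"] by (simp add: sum_2)
    then have "\<not> (\<bar>x $ 1 - y $ 1\<bar> < d \<and> \<bar>x $ 2 - y $ 2\<bar> < d)"
      using y(2) d(2) unfolding dist_norm by linarith
    then obtain i where i: "d \<le> \<bar>x $ i - y $ i\<bar>"
      by (meson not_le)
    let ?c = "\<lambda>i. cos (pi * (x $ i - y $ i))"
    have eq: "?c 1 * ?c 2 = ?c i * (?c (if i = 1 then 2 else 1))"
      using exhaust_2[of i] by auto
    have "\<bar>?c 1 * ?c 2\<bar> = \<bar>?c i\<bar> * \<bar>?c (if i = 1 then 2 else 1)\<bar>"
      unfolding eq abs_mult ..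
    also have "\<dots> \<le> q * 1"
      by (rule mult_mono[OF far1[OF y(1) i]]) (use q in auto)
    finally have "\<bar>?c 1 * ?c 2\<bar> \<le> q * 1" .
    then have "\<bar>?c 1 * ?c 2\<bar> ^ (2 * N) \<le> q ^ (2 * N)"
      by (intro power_mono) auto
    then have c: "?c 1 ^ (2 * N) * ?c 2 ^ (2 * N) \<le> (q ^ N)\<^sup>2"
      by (simp add: power_mult power_mult_distrib flip: power_mult[of q N 2] mult.commute[of 2 N])
    have k: "1 / knorm N \<le> pi * (1 + real (2 * N))"
      using le_imp_inverse_le[OF knorm_lower[of N]] by (simp add: inverse_eq_divide add_pos_nonneg)
    have "kern N (x - y) = (?c 1 ^ (2 * N) * ?c 2 ^ (2 * N)) * (1 / knorm N)\<^sup>2"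
      by (simp add: kern_def kern1_def power2_eq_square)
    also have "\<dots> \<le> (q ^ N)\<^sup>2 * (pi * (1 + real (2 * N)))\<^sup>2"
      using c k knorm_pos[of N] by (intro mult_mono power_mono) auto
    finally show ?thesis by (simp add: r_def power_mult_distrib)
  qed
  have bound: "\<bar>conv N g x - g x\<bar> \<le> \<epsilon> / 2 + 2 * B * r N" for N
  proof -
    have i0: "integrable cellM (\<lambda>y. kern N (x - y))"
      by (rule integrable_continuous_cellM[OF continuous_kern_left])
    have i1: "integrable cellM (\<lambda>y. kern N (x - y) * g y)"
      by (rule integrable_continuous_cellM) (intro continuous_intros g)
    have "conv N g x - g x = (\<integral>y. kern N (x - y) * g y \<partial>cellM) - g x * (\<integral>y. kern N (x - y) \<partial>cellM)"
      by (simp add: conv_def integral_kern)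
    also have "\<dots> = (\<integral>y. kern N (x - y) * (g y - g x) \<partial>cellM)"
    proof -
      have eq: "(\<lambda>y. kern N (x - y) * (g y - g x)) = (\<lambda>y. kern N (x - y) * g y - g x * kern N (x - y))"
        by (simp add: fun_eq_iff algebra_simps)
      show ?thesis
        unfolding eq using i0 i1 by simp
    qed
    also have "\<bar>\<dots>\<bar> \<le> (\<integral>y. \<bar>kern N (x - y) * (g y - g x)\<bar> \<partial>cellM)"
      by (rule integral_abs_bound)
    also have "\<dots> \<le> (\<integral>y. \<epsilon> / 2 * kern N (x - y) + 2 * B * r N \<partial>cellM)"
    proof (rule integral_mono)
      show "integrable cellM (\<lambda>y. \<bar>kern N (x - y) * (g y - g x)\<bar>)"
        by (rule integrable_continuous_cellM) (intro continuous_intros g)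
      show "integrable cellM (\<lambda>y. \<epsilon> / 2 * kern N (x - y) + 2 * B * r N)"
        using i0 by simp
      fix y assume "y \<in> space cellM"
      then have y: "y \<in> cell" by simp
      have gB: "\<bar>g y - g x\<bar> \<le> 2 * B" using g(2)[of x] g(2)[of y] by linarith
      have r0: "0 \<le> r N" by (simp add: r_def)
      show "\<bar>kern N (x - y) * (g y - g x)\<bar> \<le> \<epsilon> / 2 * kern N (x - y) + 2 * B * r N"
      proof (cases "dist y x < \<delta>")
        case True
        have "kern N (x - y) * \<bar>g y - g x\<bar> \<le> kern N (x - y) * (\<epsilon> / 2)"
          using \<delta>(2)[OF True] by (intro mult_left_mono kern_nonneg) (simp add: dist_real_def)
        moreover have "0 \<le> 2 * B * r N" using B r0 by simp
        moreover have "\<bar>kern N (x - y) * (g y - g x)\<bar> = kern N (x - y) * \<bar>g y - g x\<bar>"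
          by (simp add: abs_mult kern_nonneg)
        ultimately show ?thesis
          using add_mono[of "kern N (x - y) * \<bar>g y - g x\<bar>" "\<epsilon> / 2 * kern N (x - y)" 0 "2 * B * r N"]
          by (simp only: mult.commute[of "\<epsilon> / 2"] add_0_right)
      next
        case False
        then have "kern N (x - y) * \<bar>g y - g x\<bar> \<le> r N * (2 * B)"
          using far[OF y] gB r0 by (intro mult_mono) auto
        moreover have "0 \<le> \<epsilon> / 2 * kern N (x - y)" using \<epsilon> kern_nonneg[of N "x - y"] by simp
        ultimately show ?thesis by (simp add: abs_mult kern_nonneg mult.commute)
      qed
    qed
    also have "\<dots> = \<epsilon> / 2 + 2 * B * r N"
      using i0 by (simp add: integral_kern)
    finally show ?thesis .
  qed
  have "(\<lambda>N. real N * q ^ N) \<longlonglongrightarrow> 0"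
    using q by (intro powser_times_n_limit_0) (simp add: abs_of_nonneg)
  moreover have "(\<lambda>N. q ^ N) \<longlonglongrightarrow> 0" using q by (intro LIMSEQ_realpow_zero) auto
  ultimately have "(\<lambda>N. (pi * (2 * (real N * q ^ N) + q ^ N))\<^sup>2) \<longlonglongrightarrow> (pi * (2 * 0 + 0))\<^sup>2"
    by (intro tendsto_intros) (use q in \<open>simp_all add: abs_of_nonneg\<close>)
  moreover have "(\<lambda>N. (pi * (2 * (real N * q ^ N) + q ^ N))\<^sup>2) = r"
    by (simp add: fun_eq_iff r_def algebra_simps)
  ultimately have "(\<lambda>N. 2 * B * r N) \<longlonglongrightarrow> 2 * B * 0"
    by (intro tendsto_intros) simp
  then have "\<forall>\<^sub>F N in sequentially. 2 * B * r N < \<epsilon> / 2"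
    using \<epsilon> by (intro order_tendstoD(2)[of _ "2 * B * 0"]) auto
  then obtain N0 where N0: "\<And>N. N0 \<le> N \<Longrightarrow> 2 * B * r N < \<epsilon> / 2"
    by (auto simp: eventually_sequentially)
  have "norm (conv N g x - g x) < \<epsilon>" if "N0 \<le> N" for N
    using bound[of N] N0[OF that] by simp
  then show "\<exists>N0. \<forall>N\<ge>N0. norm (conv N g x - g x) < \<epsilon>" by blast
qed

lemma AE_cell_interior: "AE x in cellM. \<forall>i. 0 < x $ i \<and> x $ i < 1"
proof -
  have "negligible {x :: real^2. axis i 1 \<bullet> x = c}" for i c
    by (rule negligible_hyperplane) simp
  then have "AE x in lebesgue. x \<notin> {x :: real^2. axis i 1 \<bullet> x = c}" for i c
    by (intro AE_not_in) (simp add: negligible_iff_null_sets)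
  then have *: "AE x in lborel. (x :: real^2) $ i \<noteq> c" for i c
    by (simp add: AE_completion_iff inner_axis')
  have "AE x in lborel. x \<in> cell \<longrightarrow> (\<forall>i. 0 < x $ i \<and> x $ i < 1)"
    using *[of 1 0] *[of 1 1] *[of 2 0] *[of 2 1]
    by eventually_elim (auto simp: cell_def forall_2 less_le)
  then show ?thesis by (simp add: AE_restrict_space_iff)
qed

lemma conv_L2_tendsto:
  assumes u: "u \<in> borel_measurable borel" "integrable cellM (\<lambda>x. (u x)\<^sup>2)"
  shows "(\<lambda>N. \<integral>x. (u x - conv N u x)\<^sup>2 \<partial>cellM) \<longlonglongrightarrow> 0"
proof (rule LIMSEQ_I)
  fix \<epsilon> :: real assume \<epsilon>: "0 < \<epsilon>"
  \<comment> \<open>The error is split into u - g, g - conv g and conv (g - u), the last one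
    controlled by contraction. With the factor 3 for three squares this gives 9/12 of
    \<epsilon>.\<close>
  then have "0 < \<epsilon> / 12" by simp
  then obtain g B where g: "continuous_on UNIV g" "\<And>x. \<bar>g x\<bar> \<le> B" and ug: "(\<integral>x. (u x - g x)\<^sup>2 \<partial>cellM) < \<epsilon> / 12"
    using continuous_dense_L2[OF u] by blast
  have mg: "g \<in> borel_measurable borel" by (rule borel_measurable_continuous_onI[OF g(1)])
  have ig: "integrable cellM (\<lambda>x. (g x)\<^sup>2)"
    by (rule integrable_continuous_cellM) (intro continuous_intros g)
  have cc: "continuous_on UNIV (conv N v)" if "v \<in> borel_measurable borel" "integrable cellM (\<lambda>x. (v x)\<^sup>2)" for N v
    by (rule smooth_continuous_on[OF smooth_conv[OF that]])
  have convB: "\<bar>conv N g x\<bar> \<le> B" for N x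
  proof -
    have "\<bar>conv N g x\<bar> \<le> (\<integral>y. \<bar>kern N (x - y) * g y\<bar> \<partial>cellM)"
      unfolding conv_def by (rule integral_abs_bound)
    also have "\<dots> \<le> (\<integral>y. kern N (x - y) * B \<partial>cellM)"
    proof (rule integral_mono)
      show "integrable cellM (\<lambda>y. \<bar>kern N (x - y) * g y\<bar>)" "integrable cellM (\<lambda>y. kern N (x - y) * B)"
        by (intro integrable_continuous_cellM continuous_intros g)+
      show "\<bar>kern N (x - y) * g y\<bar> \<le> kern N (x - y) * B" for y
        using g(2) by (simp add: abs_mult kern_nonneg mult_left_mono)
    qed
    also have "\<dots> = B" by (simp add: integral_kern)
    finally show ?thesis .
  qed
  have "(\<lambda>N. \<integral>x. (g x - conv N g x)\<^sup>2 \<partial>cellM) \<longlonglongrightarrow> (\<integral>x. 0 \<partial>cellM)"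
  proof (rule integral_dominated_convergence[where w = "\<lambda>x. (2 * B)\<^sup>2"])
    show "AE x in cellM. (\<lambda>N. (g x - conv N g x)\<^sup>2) \<longlonglongrightarrow> 0"
      using AE_cell_interior
    proof eventually_elim
      case (elim x)
      have "(\<lambda>N. (g x - conv N g x)\<^sup>2) \<longlonglongrightarrow> (g x - g x)\<^sup>2"
        by (intro tendsto_intros conv_tendsto[OF g]) (use elim in auto)
      then show ?case by simp
    qed
    have "\<bar>g x - conv N g x\<bar> \<le> \<bar>2 * B\<bar>" for N x
      using g(2)[of x] convB[of N x] by linarith
    then show "AE x in cellM. norm ((g x - conv N g x)\<^sup>2) \<le> (2 * B)\<^sup>2" for N
      unfolding real_norm_def abs_power2 abs_le_square_iff by (intro AE_I2)
    show "(\<lambda>x. (g x - conv N g x)\<^sup>2) \<in> borel_measurable cellM" for N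
      by (intro measurable_cellM borel_measurable_continuous_onI continuous_intros g cc mg ig)
  qed auto
  then have "\<forall>\<^sub>F N in sequentially. (\<integral>x. (g x - conv N g x)\<^sup>2 \<partial>cellM) < \<epsilon> / 12"
    using \<epsilon> by (intro order_tendstoD(2)[of _ 0]) auto
  then obtain N0 where N0: "\<And>N. N0 \<le> N \<Longrightarrow> (\<integral>x. (g x - conv N g x)\<^sup>2 \<partial>cellM) < \<epsilon> / 12"
    by (auto simp: eventually_sequentially)
  have main: "(\<integral>x. (u x - conv N u x)\<^sup>2 \<partial>cellM) < \<epsilon>" if N: "N0 \<le> N" for N
  proof -
    have mgu: "(\<lambda>x. g x - u x) \<in> borel_measurable borel" using mg u(1) by simp
    have igu: "integrable cellM (\<lambda>x. (g x - u x)\<^sup>2)" by (rule integrable_diff_sq[OF mg ig u])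
    have iug: "integrable cellM (\<lambda>x. (u x - g x)\<^sup>2)" by (rule integrable_diff_sq[OF u mg ig])
    have lin: "conv N g x - conv N u x = conv N (\<lambda>x. g x - u x) x" for x
    proof -
      have "integrable cellM (\<lambda>y. kern N (x - y) * g y)" "integrable cellM (\<lambda>y. kern N (x - y) * u y)"
        by (rule integrable_continuous_mult_L2[OF _ _ continuous_kern_left]; fact)+
      then show ?thesis by (simp add: conv_def right_diff_distrib)
    qed
    have i1: "integrable cellM (\<lambda>x. (g x - conv N g x)\<^sup>2)"
      by (intro integrable_continuous_cellM continuous_intros g cc mg ig)
    have i2: "integrable cellM (\<lambda>x. (conv N g x - conv N u x)\<^sup>2)"
      by (intro integrable_continuous_cellM continuous_intros cc mg ig u)
    have i3: "integrable cellM (\<lambda>x. (conv N u x)\<^sup>2)"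
      by (intro integrable_continuous_cellM continuous_intros cc u)
    have "(\<integral>x. (u x - conv N u x)\<^sup>2 \<partial>cellM) \<le>
      (\<integral>x. 3 * ((u x - g x)\<^sup>2 + (g x - conv N g x)\<^sup>2 + (conv N g x - conv N u x)\<^sup>2) \<partial>cellM)"
    proof (rule integral_mono)
      show "integrable cellM (\<lambda>x. (u x - conv N u x)\<^sup>2)"
        by (rule integrable_diff_sq[OF u borel_measurable_continuous_onI[OF cc[OF u]] i3])
    qed (use i1 i2 iug diff_sq_le3 in auto)
    also have "\<dots> = 3 * ((\<integral>x. (u x - g x)\<^sup>2 \<partial>cellM) + (\<integral>x. (g x - conv N g x)\<^sup>2 \<partial>cellM)
        + (\<integral>x. (conv N (\<lambda>x. g x - u x) x)\<^sup>2 \<partial>cellM))"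
      using i1 i2 iug by (simp add: lin)
    finally have "(\<integral>x. (u x - conv N u x)\<^sup>2 \<partial>cellM) \<le> 3 * ((\<integral>x. (u x - g x)\<^sup>2 \<partial>cellM)
        + (\<integral>x. (g x - conv N g x)\<^sup>2 \<partial>cellM) + (\<integral>x. (conv N (\<lambda>x. g x - u x) x)\<^sup>2 \<partial>cellM))" .
    moreover have "(\<integral>x. (conv N (\<lambda>x. g x - u x) x)\<^sup>2 \<partial>cellM) \<le> (\<integral>x. (u x - g x)\<^sup>2 \<partial>cellM)"
      using conv_L2_le[OF mgu igu, of N] by (simp add: power2_commute[of "g _"])
    moreover have "a < \<epsilon>" if "a \<le> 3 * (b + c + d)" "d \<le> b" "b < \<epsilon> / 12" "c < \<epsilon> / 12" for a b c d :: real
      using that \<epsilon> by (simp add: field_simps)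
    ultimately show ?thesis using ug N0[OF N] by blast
  qed
  have "0 \<le> (\<integral>x. (u x - conv N u x)\<^sup>2 \<partial>cellM)" for N
    by (intro Bochner_Integration.integral_nonneg) simp
  then show "\<exists>N0. \<forall>N\<ge>N0. norm ((\<integral>x. (u x - conv N u x)\<^sup>2 \<partial>cellM) - 0) < \<epsilon>"
    using main by (intro exI[of _ N0]) simp
qed

section \<open>The energy of \<open>\<surd>g\<^sub>0 + t dh\<close>\<close>

lemma dir_add_2pi: "dir (\<theta> + 2 * pi * of_int k) = dir \<theta>"
  by (rule dir_periodic) simp

lemma dir_inner_sq_le: "(p \<bullet> dir \<theta>)\<^sup>2 \<le> (norm p)\<^sup>2"
  using Cauchy_Schwarz_ineq2[of p "dir \<theta>"] by (metis abs_ge_zero norm_dir mult.right_neutral power2_abs power_mono)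

context randers_potential
begin

text \<open>The energy density after integration over the fibre, as a quadratic form in the gradient
  p. Two factors 1 / speed come from the geodesic field and one factor speed from A \<and> dA; 1 /
  pi is n / vol(S^(n-1)) for n = 2.\<close>

definition Q :: "real^2 \<Rightarrow> real^2 \<Rightarrow> real" where
  "Q x p = 1 / pi * integral {0..2 * pi} (\<lambda>\<theta>. (p \<bullet> dir \<theta>)\<^sup>2 / speed (x, \<theta>))"

lemma continuous_on_dir [continuous_intros]: "continuous_on A f \<Longrightarrow> continuous_on A (\<lambda>x. dir (f x))"
  by (rule continuous_on_compose2[OF smooth_continuous_on[OF smooth_dir[OF smooth_ident], of UNIV]]) auto

lemma continuous_on_speed [continuous_intros]: "continuous_on A f \<Longrightarrow> continuous_on A (\<lambda>x. speed (f x))"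
  by (rule continuous_on_compose2[OF smooth_continuous_on[OF smooth_speed, of UNIV]]) auto

lemma speed_neq_0 [simp]: "speed q \<noteq> 0"
  using speed_pos[of q] by simp

lemma continuous_integrand:
  assumes "continuous_on A f" "continuous_on A g" "continuous_on A k"
  shows "continuous_on A (\<lambda>x. (f x \<bullet> dir (g x))\<^sup>2 / speed (k x, g x))"
  by (intro continuous_intros assms) simp

lemma continuous_Q: "continuous_on UNIV (\<lambda>(x, p). Q x p)"
proof -
  have "continuous_on UNIV (\<lambda>z. integral (cbox 0 (2 * pi)) (\<lambda>\<theta>. (snd z \<bullet> dir \<theta>)\<^sup>2 / speed (fst z, \<theta>)))"
    by (rule integral_continuous_on_param) (auto simp: case_prod_beta' intro!: continuous_integrand continuous_intros)
  then show ?thesis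
    unfolding Q_def case_prod_beta' cbox_interval by (intro continuous_intros)
qed

lemma continuous_Q_comp:
  assumes "continuous_on A f" "continuous_on A g"
  shows "continuous_on A (\<lambda>x. Q (f x) (g x))"
  using continuous_on_compose2[OF continuous_Q continuous_on_Pair[OF assms]] by simp

lemma integrand_integrable: "(\<lambda>\<theta>. (p \<bullet> dir \<theta>)\<^sup>2 / speed (x, \<theta>)) integrable_on {a..b}"
  by (intro integrable_continuous_interval continuous_integrand continuous_intros)

lemma integrand_nonneg: "0 \<le> (p \<bullet> dir \<theta>)\<^sup>2 / speed q"
  using speed_pos[of q] by simp

lemma Q_nonneg: "0 \<le> Q x p"
  unfolding Q_def by (intro mult_nonneg_nonneg integral_nonneg integrand_integrable integrand_nonneg) auto

text \<open>The bound degenerates as t tends to 1. It serves integrability and the approximation for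
  a fixed t, where it multiplies only errors that tend to 0.\<close>

lemma Q_le: "Q x p \<le> 2 / (1 - t) * (norm p)\<^sup>2"
proof -
  have "integral {0..2 * pi} (\<lambda>\<theta>. (p \<bullet> dir \<theta>)\<^sup>2 / speed (x, \<theta>)) \<le> integral {0..2 * pi} (\<lambda>\<theta>. (norm p)\<^sup>2 / (1 - t))"
    by (intro integral_le integrand_integrable integrable_const_ivl frac_le dir_inner_sq_le speed_ge)
      (use t_less in auto)
  also have "\<dots> = 2 * pi * ((norm p)\<^sup>2 / (1 - t))" by simp
  finally have "Q x p \<le> 1 / pi * (2 * pi * ((norm p)\<^sup>2 / (1 - t)))"
    unfolding Q_def by (intro mult_left_mono) auto
  then show ?thesis by simp
qed

lemma Q_triangle: "Q x p \<le> 2 * Q x q + 2 * Q x (p - q)"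
proof -
  let ?i = "\<lambda>p \<theta>. (p \<bullet> dir \<theta>)\<^sup>2 / speed (x, \<theta>)"
  have "((\<lambda>\<theta>. 2 * ?i q \<theta> + 2 * ?i (p - q) \<theta>) has_integral
      2 * integral {0..2 * pi} (?i q) + 2 * integral {0..2 * pi} (?i (p - q))) {0..2 * pi}"
    by (intro has_integral_add has_integral_mult_right integrable_integral integrand_integrable)
  moreover have "?i p \<theta> \<le> 2 * ?i q \<theta> + 2 * ?i (p - q) \<theta>" for \<theta>
  proof -
    have "(p \<bullet> dir \<theta>)\<^sup>2 \<le> 2 * (q \<bullet> dir \<theta>)\<^sup>2 + 2 * ((p - q) \<bullet> dir \<theta>)\<^sup>2"
      using zero_le_power2[of "q \<bullet> dir \<theta> - (p - q) \<bullet> dir \<theta>"]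
      by (simp add: inner_diff_left power2_eq_square algebra_simps)
    then have "?i p \<theta> \<le> (2 * (q \<bullet> dir \<theta>)\<^sup>2 + 2 * ((p - q) \<bullet> dir \<theta>)\<^sup>2) / speed (x, \<theta>)"
      using speed_pos[of "(x, \<theta>)"] by (intro divide_right_mono) auto
    then show ?thesis by (simp add: add_divide_distrib)
  qed
  ultimately have "integral {0..2 * pi} (?i p) \<le> 2 * integral {0..2 * pi} (?i q) + 2 * integral {0..2 * pi} (?i (p - q))"
    using has_integral_le[OF integrable_integral[OF integrand_integrable]] by blast
  then have "1 / pi * integral {0..2 * pi} (?i p) \<le> 1 / pi * (2 * integral {0..2 * pi} (?i q) + 2 * integral {0..2 * pi} (?i (p - q)))"
    by (intro mult_left_mono) auto
  then show ?thesis by (simp add: Q_def algebra_simps add_divide_distrib)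
qed

text \<open>Cauchy--Schwarz with the weight \<open>speed\<close>, tested against \<open>\<theta> \<mapsto> v \<bullet> dir \<theta>\<close>.\<close>

lemma inner_sq_le_Q: "(p \<bullet> v)\<^sup>2 \<le> (norm v)\<^sup>2 * (2 * Q x p)"
proof -
  define a b c where "a = p $ 1 * v $ 1 / 2" and "b = (p $ 1 * v $ 2 + p $ 2 * v $ 1) / 2" and "c = p $ 2 * v $ 2 / 2"
  \<comment> \<open>A primitive of (p \<bullet> dir \<theta>) (v \<bullet> dir \<theta>); over a
    full turn it increases by pi (p \<bullet> v).\<close>
  let ?g = "\<lambda>\<theta>. a * (\<theta> + sin \<theta> * cos \<theta>) + b * (sin \<theta>)\<^sup>2 + c * (\<theta> - sin \<theta> * cos \<theta>)"
  have "(?g (2 * pi) - ?g 0)\<^sup>2 \<le> integral {0..2 * pi} (\<lambda>\<theta>. (p \<bullet> dir \<theta>)\<^sup>2 / speed (x, \<theta>)) *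
      integral {0..2 * pi} (\<lambda>\<theta>. (norm v)\<^sup>2 * speed (x, \<theta>))"
  proof (rule increment_sq_le[where g' = "\<lambda>\<theta>. (p \<bullet> dir \<theta>) * (v \<bullet> dir \<theta>)"])
    fix \<theta> :: real
    have cs: "(cos \<theta>)\<^sup>2 = 1 - (sin \<theta>)\<^sup>2" by (simp add: cos_squared_eq)
    have "(?g has_real_derivative a * (1 + (cos \<theta> * cos \<theta> + - sin \<theta> * sin \<theta>))
        + b * (2 * (cos \<theta> * sin \<theta>)) + c * (1 - (cos \<theta> * cos \<theta> + - sin \<theta> * sin \<theta>))) (at \<theta>)"
      by (auto intro!: derivative_eq_intros simp: algebra_simps)
    also have "a * (1 + (cos \<theta> * cos \<theta> + - sin \<theta> * sin \<theta>))
        + b * (2 * (cos \<theta> * sin \<theta>)) + c * (1 - (cos \<theta> * cos \<theta> + - sin \<theta> * sin \<theta>))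
      = (p \<bullet> dir \<theta>) * (v \<bullet> dir \<theta>)"
    proof -
      have 1: "1 + (cos \<theta> * cos \<theta> + - sin \<theta> * sin \<theta>) = 2 * (cos \<theta> * cos \<theta>)"
        and 2: "1 - (cos \<theta> * cos \<theta> + - sin \<theta> * sin \<theta>) = 2 * (sin \<theta> * sin \<theta>)"
        using cs by (simp_all add: power2_eq_square)
      show ?thesis unfolding 1 2 a_def b_def c_def by (simp add: inner_2 algebra_simps)
    qed
    finally show "(?g has_real_derivative (p \<bullet> dir \<theta>) * (v \<bullet> dir \<theta>)) (at \<theta>)" .
    have "((p \<bullet> dir \<theta>) * (v \<bullet> dir \<theta>))\<^sup>2 = (p \<bullet> dir \<theta>)\<^sup>2 * (v \<bullet> dir \<theta>)\<^sup>2"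
      by (rule power_mult_distrib)
    also have "\<dots> \<le> (p \<bullet> dir \<theta>)\<^sup>2 * (norm v)\<^sup>2"
      by (intro mult_left_mono dir_inner_sq_le) simp
    finally show "((p \<bullet> dir \<theta>) * (v \<bullet> dir \<theta>))\<^sup>2 \<le> (p \<bullet> dir \<theta>)\<^sup>2 / speed (x, \<theta>) * ((norm v)\<^sup>2 * speed (x, \<theta>))"
      by (simp add: field_simps)
    show "0 \<le> (norm v)\<^sup>2 * speed (x, \<theta>)" using speed_pos[of "(x, \<theta>)"] by simp
  qed (auto intro!: continuous_integrand continuous_intros integrand_nonneg)
  also have "integral {0..2 * pi} (\<lambda>\<theta>. (norm v)\<^sup>2 * speed (x, \<theta>)) = (norm v)\<^sup>2 * (2 * pi)"
    by (rule integral_unique[OF has_integral_mult_right[OF speed_has_integral]])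
  also have "?g (2 * pi) - ?g 0 = pi * (p \<bullet> v)"
    unfolding a_def c_def by (simp add: inner_2 algebra_simps)
  also have "integral {0..2 * pi} (\<lambda>\<theta>. (p \<bullet> dir \<theta>)\<^sup>2 / speed (x, \<theta>)) = pi * Q x p"
    by (simp add: Q_def)
  finally have "pi\<^sup>2 * (p \<bullet> v)\<^sup>2 \<le> pi\<^sup>2 * ((norm v)\<^sup>2 * (2 * Q x p))"
    by (simp add: power_mult_distrib power2_eq_square mult_ac)
  then show ?thesis
    by (simp add: mult_le_cancel_left)
qed

text \<open>
  Directions opposite to \<open>w\<close>, where the weight \<open>1 / speed\<close> is large, are resolved by a small window
  of half-width \<open>\<gamma>\<close>.
\<close>

lemma radial_sq_le_Q:
  assumes \<gamma>: "0 < \<gamma>" "\<gamma> < pi" and z: "z \<noteq> 0" and w: "(1 - \<mu>) * norm z \<le> w x \<bullet> z"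
  shows "(p \<bullet> z)\<^sup>2 \<le> (norm z)\<^sup>2 * (pi * (\<gamma> - sin \<gamma> + \<mu> * sin \<gamma>) / (4 * (sin \<gamma>)\<^sup>2) * (2 * Q x p))"
proof -
  let ?i = "\<lambda>\<theta>. (p \<bullet> dir \<theta>)\<^sup>2 / speed (x, \<theta>)"
  \<comment> \<open>The direction opposite to z, where speed is close to its minimum 1 - t when w is
    close to z / |z|.\<close>
  obtain \<theta>0 where "- sgn z = dir \<theta>0"
    using dir_exists[of "- sgn z"] z by (auto simp: norm_sgn)
  then have "sgn z = - dir \<theta>0"
    by (metis minus_minus)
  moreover have "z = norm z *\<^sub>R sgn z"
    using z by (simp add: sgn_div_norm)
  ultimately have zd: "z = - norm z *\<^sub>R dir \<theta>0"
    by (metis scaleR_minus_left scaleR_minus_right)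
  have s: "0 < sin \<gamma>" using \<gamma> by (simp add: sin_gt_zero)
  have win: "integral {\<theta>0 - \<gamma>..\<theta>0 + \<gamma>} ?i \<le> pi * Q x p"
  proof -
    have "integral {\<theta>0 - \<gamma>..\<theta>0 + \<gamma>} ?i \<le> integral {\<theta>0 - pi..\<theta>0 - pi + 2 * pi} ?i"
    proof (intro integral_subset_le integrand_integrable ballI)
      show "{\<theta>0 - \<gamma>..\<theta>0 + \<gamma>} \<subseteq> {\<theta>0 - pi..\<theta>0 - pi + 2 * pi}"
        using \<gamma> by auto
    qed (rule integrand_nonneg)
    also have "\<dots> = integral {0..2 * pi} ?i"
    proof (rule integral_periodic)
      show "continuous_on UNIV ?i"
        by (intro continuous_integrand continuous_intros)
    qed (simp_all add: speed_def dir_add_2pi)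
    finally show ?thesis by (simp add: Q_def)
  qed
  \<comment> \<open>The weight has small mass on the window: as w \<bullet> dir \<theta>0 <= - (1 -
    \<mu>), it is at most 2 (\<gamma> - sin \<gamma> + \<mu> sin \<gamma>), which is of third order
    in \<gamma> up to the term with \<mu>. The increment of \<open>?k\<close> is of first order, and
    this gap produces the stiffness.\<close>
  have sw: "((\<lambda>\<theta>. speed (x, \<theta>)) has_integral (2 * (\<gamma> + sin \<gamma> * (w x \<bullet> dir \<theta>0)))) {\<theta>0 - \<gamma>..\<theta>0 + \<gamma>}"
  proof -
    let ?g = "\<lambda>\<theta>. \<theta> + w x $ 1 * sin \<theta> - w x $ 2 * cos \<theta>"
    have "((\<lambda>\<theta>. speed (x, \<theta>)) has_integral (?g (\<theta>0 + \<gamma>) - ?g (\<theta>0 - \<gamma>))) {\<theta>0 - \<gamma>..\<theta>0 + \<gamma>}"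
    proof (rule fundamental_theorem_of_calculus)
      show "(?g has_vector_derivative speed (x, \<theta>)) (at \<theta> within {\<theta>0 - \<gamma>..\<theta>0 + \<gamma>})" for \<theta>
        unfolding speed_def inner_2 has_real_derivative_iff_has_vector_derivative[symmetric]
        by (auto intro!: derivative_eq_intros)
    qed (use \<gamma> in simp)
    moreover have "?g (\<theta>0 + \<gamma>) - ?g (\<theta>0 - \<gamma>) = 2 * (\<gamma> + sin \<gamma> * (w x \<bullet> dir \<theta>0))"
      by (simp add: inner_2 sin_add sin_diff cos_add cos_diff algebra_simps)
    ultimately show ?thesis by simp
  qed
  let ?k = "\<lambda>\<theta>. p $ 1 * sin \<theta> - p $ 2 * cos \<theta>"
  have "(?k (\<theta>0 + \<gamma>) - ?k (\<theta>0 - \<gamma>))\<^sup>2 \<le> integral {\<theta>0 - \<gamma>..\<theta>0 + \<gamma>} ?i * integral {\<theta>0 - \<gamma>..\<theta>0 + \<gamma>} (\<lambda>\<theta>. speed (x, \<theta>))"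
  proof (rule increment_sq_le[where g' = "\<lambda>\<theta>. p \<bullet> dir \<theta>"])
    show "(?k has_real_derivative p \<bullet> dir \<theta>) (at \<theta>)" for \<theta>
      by (auto intro!: derivative_eq_intros simp: inner_2)
    show "0 \<le> speed (x, \<theta>)" for \<theta> using speed_pos[of "(x, \<theta>)"] by simp
  qed (use \<gamma> in \<open>auto intro!: continuous_integrand continuous_intros integrand_nonneg\<close>)
  also have "integral {\<theta>0 - \<gamma>..\<theta>0 + \<gamma>} (\<lambda>\<theta>. speed (x, \<theta>)) = 2 * (\<gamma> + sin \<gamma> * (w x \<bullet> dir \<theta>0))"
    by (rule integral_unique[OF sw])
  also have "?k (\<theta>0 + \<gamma>) - ?k (\<theta>0 - \<gamma>) = 2 * sin \<gamma> * (p \<bullet> dir \<theta>0)"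
    by (simp add: inner_2 sin_add sin_diff cos_add cos_diff algebra_simps)
  finally have k: "(2 * sin \<gamma> * (p \<bullet> dir \<theta>0))\<^sup>2 \<le> integral {\<theta>0 - \<gamma>..\<theta>0 + \<gamma>} ?i * (2 * (\<gamma> + sin \<gamma> * (w x \<bullet> dir \<theta>0)))" .
  have "w x \<bullet> z = - norm z * (w x \<bullet> dir \<theta>0)"
    by (subst zd) simp
  then have "norm z * (1 - \<mu>) \<le> norm z * (- (w x \<bullet> dir \<theta>0))"
    using w by (simp add: mult.commute)
  then have wd: "w x \<bullet> dir \<theta>0 \<le> - (1 - \<mu>)"
    using z mult_left_le_imp_le[of "norm z" "1 - \<mu>" "- (w x \<bullet> dir \<theta>0)"] by simp
  have pos: "0 \<le> 2 * (\<gamma> + sin \<gamma> * (w x \<bullet> dir \<theta>0))"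
    using has_integral_nonneg[OF sw] speed_pos less_imp_le by blast
  have "(2 * sin \<gamma> * (p \<bullet> dir \<theta>0))\<^sup>2 \<le> (pi * Q x p) * (2 * (\<gamma> + sin \<gamma> * (w x \<bullet> dir \<theta>0)))"
    by (rule order_trans[OF k mult_right_mono[OF win pos]])
  also have "\<dots> \<le> (pi * Q x p) * (2 * (\<gamma> + sin \<gamma> * (- (1 - \<mu>))))"
    using wd s Q_nonneg[of x p] by (intro mult_left_mono add_left_mono) auto
  finally have "4 * (sin \<gamma>)\<^sup>2 * (p \<bullet> dir \<theta>0)\<^sup>2 \<le> (pi * Q x p) * (2 * (\<gamma> - sin \<gamma> + \<mu> * sin \<gamma>))"
    by (simp add: power_mult_distrib algebra_simps)
  then have "(p \<bullet> dir \<theta>0)\<^sup>2 \<le> (pi * Q x p) * (2 * (\<gamma> - sin \<gamma> + \<mu> * sin \<gamma>)) / (4 * (sin \<gamma>)\<^sup>2)"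
    using s by (simp add: pos_le_divide_eq mult.commute)
  also have "\<dots> = pi * (\<gamma> - sin \<gamma> + \<mu> * sin \<gamma>) / (4 * (sin \<gamma>)\<^sup>2) * (2 * Q x p)"
  proof -
    have "a * q * (2 * y) / s = a * y / s * (2 * q)" for a q y s :: real by simp
    then show ?thesis .
  qed
  finally have "(norm z)\<^sup>2 * (p \<bullet> dir \<theta>0)\<^sup>2 \<le> (norm z)\<^sup>2 * (pi * (\<gamma> - sin \<gamma> + \<mu> * sin \<gamma>) / (4 * (sin \<gamma>)\<^sup>2) * (2 * Q x p))"
    by (intro mult_left_mono) auto
  moreover have "(p \<bullet> z)\<^sup>2 = (norm z)\<^sup>2 * (p \<bullet> dir \<theta>0)\<^sup>2"
    by (subst zd) (simp add: power_mult_distrib)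
  ultimately show ?thesis by simp
qed

section \<open>The energy of Sobolev functions\<close>

lemma integrable_Q:
  assumes G: "G \<in> borel_measurable borel" "integrable cellM (\<lambda>x. (norm (G x))\<^sup>2)"
  shows "integrable cellM (\<lambda>x. Q x (G x))"
proof (rule Bochner_Integration.integrable_bound[of _ "\<lambda>x. 2 / (1 - t) * (norm (G x))\<^sup>2"])
  show "integrable cellM (\<lambda>x. 2 / (1 - t) * (norm (G x))\<^sup>2)" using G(2) by simp
  have "(\<lambda>x. (x, G x)) \<in> borel \<rightarrow>\<^sub>M borel"
    unfolding borel_prod[symmetric] using G(1) by (intro measurable_Pair) auto
  from measurable_compose[OF this borel_measurable_continuous_onI[OF continuous_Q]]
  show "(\<lambda>x. Q x (G x)) \<in> borel_measurable cellM"
    by (intro measurable_cellM) simp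
  show "AE x in cellM. norm (Q x (G x)) \<le> norm (2 / (1 - t) * (norm (G x))\<^sup>2)"
    using Q_le Q_nonneg t_less by (intro AE_I2) (simp add: abs_of_nonneg)
qed

lemma energy_eq:
  assumes G: "weak_grad f = G" "G \<in> borel_measurable borel" "integrable cellM (\<lambda>x. (norm (G x))\<^sup>2)"
  shows "energy F f = (\<integral>x. Q x (G x) \<partial>cellM)"
proof -
  let ?i = "\<lambda>p. (G (fst p) \<bullet> dir (snd p))\<^sup>2 / speed p"
  have integrand: "\<bar>lie_deriv F f p\<bar>\<^sup>2 * contact_density F p = ?i p" for p
    using speed_pos[of p]
    by (simp add: lie_deriv_def G(1) geodesic_field_eq contact_density_eq power_divide power2_eq_square)
  have G1: "(\<lambda>p::hm. G (fst p)) \<in> borel_measurable borel"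
  proof -
    have "(fst :: hm \<Rightarrow> real^2) \<in> borel_measurable borel"
      by (intro borel_measurable_continuous_onI continuous_intros)
    from measurable_compose[OF this G(2)] show ?thesis .
  qed
  have d1: "(\<lambda>p::hm. dir (snd p)) \<in> borel_measurable borel" and s1: "speed \<in> borel_measurable borel"
    by (intro borel_measurable_continuous_onI continuous_intros smooth_continuous_on[OF smooth_speed])+
  have mi: "?i \<in> borel_measurable borel"
    using G1 d1 s1 by (intro borel_measurable_divide borel_measurable_power borel_measurable_inner)
  have cT: "cell \<times> {0..2 * pi} \<in> sets borel"
    by (intro borel_closed closed_Times compact_imp_closed compact_cell) simp
  have mj: "(\<lambda>p. ennreal (?i p) * indicator (cell \<times> {0..2 * pi}) p) \<in> borel_measurable (lborel \<Otimes>\<^sub>M lborel)"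
    unfolding lborel_prod using mi cT by simp
  have Qi: "integrable cellM (\<lambda>x. Q x (G x))" by (rule integrable_Q[OF G(2,3)])
  have "(LINT p:(cell \<times> {0..2 * pi})|lborel. ?i p) = (\<integral>p. indicator (cell \<times> {0..2 * pi}) p * ?i p \<partial>lborel)"
    by (simp add: set_lebesgue_integral_def)
  also have "\<dots> = enn2real (\<integral>\<^sup>+p. ennreal (indicator (cell \<times> {0..2 * pi}) p * ?i p) \<partial>lborel)"
  proof (intro integral_eq_nn_integral AE_I2 mult_nonneg_nonneg integrand_nonneg)
    show "(\<lambda>p. indicator (cell \<times> {0..2 * pi}) p * ?i p) \<in> borel_measurable lborel"
      using borel_measurable_times[OF borel_measurable_indicator[OF cT] mi] by simp
  qed simp
  also have "(\<integral>\<^sup>+p. ennreal (indicator (cell \<times> {0..2 * pi}) p * ?i p) \<partial>lborel)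
      = (\<integral>\<^sup>+p. ennreal (?i p) * indicator (cell \<times> {0..2 * pi}) p \<partial>(lborel \<Otimes>\<^sub>M lborel))"
    unfolding lborel_prod by (intro nn_integral_cong) (auto simp: indicator_def)
  also have "\<dots> = (\<integral>\<^sup>+x. \<integral>\<^sup>+\<theta>. ennreal (?i (x, \<theta>)) * indicator (cell \<times> {0..2 * pi}) (x, \<theta>) \<partial>lborel \<partial>lborel)"
    by (rule lborel.nn_integral_fst[OF mj, symmetric])
  also have "\<dots> = (\<integral>\<^sup>+x. ennreal (pi * Q x (G x)) * indicator cell x \<partial>lborel)"
  proof (rule nn_integral_cong)
    fix x
    have "(\<integral>\<^sup>+\<theta>. ennreal (?i (x, \<theta>)) * indicator {0..2 * pi} \<theta> \<partial>lborel) = ennreal (pi * Q x (G x))"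
      by (subst nn_integral_eq_integral_Icc)
        (auto intro!: continuous_integrand continuous_intros integrand_nonneg simp: Q_def)
    then show "(\<integral>\<^sup>+\<theta>. ennreal (?i (x, \<theta>)) * indicator (cell \<times> {0..2 * pi}) (x, \<theta>) \<partial>lborel)
      = ennreal (pi * Q x (G x)) * indicator cell x"
      by (simp add: indicator_times indicator_def)
  qed
  also have "\<dots> = (\<integral>\<^sup>+x. ennreal (pi * Q x (G x)) \<partial>cellM)"
    by (simp add: nn_integral_cellM)
  also have "\<dots> = ennreal (\<integral>x. pi * Q x (G x) \<partial>cellM)"
    using Qi Q_nonneg by (intro nn_integral_eq_integral) auto
  also have "enn2real \<dots> = pi * (\<integral>x. Q x (G x) \<partial>cellM)"
    using Q_nonneg by (subst enn2real_ennreal) (auto intro!: Bochner_Integration.integral_nonneg)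
  finally have int: "(LINT p:(cell \<times> {0..2 * pi})|lborel. ?i p) = pi * (\<integral>x. Q x (G x) \<partial>cellM)" .
  show ?thesis
    unfolding energy_def integrand int by simp
qed

text \<open>\<open>focal_poincare\<close> with density 2 Q(x, grad \<phi>) is applied to the
  convolutions of f, and the limit is taken. The factor 8 collects 2 from separating f from its
  approximation, 2 from \<open>Q_triangle\<close>, and 2 from the density.\<close>

lemma poincare_energy:
  assumes \<rho>: "0 < \<rho>" "\<rho> < 1/4" and \<gamma>: "0 < \<gamma>" "\<gamma> < pi" and \<mu>: "0 \<le> \<mu>"
    and w: "\<And>z. \<rho> \<le> norm z \<Longrightarrow> (\<And>i. \<bar>z $ i\<bar> \<le> 1/2 - \<rho>) \<Longrightarrow> (1 - \<mu>) * norm z \<le> w (center + z) \<bullet> z"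
    and \<eta>: "pi * (\<gamma> - sin \<gamma> + \<mu> * sin \<gamma>) / (4 * (sin \<gamma>)\<^sup>2) \<le> \<eta>" "0 \<le> \<eta>"
    and \<kappa>: "6 * \<rho> + 3/2 * \<eta> * ln ((1/2 - \<rho>) / \<rho>) + 48 / ln ((1/2 - \<rho>) / \<rho>) \<le> \<kappa>"
    and f: "f \<in> borel_measurable borel" "integrable cellM (\<lambda>x. (f x)\<^sup>2)" and mean: "(\<integral>x. f x \<partial>cellM) = 0"
    and G: "is_weak_grad f G"
  shows "(\<integral>x. (f x)\<^sup>2 \<partial>cellM) \<le> 8 * \<kappa> * (\<integral>x. Q x (G x) \<partial>cellM)"
proof -
  have mG: "G \<in> borel_measurable borel" and iG: "integrable cellM (\<lambda>x. (norm (G x))\<^sup>2)"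
    using G by (auto simp: is_weak_grad_def set_integrable_cell)
  have mGi: "(\<lambda>x. G x $ i) \<in> borel_measurable borel" for i
    by (rule measurable_compose[OF mG borel_measurable_continuous_onI]) (intro continuous_intros)
  have iGi: "integrable cellM (\<lambda>x. (G x $ i)\<^sup>2)" for i
  proof (rule Bochner_Integration.integrable_bound[OF iG])
    show "(\<lambda>x. (G x $ i)\<^sup>2) \<in> borel_measurable cellM" using mGi by (intro measurable_cellM) simp
    have "(G x $ i)\<^sup>2 \<le> (norm (G x))\<^sup>2" for x
      using component_le_norm_cart[of "G x" i] by (metis abs_ge_zero power2_abs power_mono)
    then show "AE x in cellM. norm ((G x $ i)\<^sup>2) \<le> norm ((norm (G x))\<^sup>2)" by (intro AE_I2) simp
  qed
  let ?E = "\<integral>x. Q x (G x) \<partial>cellM"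
  have \<kappa>0: "0 \<le> \<kappa>"
  proof -
    have "0 < ln ((1/2 - \<rho>) / \<rho>)" using \<rho> by (intro ln_gt_zero) (simp add: field_simps)
    then have "0 \<le> 6 * \<rho> + 3/2 * \<eta> * ln ((1/2 - \<rho>) / \<rho>) + 48 / ln ((1/2 - \<rho>) / \<rho>)"
      using \<rho> \<eta> by (intro add_nonneg_nonneg mult_nonneg_nonneg) auto
    then show ?thesis using \<kappa> by linarith
  qed
  have smooth_case: "\<exists>k. (\<integral>x. (\<phi> x - k)\<^sup>2 \<partial>cellM) \<le> \<kappa> * (\<integral>x. 2 * Q x (grad \<phi> x) \<partial>cellM)"
    if \<phi>: "smooth \<phi>" for \<phi>
  proof -
    have c: "continuous_on UNIV (\<lambda>x. 2 * Q x (grad \<phi> x))"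
      by (intro continuous_intros continuous_Q_comp smooth_continuous_on smooth_grad \<phi>)
    have d: "(\<phi> has_derivative (\<lambda>v. grad \<phi> x \<bullet> v)) (at x)" for x
    proof -
      have "frechet_derivative \<phi> (at x) = (\<lambda>v. grad \<phi> x \<bullet> v)"
        using frechet_derivative_eq_grad[OF smooth_differentiable[OF \<phi>]] by blast
      then show ?thesis using smooth_has_derivative[OF \<phi>, of x] by simp
    qed
    have rad: "(grad \<phi> (center + z) \<bullet> z)\<^sup>2 \<le> (norm z)\<^sup>2 * (\<eta> * (2 * Q (center + z) (grad \<phi> (center + z))))"
      if z: "\<rho> \<le> norm z" "\<And>i. \<bar>z $ i\<bar> \<le> 1/2 - \<rho>" for z
    proof -
      have "z \<noteq> 0" using z(1) \<rho> by auto
      from radial_sq_le_Q[OF \<gamma> this w[OF z], of "grad \<phi> (center + z)"]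
      show ?thesis
        using \<eta>(1) Q_nonneg[of "center + z" "grad \<phi> (center + z)"]
        by (elim order_trans) (intro mult_left_mono mult_right_mono, auto)
    qed
    obtain k where "(LINT x:cell|lborel. (\<phi> x - k)\<^sup>2) \<le>
      (6 * \<rho> + 3/2 * \<eta> * ln ((1/2 - \<rho>) / \<rho>) + 48 / ln ((1/2 - \<rho>) / \<rho>)) * (LINT x:cell|lborel. 2 * Q x (grad \<phi> x))"
      using focal_poincare[OF \<rho> \<eta>(2) d c inner_sq_le_Q rad] by blast
    also have "\<dots> \<le> \<kappa> * (LINT x:cell|lborel. 2 * Q x (grad \<phi> x))"
      by (intro mult_right_mono \<kappa>) (simp add: set_integral_cellM Bochner_Integration.integral_nonneg Q_nonneg)
    finally show ?thesis unfolding set_integral_cellM by blast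
  qed
  define a where "a N = (\<integral>x. (f x - conv N f x)\<^sup>2 \<partial>cellM)" for N
  define b where "b N i = (\<integral>x. (G x $ i - conv N (\<lambda>x. G x $ i) x)\<^sup>2 \<partial>cellM)" for N and i :: 2
  have step: "(\<integral>x. (f x)\<^sup>2 \<partial>cellM) \<le> 2 * (\<kappa> * (4 * ?E + 8 / (1 - t) * (b N 1 + b N 2))) + 2 * a N" for N
  proof -
    let ?\<phi> = "conv N f"
    have \<phi>: "smooth ?\<phi>" by (rule smooth_conv[OF f])
    have c\<phi>: "continuous_on UNIV ?\<phi>" by (rule smooth_continuous_on[OF \<phi>])
    have cg: "continuous_on UNIV (grad ?\<phi>)" by (intro smooth_continuous_on smooth_grad \<phi>)
    obtain k where k: "(\<integral>x. (?\<phi> x - k)\<^sup>2 \<partial>cellM) \<le> \<kappa> * (\<integral>x. 2 * Q x (grad ?\<phi> x) \<partial>cellM)"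
      using smooth_case[OF \<phi>] by blast
    have i1: "integrable cellM (\<lambda>x. (?\<phi> x - k)\<^sup>2)"
      by (intro integrable_continuous_cellM continuous_intros c\<phi>)
    have i2: "integrable cellM (\<lambda>x. (f x - ?\<phi> x)\<^sup>2)"
      by (rule integrable_diff_sq[OF f borel_measurable_continuous_onI[OF c\<phi>]])
        (intro integrable_continuous_cellM continuous_intros c\<phi>)
    have i0: "integrable cellM f" by (rule integrable_L2[OF f])
    \<comment> \<open>For mean zero the best constant is 0, so the unknown k can only increase the
      left-hand side.\<close>
    have "(\<integral>x. (f x - k)\<^sup>2 \<partial>cellM) = (\<integral>x. (f x)\<^sup>2 - 2 * k * f x + k\<^sup>2 \<partial>cellM)"
      by (simp add: power2_diff algebra_simps)
    also have "\<dots> = (\<integral>x. (f x)\<^sup>2 \<partial>cellM) - 2 * k * (\<integral>x. f x \<partial>cellM) + k\<^sup>2"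
      using f i0 by simp
    finally have "(\<integral>x. (f x)\<^sup>2 \<partial>cellM) \<le> (\<integral>x. (f x - k)\<^sup>2 \<partial>cellM)" using mean by simp
    also have "\<dots> \<le> (\<integral>x. 2 * (?\<phi> x - k)\<^sup>2 + 2 * (f x - ?\<phi> x)\<^sup>2 \<partial>cellM)"
    proof (rule integral_mono)
      show "integrable cellM (\<lambda>x. (f x - k)\<^sup>2)"
        by (rule integrable_diff_sq[OF f]) simp_all
      show "integrable cellM (\<lambda>x. 2 * (?\<phi> x - k)\<^sup>2 + 2 * (f x - ?\<phi> x)\<^sup>2)" using i1 i2 by simp
      show "(f x - k)\<^sup>2 \<le> 2 * (?\<phi> x - k)\<^sup>2 + 2 * (f x - ?\<phi> x)\<^sup>2" for x
        using zero_le_power2[of "(?\<phi> x - k) - (f x - ?\<phi> x)"] by (simp add: power2_eq_square algebra_simps)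
    qed
    also have "\<dots> = 2 * (\<integral>x. (?\<phi> x - k)\<^sup>2 \<partial>cellM) + 2 * a N"
      using i1 i2 by (simp add: a_def)
    finally have 1: "(\<integral>x. (f x)\<^sup>2 \<partial>cellM) \<le> 2 * (\<integral>x. (?\<phi> x - k)\<^sup>2 \<partial>cellM) + 2 * a N" .
    have iQ: "integrable cellM (\<lambda>x. Q x (G x))" by (rule integrable_Q[OF mG iG])
    have ib: "integrable cellM (\<lambda>x. (G x $ i - conv N (\<lambda>x. G x $ i) x)\<^sup>2)" for i
    proof (rule integrable_diff_sq[OF mGi iGi])
      have "continuous_on UNIV (conv N (\<lambda>x. G x $ i))"
        by (rule smooth_continuous_on[OF smooth_conv[OF mGi iGi]])
      then show "conv N (\<lambda>x. G x $ i) \<in> borel_measurable borel" "integrable cellM (\<lambda>x. (conv N (\<lambda>x. G x $ i) x)\<^sup>2)"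
        by (auto intro!: borel_measurable_continuous_onI integrable_continuous_cellM continuous_intros)
    qed
    have "(\<integral>x. 2 * Q x (grad ?\<phi> x) \<partial>cellM) \<le> (\<integral>x. 4 * Q x (G x) + 8 / (1 - t) *
        ((G x $ 1 - conv N (\<lambda>x. G x $ 1) x)\<^sup>2 + (G x $ 2 - conv N (\<lambda>x. G x $ 2) x)\<^sup>2) \<partial>cellM)"
    proof (rule integral_mono)
      show "integrable cellM (\<lambda>x. 2 * Q x (grad ?\<phi> x))"
        by (intro integrable_continuous_cellM continuous_intros continuous_Q_comp cg)
      show "integrable cellM (\<lambda>x. 4 * Q x (G x) + 8 / (1 - t) *
        ((G x $ 1 - conv N (\<lambda>x. G x $ 1) x)\<^sup>2 + (G x $ 2 - conv N (\<lambda>x. G x $ 2) x)\<^sup>2))"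
        using iQ ib by simp
      fix x
      have "(norm (grad ?\<phi> x - G x))\<^sup>2 = (G x $ 1 - conv N (\<lambda>x. G x $ 1) x)\<^sup>2 + (G x $ 2 - conv N (\<lambda>x. G x $ 2) x)\<^sup>2"
        unfolding power2_norm_eq_inner inner_2
        by (simp add: grad_conv[OF f G] power2_commute[of "G x $ _"] flip: power2_eq_square)
      then have "Q x (grad ?\<phi> x - G x) \<le> 2 / (1 - t) * ((G x $ 1 - conv N (\<lambda>x. G x $ 1) x)\<^sup>2 + (G x $ 2 - conv N (\<lambda>x. G x $ 2) x)\<^sup>2)"
        using Q_le[of x "grad ?\<phi> x - G x"] by simp
      then have "2 * Q x (grad ?\<phi> x) \<le> 4 * Q x (G x) + 4 * (2 / (1 - t) * ((G x $ 1 - conv N (\<lambda>x. G x $ 1) x)\<^sup>2 + (G x $ 2 - conv N (\<lambda>x. G x $ 2) x)\<^sup>2))"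
        using Q_triangle[of x "grad ?\<phi> x" "G x"] by linarith
      then show "2 * Q x (grad ?\<phi> x) \<le> 4 * Q x (G x) + 8 / (1 - t) * ((G x $ 1 - conv N (\<lambda>x. G x $ 1) x)\<^sup>2 + (G x $ 2 - conv N (\<lambda>x. G x $ 2) x)\<^sup>2)"
        by (simp add: mult.assoc[symmetric])
    qed
    also have "\<dots> = 4 * ?E + 8 / (1 - t) * (b N 1 + b N 2)"
      using iQ ib by (simp add: b_def)
    finally have "\<kappa> * (\<integral>x. 2 * Q x (grad ?\<phi> x) \<partial>cellM) \<le> \<kappa> * (4 * ?E + 8 / (1 - t) * (b N 1 + b N 2))"
      by (rule mult_left_mono[OF _ \<kappa>0])
    then show ?thesis using 1 k by linarith
  qed
  \<comment> \<open>t is fixed here, so 8 / (1 - t) is a constant in front of errors that vanish as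
    N grows; it leaves no trace in the result.\<close>
  have "(\<lambda>N. 2 * (\<kappa> * (4 * ?E + 8 / (1 - t) * (b N 1 + b N 2))) + 2 * a N)
      \<longlonglongrightarrow> 2 * (\<kappa> * (4 * ?E + 8 / (1 - t) * (0 + 0))) + 2 * 0"
    unfolding a_def b_def by (intro tendsto_intros conv_L2_tendsto f mGi iGi)
  then have "(\<integral>x. (f x)\<^sup>2 \<partial>cellM) \<le> 2 * (\<kappa> * (4 * ?E + 8 / (1 - t) * (0 + 0))) + 2 * 0"
    by (rule LIMSEQ_le_const) (use step in blast)
  then show ?thesis by simp
qed

end

section \<open>The first eigenvalue\<close>

text \<open>Every point lies in one of countably many integer translates of the cell, and each
  translate has only a null set of exceptions.\<close>

lemma AE_cellM_periodic:
  assumes f: "torus_periodic f" and AE: "AE x in cellM. P (f x)"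
  shows "AE x in lborel. P (f x)"
proof -
  have cell: "AE x in lborel. x \<in> cell \<longrightarrow> P (f x)"
    using AE by (simp add: AE_restrict_space_iff)
  have "AE x in lborel. k + x \<in> cell \<longrightarrow> P (f (k + x))" for k :: "real^2"
    by (rule AE_distrD[of "(+) k" lborel borel]) (simp, unfold lborel_distr_plus, rule cell)
  then have "AE x in lborel. \<forall>p q :: int. vector [of_int p, of_int q] + x \<in> cell \<longrightarrow> P (f (vector [of_int p, of_int q] + x))"
    by (simp add: AE_all_countable)
  then show ?thesis
  proof eventually_elim
    case (elim x)
    let ?k = "vector [of_int (- \<lfloor>x $ 1\<rfloor>), of_int (- \<lfloor>x $ 2\<rfloor>)] :: real^2"
    have "0 \<le> x $ i - of_int \<lfloor>x $ i\<rfloor>" "x $ i - of_int \<lfloor>x $ i\<rfloor> \<le> 1" for i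
      by linarith+
    then have "?k + x \<in> cell"
      by (simp add: cell_def forall_2)
    then have "P (f (?k + x))" using elim by blast
    moreover have "?k \<in> lattice" by (simp add: lattice_def forall_2)
    then have "f (x + ?k) = f x" using f by (simp only: torus_periodic_def)
    ultimately show ?case by (simp only: add.commute)
  qed
qed

section \<open>Linearity of the Sobolev space\<close>

lemma is_weak_grad_add:
  assumes f: "f \<in> borel_measurable borel" "integrable cellM (\<lambda>x. (f x)\<^sup>2)" "is_weak_grad f G"
    and g: "g \<in> borel_measurable borel" "integrable cellM (\<lambda>x. (g x)\<^sup>2)" "is_weak_grad g H"
  shows "is_weak_grad (\<lambda>x. a * f x + b * g x) (\<lambda>x. a *\<^sub>R G x + b *\<^sub>R H x)"
  unfolding is_weak_grad_def set_integral_cellM set_integrable_cell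
proof (intro conjI allI impI)
  have G: "G \<in> borel_measurable borel" "torus_periodic G" "integrable cellM (\<lambda>x. (norm (G x))\<^sup>2)"
    and H: "H \<in> borel_measurable borel" "torus_periodic H" "integrable cellM (\<lambda>x. (norm (H x))\<^sup>2)"
    using f(3) g(3) by (auto simp: is_weak_grad_def set_integrable_cell)
  show m: "(\<lambda>x. a *\<^sub>R G x + b *\<^sub>R H x) \<in> borel_measurable borel"
    using G(1) H(1) by simp
  show "torus_periodic (\<lambda>x. a *\<^sub>R G x + b *\<^sub>R H x)"
    using G(2) H(2) by (simp add: torus_periodic_def)
  show "integrable cellM (\<lambda>x. (norm (a *\<^sub>R G x + b *\<^sub>R H x))\<^sup>2)"
  proof (rule Bochner_Integration.integrable_bound[of _ "\<lambda>x. 2 * (a\<^sup>2 * (norm (G x))\<^sup>2) + 2 * (b\<^sup>2 * (norm (H x))\<^sup>2)"])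
    show "integrable cellM (\<lambda>x. 2 * (a\<^sup>2 * (norm (G x))\<^sup>2) + 2 * (b\<^sup>2 * (norm (H x))\<^sup>2))"
      using G(3) H(3) by simp
    show "(\<lambda>x. (norm (a *\<^sub>R G x + b *\<^sub>R H x))\<^sup>2) \<in> borel_measurable cellM"
      using m by (intro measurable_cellM) simp
    have le: "(norm (a *\<^sub>R G x + b *\<^sub>R H x))\<^sup>2 \<le> 2 * (a\<^sup>2 * (norm (G x))\<^sup>2) + 2 * (b\<^sup>2 * (norm (H x))\<^sup>2)" for x
    proof -
      have "(norm (a *\<^sub>R G x + b *\<^sub>R H x))\<^sup>2 \<le> (norm (a *\<^sub>R G x) + norm (b *\<^sub>R H x))\<^sup>2"
        by (intro power_mono norm_triangle_ineq) simp
      also have "\<dots> \<le> 2 * (norm (a *\<^sub>R G x))\<^sup>2 + 2 * (norm (b *\<^sub>R H x))\<^sup>2"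
        using zero_le_power2[of "norm (a *\<^sub>R G x) - norm (b *\<^sub>R H x)"] by (simp only: power2_eq_square) (simp add: algebra_simps)
      finally show ?thesis by (simp add: power_mult_distrib)
    qed
    show "AE x in cellM. norm ((norm (a *\<^sub>R G x + b *\<^sub>R H x))\<^sup>2) \<le>
        norm (2 * (a\<^sup>2 * (norm (G x))\<^sup>2) + 2 * (b\<^sup>2 * (norm (H x))\<^sup>2))"
      unfolding real_norm_def abs_power2 by (intro AE_I2 order_trans[OF le abs_ge_self])
  qed
  fix \<phi> :: "real^2 \<Rightarrow> real" and i :: 2
  assume \<phi>: "smooth \<phi>" "torus_periodic \<phi>"
  have comp: "(\<lambda>x. G x $ i) \<in> borel_measurable borel" "integrable cellM (\<lambda>x. (G x $ i)\<^sup>2)"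
    if "G \<in> borel_measurable borel" "integrable cellM (\<lambda>x. (norm (G x))\<^sup>2)" for G :: "real^2 \<Rightarrow> real^2"
  proof -
    show m: "(\<lambda>x. G x $ i) \<in> borel_measurable borel"
      by (rule measurable_compose[OF that(1) borel_measurable_continuous_onI]) (intro continuous_intros)
    have "(G x $ i)\<^sup>2 \<le> (norm (G x))\<^sup>2" for x
      using component_le_norm_cart[of "G x" i] by (metis abs_ge_zero power2_abs power_mono)
    then show "integrable cellM (\<lambda>x. (G x $ i)\<^sup>2)"
      using m by (intro Bochner_Integration.integrable_bound[OF that(2)] measurable_cellM AE_I2) simp_all
  qed
  have c1: "continuous_on UNIV (\<lambda>x. grad \<phi> x $ i)" and c2: "continuous_on UNIV \<phi>"
    by (intro smooth_continuous_on smooth_intros \<phi>)+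
  have i1: "integrable cellM (\<lambda>x. f x * grad \<phi> x $ i)" "integrable cellM (\<lambda>x. g x * grad \<phi> x $ i)"
    using integrable_continuous_mult_L2[OF f(1,2) c1] integrable_continuous_mult_L2[OF g(1,2) c1]
    by (simp_all add: mult.commute)
  have i2: "integrable cellM (\<lambda>x. G x $ i * \<phi> x)" "integrable cellM (\<lambda>x. H x $ i * \<phi> x)"
    using integrable_continuous_mult_L2[OF comp[OF G(1,3)] c2] integrable_continuous_mult_L2[OF comp[OF H(1,3)] c2]
    by (simp_all add: mult.commute)
  have parts: "(\<integral>x. f x * grad \<phi> x $ i \<partial>cellM) = - (\<integral>x. G x $ i * \<phi> x \<partial>cellM)"
    "(\<integral>x. g x * grad \<phi> x $ i \<partial>cellM) = - (\<integral>x. H x $ i * \<phi> x \<partial>cellM)"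
    using f(3) g(3) \<phi> unfolding is_weak_grad_def set_integral_cellM by blast+
  have "(\<integral>x. (a * f x + b * g x) * grad \<phi> x $ i \<partial>cellM)
      = (\<integral>x. a * (f x * grad \<phi> x $ i) + b * (g x * grad \<phi> x $ i) \<partial>cellM)"
    by (simp add: algebra_simps)
  also have "\<dots> = a * (\<integral>x. f x * grad \<phi> x $ i \<partial>cellM) + b * (\<integral>x. g x * grad \<phi> x $ i \<partial>cellM)"
    using i1 by simp
  also have "\<dots> = - (a * (\<integral>x. G x $ i * \<phi> x \<partial>cellM) + b * (\<integral>x. H x $ i * \<phi> x \<partial>cellM))"
    by (simp add: parts)
  also have "a * (\<integral>x. G x $ i * \<phi> x \<partial>cellM) + b * (\<integral>x. H x $ i * \<phi> x \<partial>cellM)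
      = (\<integral>x. a * (G x $ i * \<phi> x) + b * (H x $ i * \<phi> x) \<partial>cellM)"
    using i2 by simp
  also have "\<dots> = (\<integral>x. (a *\<^sub>R G x + b *\<^sub>R H x) $ i * \<phi> x \<partial>cellM)"
    by (simp add: algebra_simps)
  finally show "(\<integral>x. (a * f x + b * g x) * grad \<phi> x $ i \<partial>cellM) = - (\<integral>x. (a *\<^sub>R G x + b *\<^sub>R H x) $ i * \<phi> x \<partial>cellM)" .
qed

lemma H1_D:
  assumes "f \<in> H1"
  shows "f \<in> borel_measurable borel" "torus_periodic f" "integrable cellM (\<lambda>x. (f x)\<^sup>2)"
    "is_weak_grad f (weak_grad f)"
proof -
  show "f \<in> borel_measurable borel" "torus_periodic f" "integrable cellM (\<lambda>x. (f x)\<^sup>2)"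
    using assms by (auto simp: H1_def set_integrable_cell)
  have "\<exists>G. is_weak_grad f G" using assms by (simp add: H1_def)
  then show "is_weak_grad f (weak_grad f)"
    unfolding weak_grad_def by (rule someI_ex)
qed

lemma H1_add:
  assumes f: "f \<in> H1" and g: "g \<in> H1"
  shows "(\<lambda>x. a * f x + b * g x) \<in> H1"
proof -
  note F = H1_D[OF f] and G = H1_D[OF g]
  have "(\<lambda>x. a * f x + b * g x) \<in> borel_measurable borel" using F(1) G(1) by simp
  moreover have "torus_periodic (\<lambda>x. a * f x + b * g x)" using F(2) G(2) by (simp add: torus_periodic_def)
  moreover have "integrable cellM (\<lambda>x. (a * f x - (- b) * g x)\<^sup>2)"
    by (rule integrable_diff_sq) (use F(1,3) G(1,3) in \<open>simp_all add: power_mult_distrib\<close>)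
  then have "integrable cellM (\<lambda>x. (a * f x + b * g x)\<^sup>2)" by simp
  ultimately show ?thesis
    using is_weak_grad_add[OF F(1,3,4) G(1,3,4)] by (auto simp: H1_def set_integrable_cell)
qed

context randers_potential
begin

text \<open>The mean is a single linear functional, so every two-dimensional subspace contains a
  nonzero function of mean zero. Its Rayleigh quotient bounds the supremum over that subspace from
  below.\<close>

lemma eigenvalue_ge:
  assumes B: "0 < B"
    and poincare: "\<And>f. f \<in> H1 \<Longrightarrow> (\<integral>x. f x \<partial>cellM) = 0 \<Longrightarrow>
      (\<integral>x. (f x)\<^sup>2 \<partial>cellM) \<le> B * (\<integral>x. Q x (weak_grad f x) \<partial>cellM)"
  shows "ereal (1 / B) \<le> eigenvalue 1 F"
  unfolding eigenvalue_def
proof (rule INF_greatest)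
  fix V assume "V \<in> {V. H1_subspace (1 + 1) V}"
  then have "H1_subspace 2 V" by (simp add: numeral_2_eq_2)
  then obtain b :: "nat \<Rightarrow> real^2 \<Rightarrow> real" where b: "\<And>i. i < 2 \<Longrightarrow> b i \<in> H1"
    and indep: "\<And>c. (AE x in lborel. (\<Sum>i<2. c i * b i x) = 0) \<Longrightarrow> (\<forall>i<2. c i = 0)"
    and V: "V = {f \<in> H1. \<exists>c. AE x in lborel. f x = (\<Sum>i<2. c i * b i x)}"
    unfolding H1_subspace_def by blast
  have b01: "b 0 \<in> H1" "b 1 \<in> H1" using b by auto
  let ?I = "\<lambda>i. \<integral>x. b i x \<partial>cellM"
  \<comment> \<open>The combination - I1 b0 + I0 b1 has mean zero; it could be trivial when I0 = 0,
    but then b0 itself has mean zero.\<close>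
  define c where "c i = (if ?I 0 = 0 then if i = 0 then 1 else 0 else if i = 0 then - ?I 1 else ?I 0)" for i :: nat
  define f where "f x = (\<Sum>i<2. c i * b i x)" for x
  have f2: "f = (\<lambda>x. c 0 * b 0 x + c 1 * b 1 x)"
    by (simp add: fun_eq_iff f_def numeral_2_eq_2)
  have fH: "f \<in> H1" unfolding f2 by (rule H1_add[OF b01])
  have fV: "f \<in> V" unfolding V using fH by (auto simp: f_def)
  have "\<not> (\<forall>i<2. c i = 0)"
  proof
    assume "\<forall>i<2. c i = 0"
    then have "c 0 = 0" "c 1 = 0" by simp_all
    then show False by (simp add: c_def split: if_splits)
  qed
  then have nz: "\<not> (AE x in lborel. f x = 0)"
    using indep[of c] unfolding f_def by blast
  have "integrable cellM (b 0)" "integrable cellM (b 1)"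
    using H1_D(1,3)[OF b01(1)] H1_D(1,3)[OF b01(2)] by (auto intro: integrable_L2)
  then have mean: "(\<integral>x. f x \<partial>cellM) = 0"
    by (simp add: f2 c_def)
  note f = H1_D[OF fH]
  have G: "weak_grad f \<in> borel_measurable borel" "integrable cellM (\<lambda>x. (norm (weak_grad f x))\<^sup>2)"
    using f(4) by (auto simp: is_weak_grad_def set_integrable_cell)
  have "(\<integral>x. (f x)\<^sup>2 \<partial>cellM) \<noteq> 0"
  proof
    assume "(\<integral>x. (f x)\<^sup>2 \<partial>cellM) = 0"
    then have "AE x in cellM. f x = 0"
      using integral_nonneg_eq_0_iff_AE[OF f(3)] by simp
    then show False
      using nz AE_cellM_periodic[OF f(2), of "\<lambda>y. y = 0"] by blast
  qed
  moreover have "0 \<le> (\<integral>x. (f x)\<^sup>2 \<partial>cellM)"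
    by (intro Bochner_Integration.integral_nonneg) simp
  ultimately have pos: "0 < (\<integral>x. (f x)\<^sup>2 \<partial>cellM)" by linarith
  have "1 / B \<le> (\<integral>x. Q x (weak_grad f x) \<partial>cellM) / (\<integral>x. (f x)\<^sup>2 \<partial>cellM)"
    using poincare[OF fH mean] B pos by (simp add: field_simps)
  also have "\<dots> = rayleigh F f"
    by (simp add: rayleigh_def ht_density_eq set_integral_cellM energy_eq[OF refl G])
  finally have le: "ereal (1 / B) \<le> ereal (rayleigh F f)" by simp
  show "ereal (1 / B) \<le> (SUP f\<in>{f \<in> V. \<not> (AE x in lborel. f x = 0)}. ereal (rayleigh F f))"
  proof (rule SUP_upper2)
    show "f \<in> {f \<in> V. \<not> (AE x in lborel. f x = 0)}" using fV nz by simp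
  qed (rule le)
qed

end

text \<open>\<rho> is chosen first, small enough for the terms without \<eta>, of which 48 / ln
  tends to 0 only logarithmically. With \<rho> and hence the logarithm fixed, \<eta> makes the
  middle term equal to \<kappa> / 2.\<close>

lemma exists_small_constants:
  fixes \<kappa> :: real
  assumes "0 < \<kappa>"
  obtains \<rho> \<eta> where "0 < \<rho>" "\<rho> < 1/4" "0 < \<eta>"
    "6 * \<rho> + 3/2 * \<eta> * ln ((1/2 - \<rho>) / \<rho>) + 48 / ln ((1/2 - \<rho>) / \<rho>) \<le> \<kappa>"
proof -
  have "((\<lambda>\<rho>::real. 6 * \<rho> + 48 / ln ((1/2 - \<rho>) / \<rho>)) \<longlongrightarrow> 0) (at_right 0)"
    by real_asymp
  then have "\<forall>\<^sub>F \<rho> in at_right 0. 6 * \<rho> + 48 / ln ((1/2 - \<rho>) / \<rho>) < \<kappa> / 2"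
    using assms by (intro order_tendstoD(2)[of _ 0]) auto
  moreover have "\<forall>\<^sub>F \<rho>::real in at_right 0. 0 < \<rho> \<and> \<rho> < 1/4"
    by (auto simp: eventually_at_right_field intro!: exI[of _ "1/4"])
  ultimately have "\<forall>\<^sub>F \<rho> in at_right 0. 6 * \<rho> + 48 / ln ((1/2 - \<rho>) / \<rho>) < \<kappa> / 2 \<and> 0 < \<rho> \<and> \<rho> < 1/4"
    by eventually_elim auto
  then obtain \<rho> where \<rho>: "6 * \<rho> + 48 / ln ((1/2 - \<rho>) / \<rho>) < \<kappa> / 2" "0 < \<rho>" "\<rho> < 1/4"
    using eventually_happens trivial_limit_at_right_real by blast
  have L: "0 < ln ((1/2 - \<rho>) / \<rho>)" using \<rho> by (intro ln_gt_zero) (simp add: field_simps)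
  define \<eta> where "\<eta> = \<kappa> / (3 * ln ((1/2 - \<rho>) / \<rho>))"
  have "3/2 * \<eta> * ln ((1/2 - \<rho>) / \<rho>) = \<kappa> / 2" using L by (simp add: \<eta>_def)
  moreover have "0 < \<eta>" using L assms by (simp add: \<eta>_def)
  ultimately show thesis using \<rho> by (intro that[of \<rho> \<eta>]) linarith+
qed

text \<open>Since \<gamma> - sin \<gamma> is of third order, the part without \<mu> is O(\<gamma>)
  and determines the window. The other part behaves like \<mu> / sin \<gamma>, so \<mu> can be fixed
  only afterwards, with the value that makes it \<eta> / 2.\<close>

lemma exists_small_window:
  fixes \<eta> :: real
  assumes "0 < \<eta>"
  obtains \<gamma> \<mu> where "0 < \<gamma>" "\<gamma> < pi" "0 < \<mu>" "pi * (\<gamma> - sin \<gamma> + \<mu> * sin \<gamma>) / (4 * (sin \<gamma>)\<^sup>2) \<le> \<eta>"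
proof -
  have "((\<lambda>\<gamma>::real. pi * (\<gamma> - sin \<gamma>) / (4 * (sin \<gamma>)\<^sup>2)) \<longlongrightarrow> 0) (at_right 0)"
    by real_asymp
  then have "\<forall>\<^sub>F \<gamma> in at_right 0. pi * (\<gamma> - sin \<gamma>) / (4 * (sin \<gamma>)\<^sup>2) < \<eta> / 2"
    using assms by (intro order_tendstoD(2)[of _ 0]) auto
  moreover have "\<forall>\<^sub>F \<gamma>::real in at_right 0. 0 < \<gamma> \<and> \<gamma> < pi"
    by (auto simp: eventually_at_right_field intro!: exI[of _ pi])
  ultimately have "\<forall>\<^sub>F \<gamma> in at_right 0. pi * (\<gamma> - sin \<gamma>) / (4 * (sin \<gamma>)\<^sup>2) < \<eta> / 2 \<and> 0 < \<gamma> \<and> \<gamma> < pi"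
    by eventually_elim auto
  then obtain \<gamma> where \<gamma>: "pi * (\<gamma> - sin \<gamma>) / (4 * (sin \<gamma>)\<^sup>2) < \<eta> / 2" "0 < \<gamma>" "\<gamma> < pi"
    using eventually_happens trivial_limit_at_right_real by blast
  have s: "0 < sin \<gamma>" using \<gamma> by (simp add: sin_gt_zero)
  define \<mu> where "\<mu> = 2 * \<eta> * sin \<gamma> / pi"
  have "pi * (\<gamma> - sin \<gamma> + \<mu> * sin \<gamma>) / (4 * (sin \<gamma>)\<^sup>2)
    = pi * (\<gamma> - sin \<gamma>) / (4 * (sin \<gamma>)\<^sup>2) + pi * (\<mu> * sin \<gamma>) / (4 * (sin \<gamma>)\<^sup>2)"
    by (simp add: distrib_left add_divide_distrib)
  also have "pi * (\<mu> * sin \<gamma>) / (4 * (sin \<gamma>)\<^sup>2) = \<eta> / 2"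
    using s by (simp add: \<mu>_def power2_eq_square)
  finally have "pi * (\<gamma> - sin \<gamma> + \<mu> * sin \<gamma>) / (4 * (sin \<gamma>)\<^sup>2) \<le> \<eta>"
    using \<gamma>(1) by linarith
  moreover have "0 < \<mu>" using s assms by (simp add: \<mu>_def)
  ultimately show thesis using \<gamma> by (intro that)
qed

lemma eigenvalue_potential_large:
  fixes M :: real
  assumes M: "0 < M"
  obtains \<delta> where "0 < \<delta>" "\<And>e t. 0 < e \<Longrightarrow> e < 1 \<Longrightarrow> e < \<delta> \<Longrightarrow> 0 \<le> t \<Longrightarrow> t < 1 \<Longrightarrow> 1 - \<delta> < t \<Longrightarrow>
    ereal M \<le> eigenvalue 1 (randers flat_metric (\<lambda>x v. t * frechet_derivative (potential e) (at x) v))"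
proof -
  \<comment> \<open>Compensates the factor 8 in \<open>poincare_energy\<close>, so that the
    resulting lower bound is exactly M.\<close>
  define \<kappa> where "\<kappa> = 1 / (8 * M)"
  have \<kappa>: "0 < \<kappa>" using M by (simp add: \<kappa>_def)
  obtain \<rho> \<eta> where \<rho>: "0 < \<rho>" "\<rho> < 1/4" and \<eta>: "0 < \<eta>"
    and K: "6 * \<rho> + 3/2 * \<eta> * ln ((1/2 - \<rho>) / \<rho>) + 48 / ln ((1/2 - \<rho>) / \<rho>) \<le> \<kappa>"
    using exists_small_constants[OF \<kappa>] by blast
  obtain \<gamma> \<mu> where \<gamma>: "0 < \<gamma>" "\<gamma> < pi" and \<mu>: "0 < \<mu>"
    and win: "pi * (\<gamma> - sin \<gamma> + \<mu> * sin \<gamma>) / (4 * (sin \<gamma>)\<^sup>2) \<le> \<eta>"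
    using exists_small_window[OF \<eta>] by blast
  define c where "c = 4 / (sin (pi * \<rho>))\<^sup>2 + 1 / \<rho>"
  have c: "0 < c" using \<rho> by (simp add: c_def add_nonneg_pos)
  \<comment> \<open>The first entry provides the hypothesis e c <= 1 of
    \<open>grad_potential_radial\<close>. The other two give 1 - t <= \<mu> / 2 and e c <= \<mu> /
    2, so that t (1 - e c) is at least 1 - \<mu>.\<close>
  define \<delta> where "\<delta> = min (1 / c) (min (\<mu> / 2) (\<mu> / (2 * c)))"
  have \<delta>: "0 < \<delta>" using c \<mu> by (simp add: \<delta>_def)
  show thesis
  proof (rule that[OF \<delta>])
    fix e t :: real
    assume e: "0 < e" "e < 1" "e < \<delta>" and t: "0 \<le> t" "t < 1" "1 - \<delta> < t"
    interpret randers_potential "potential e" t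
      by (rule randers_potential_potential[OF e(1,2) t(1,2)])
    have ec: "e * c \<le> 1" "e * c \<le> \<mu> / 2"
      using e(3) c by (simp_all add: \<delta>_def field_simps)
    have t': "1 - \<mu> / 2 \<le> t" using t(3) by (simp add: \<delta>_def)
    have w: "(1 - \<mu>) * norm z \<le> w (center + z) \<bullet> z"
      if z: "\<rho> \<le> norm z" "\<And>i. \<bar>z $ i\<bar> \<le> 1/2 - \<rho>" for z
    proof -
      have "(1 - e * c) * norm z \<le> grad (potential e) (center + z) \<bullet> z"
        unfolding c_def by (rule grad_potential_radial[OF e(1,2) \<rho>(1) _ z(2,1)]) (use ec in \<open>simp add: c_def\<close>)
      then have "t * ((1 - e * c) * norm z) \<le> w (center + z) \<bullet> z"
        using mult_left_mono[OF _ t(1)] by (simp add: w_def)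
      moreover have "1 - \<mu> \<le> t * (1 - e * c)"
      proof -
        have "t * (e * c) \<le> 1 * (e * c)" using t e c by (intro mult_right_mono) auto
        then show ?thesis using ec t' by (simp add: right_diff_distrib)
      qed
      then have "(1 - \<mu>) * norm z \<le> t * (1 - e * c) * norm z"
        by (intro mult_right_mono) auto
      ultimately show ?thesis by (simp add: mult.assoc)
    qed
    have "ereal (1 / (8 * \<kappa>)) \<le> eigenvalue 1 F"
    proof (rule eigenvalue_ge)
      fix f assume f: "f \<in> H1" and mean: "(\<integral>x. f x \<partial>cellM) = 0"
      show "(\<integral>x. (f x)\<^sup>2 \<partial>cellM) \<le> 8 * \<kappa> * (\<integral>x. Q x (weak_grad f x) \<partial>cellM)"
        by (rule poincare_energy[OF \<rho> \<gamma> less_imp_le[OF \<mu>] w win less_imp_le[OF \<eta>] K H1_D(1,3)[OF f] mean H1_D(4)[OF f]])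
    qed (use \<kappa> in simp)
    then show "ereal M \<le> eigenvalue 1 F"
      using M by (simp add: \<kappa>_def)
  qed
qed

theorem theorem2:
  shows "\<exists>(\<epsilon>0 :: real) > 0. \<exists>h :: real \<Rightarrow> real^2 \<Rightarrow> real.
    let F = (\<lambda>\<epsilon> t. randers flat_metric (\<lambda>x v. t * frechet_derivative (h \<epsilon>) (at x) v)) in
    (\<forall>\<epsilon>\<in>{0<..<\<epsilon>0}. smooth (h \<epsilon>) \<and> torus_periodic (h \<epsilon>)) \<and>
    (AE x in lborel. \<exists>u :: real^2. norm u = 1 \<and> u $ 1 \<noteq> 0 \<and> u $ 2 / u $ 1 \<notin> \<rat> \<and>
       ((\<lambda>\<epsilon>. grad (h \<epsilon>) x) \<longlongrightarrow> u) (at_right 0)) \<and>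
    (\<forall>\<epsilon>\<in>{0<..<\<epsilon>0}. \<forall>t\<in>{0..<1}. randers_metric (F \<epsilon> t)) \<and>
    (\<forall>\<epsilon>\<in>{0<..<\<epsilon>0}. \<forall>t\<in>{0..<1}.
       ht_volume (F \<epsilon> t) = ht_volume flat_finsler \<and>
       same_geodesic_flow_up_to_trivial_time_change flat_finsler (F \<epsilon> t) \<and>
       same_marked_length_spectrum (F \<epsilon> t) flat_finsler) \<and>
    ((\<lambda>(\<epsilon>, t). eigenvalue 1 (F \<epsilon> t)) \<longlongrightarrow> \<infinity>) (at (0, 1) within {0<..<\<epsilon>0} \<times> {0..<1})"
proof (intro exI[of _ 1] exI[of _ potential] conjI, simp, unfold Let_def, intro conjI ballI)
  fix \<epsilon> :: real assume "\<epsilon> \<in> {0<..<1}"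
  then show "smooth (potential \<epsilon>)" "torus_periodic (potential \<epsilon>)"
    by (auto simp: smooth_potential periodic_potential)
next
  show "AE x in lborel. \<exists>u :: real^2. norm u = 1 \<and> u $ 1 \<noteq> 0 \<and> u $ 2 / u $ 1 \<notin> \<rat> \<and>
       ((\<lambda>\<epsilon>. grad (potential \<epsilon>) x) \<longlongrightarrow> u) (at_right 0)"
    by (rule AE_grad_potential_tendsto)
next
  fix \<epsilon> t :: real assume "\<epsilon> \<in> {0<..<1}" "t \<in> {0..<1}"
  then interpret randers_potential "potential \<epsilon>" t
    by (intro randers_potential_potential) auto
  show "randers_metric F" by (rule randers_metric_F)
  show "ht_volume F = ht_volume flat_finsler" by (rule same_volume)
  show "same_geodesic_flow_up_to_trivial_time_change flat_finsler F" by (rule same_flow)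
  show "same_marked_length_spectrum F flat_finsler" by (rule same_spectrum)
next
  let ?S = "{0<..<1} \<times> {0..<1} :: (real \<times> real) set"
  show "((\<lambda>(\<epsilon>, t). eigenvalue 1 (randers flat_metric (\<lambda>x v. t * frechet_derivative (potential \<epsilon>) (at x) v)))
    \<longlongrightarrow> \<infinity>) (at (0, 1) within ?S)"
    unfolding tendsto_PInfty
  proof
    fix r :: real
    \<comment> \<open>The threshold has to be positive for
      \<open>eigenvalue_potential_large\<close>, and the extra 1 turns its weak inequality into a
      strict one.\<close>
    have "0 < max r 0 + 1" by simp
    then obtain \<delta> where \<delta>: "0 < \<delta>" "\<And>e t. 0 < e \<Longrightarrow> e < 1 \<Longrightarrow> e < \<delta> \<Longrightarrow> 0 \<le> t \<Longrightarrow> t < 1 \<Longrightarrow> 1 - \<delta> < t \<Longrightarrow>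
      ereal (max r 0 + 1) \<le> eigenvalue 1 (randers flat_metric (\<lambda>x v. t * frechet_derivative (potential e) (at x) v))"
      using eigenvalue_potential_large by blast
    have r: "ereal r < ereal (max r 0 + 1)" by simp
    have "ereal r < eigenvalue 1 (randers flat_metric (\<lambda>x v. t * frechet_derivative (potential e) (at x) v))"
      if "(e, t) \<in> ?S" "dist (e, t) (0, 1) < \<delta>" for e t
    proof -
      have "\<bar>e\<bar> \<le> dist (e, t) (0, 1)" "\<bar>t - 1\<bar> \<le> dist (e, t) (0, 1)"
        using dist_fst_le[of "(e, t)" "(0, 1)"] dist_snd_le[of "(e, t)" "(0, 1)"] by (simp_all add: dist_real_def)
      then have "e < \<delta>" "1 - \<delta> < t" using that(2) by linarith+
      then show ?thesis
        using that(1) by (intro less_le_trans[OF r \<delta>(2)]) auto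
    qed
    then show "\<forall>\<^sub>F x in at (0, 1) within ?S.
      ereal r < (case x of (\<epsilon>, t) \<Rightarrow> eigenvalue 1 (randers flat_metric (\<lambda>x v. t * frechet_derivative (potential \<epsilon>) (at x) v)))"
      unfolding eventually_at using \<delta>(1) by (intro exI[of _ \<delta>]) auto
  qed
qed

end
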